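(* Let $n\ge 2$ be an integer, let $S=\{s_1,\dots,s_{n-1}\}$ and let $e,q,o$ be three further letters. Let $\xi:(S\cup\{e,q,o\})^*\to\mathcal{RP}_n$ be the monoid homomorphism determined by $s_i\mapsto\overline s_i$, $e\mapsto\overline e_1$, $q\mapsto\overline q_1$, $o\mapsto\overline o_1$. Then the rook partition monoid $\mathcal{RP}_n$ has monoid presentation $\langle S\cup\{e,q,o\}:R\rangle$ via $\xi$, where $R$ consists of the following relations (any relation involving a letter $s_i$ with $i>n-1$ being omitted): $s_i^2=1$ for all $i$; $s_is_j=s_js_i$ if $|i-j|>1$; $s_is_js_i=s_js_is_j$ if $|i-j|=1$; $e^2=e=eqe=eoe$; $q^2=q=qeq=qs_1=s_1q$; $es_i=s_ie$ if $i\ge2$; $qs_i=s_iq$ if $i\ge3$; $s_1es_1e=es_1es_1=es_1e$; $qs_2qs_2=s_2qs_2q$; $q(s_2s_1s_3s_2)q(s_2s_1s_3s_2)=(s_2s_1s_3s_2)q(s_2s_1s_3s_2)q$; $q(s_2s_1es_1s_2)=(s_2s_1es_1s_2)q$; $o^2=o=oeo$; $os_i=s_io$ if $i\ge2$; $os_1os_1=s_1os_1o=os_1o=oq=qo$; $es_1os_1=s_1os_1e$; $q(s_2s_1os_1s_2)=(s_2s_1os_1s_2)q$.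
   Context: Write $[n]=\{1,\dots,n\}$, $[n]'=\{1',\dots,n'\}$, $[n]''=\{1'',\dots,n''\}$. A rook partition of degree $n$ is a collection of pairwise disjoint non-empty subsets (called blocks) of $[n]\cup[n]'$; elements of $[n]\cup[n]'$ lying in no block are its rook dots. $\mathcal{RP}_n$ is the set of all rook partitions of degree $n$. Product: for $\alpha,\beta\in\mathcal{RP}_n$, relabel each $i'$ of $\alpha$ as $i''$ to get $\alpha_\vee$, and relabel each $i$ of $\beta$ as $i''$ to get $\beta^\wedge$. Let $\Gamma(\alpha,\beta)$ be the graph on $[n]\cup[n]'\cup[n]''$ in which two vertices are adjacent if they lie in a common block of $\alpha_\vee$ or a common block of $\beta^\wedge$; a vertex is white if it is a rook dot of $\alpha_\vee$ or of $\beta^\wedge$, and black otherwise. Then $\alpha\beta$ is the rook partition such that $x\in[n]\cup[n]'$ is a rook dot of $\alpha\beta$ iff $x$ is connected by a (possibly empty) path to a white vertex in $\Gamma(\alpha,\beta)$, and two elements of $[n]\cup[n]'$ that are not rook dots of $\alpha\beta$ are in the same block iff they are connected by a path in $\Gamma(\alpha,\beta)$. This makes $\mathcal{RP}_n$ a monoid with identity $\{\{1,1'\},\dots,\{n,n'\}\}$. Elements: $\overline s_i$ has blocks $\{i,(i+1)'\},\{i+1,i'\}$ and $\{j,j'\}$ for $j\notin\{i,i+1\}$; $\overline e_1$ has blocks $\{1\},\{1'\}$ and $\{j,j'\}$ for $j\ne 1$; $\overline q_1$ has blocks $\{1,2,1',2'\}$ and $\{j,j'\}$ for $j\ge3$;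 $\overline o_1$ has blocks $\{j,j'\}$ for $j\neq 1$ and rook dots $1,1'$. $X^*$ is the free monoid on $X$, with empty word $1$. A monoid $M$ has monoid presentation $\langle X:R\rangle$ via $\phi$ if $\phi:X^*\to M$ is a surjective monoid homomorphism whose kernel $\{(u,v):u\phi=v\phi\}$ is the congruence on $X^*$ generated by $R$. *)

theory Defs
  imports "HOL-Algebra.Group" "HOL-Library.Disjoint_Sets"
begin

section \<open>Monoid presentations\<close>

definition free_monoid :: "'a set \<Rightarrow> 'a list monoid" where
  "free_monoid X = \<lparr>carrier = lists X, mult = (@), one = []\<rparr>"

definition is_monoid_hom :: "('a, 'm) monoid_scheme \<Rightarrow> ('b, 'k) monoid_scheme \<Rightarrow> ('a \<Rightarrow> 'b) \<Rightarrow> bool" where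
  "is_monoid_hom M N h \<longleftrightarrow> h \<in> hom M N \<and> h \<one>\<^bsub>M\<^esub> = \<one>\<^bsub>N\<^esub>"

definition word_hom :: "('b, 'k) monoid_scheme \<Rightarrow> ('a \<Rightarrow> 'b) \<Rightarrow> 'a list \<Rightarrow> 'b" where
  "word_hom M g w = foldr (mult M) (map g w) \<one>\<^bsub>M\<^esub>"

definition monoid_congruence :: "('a, 'm) monoid_scheme \<Rightarrow> 'a rel \<Rightarrow> bool" where
  "monoid_congruence M r \<longleftrightarrow> equiv (carrier M) r \<and>
     (\<forall>(a, b)\<in>r. \<forall>(c, d)\<in>r. (a \<otimes>\<^bsub>M\<^esub> c, b \<otimes>\<^bsub>M\<^esub> d) \<in> r)"

definition generated_congruence :: "('a, 'm) monoid_scheme \<Rightarrow> 'a rel \<Rightarrow> 'a rel" where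
  "generated_congruence M R = \<Inter> {r. monoid_congruence M r \<and> R \<subseteq> r}"

definition kernel_rel :: "('a, 'm) monoid_scheme \<Rightarrow> ('a \<Rightarrow> 'b) \<Rightarrow> 'a rel" where
  "kernel_rel M h = {(u, v) \<in> carrier M \<times> carrier M. h u = h v}"

text \<open>The condition \<open>R \<subseteq> lists X \<times> lists X\<close> is what makes the presentation
  meaningful; without it no congruence on the free monoid could contain \<open>R\<close>.\<close>

definition has_monoid_presentation ::
  "('b, 'k) monoid_scheme \<Rightarrow> 'a set \<Rightarrow> 'a list rel \<Rightarrow> ('a list \<Rightarrow> 'b) \<Rightarrow> bool" where
  "has_monoid_presentation M X R h \<longleftrightarrow>
     monoid M \<and>
     R \<subseteq> lists X \<times> lists X \<and>
     is_monoid_hom (free_monoid X) M h \<and>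
     h ` carrier (free_monoid X) = carrier M \<and>
     kernel_rel (free_monoid X) h = generated_congruence (free_monoid X) R"

section \<open>Rook partitions\<close>

text \<open>\<open>Up i\<close>, \<open>Lo i\<close>, \<open>Mid i\<close> stand for \<open>i\<close>, \<open>i'\<close>, \<open>i''\<close>.\<close>

datatype vertex = Up nat | Lo nat | Mid nat

definition verts :: "nat \<Rightarrow> vertex set" where
  "verts n = Up ` {1..n} \<union> Lo ` {1..n}"

definition rook_partitions :: "nat \<Rightarrow> vertex set set set" where
  "rook_partitions n = {A. disjoint A \<and> {} \<notin> A \<and> \<Union> A \<subseteq> verts n}"

text \<open>Relabellings used in the product: \<open>lower\<close> moves \<open>i'\<close> to \<open>i''\<close> (for the left
  factor), \<open>upper\<close> moves \<open>i\<close> to \<open>i''\<close> (for the right factor). Rook partitions never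
  contain \<open>Mid i\<close>, so the third clauses are irrelevant.\<close>

fun lower :: "vertex \<Rightarrow> vertex" where
  "lower (Up i) = Up i"
| "lower (Lo i) = Mid i"
| "lower (Mid i) = Mid i"

fun upper :: "vertex \<Rightarrow> vertex" where
  "upper (Up i) = Mid i"
| "upper (Lo i) = Lo i"
| "upper (Mid i) = Mid i"

definition relabel :: "(vertex \<Rightarrow> vertex) \<Rightarrow> vertex set set \<Rightarrow> vertex set set" where
  "relabel f A = (\<lambda>B. f ` B) ` A"

text \<open>Adjacency in the product graph; loops are included, which does not affect connectivity.\<close>

definition product_edges :: "vertex set set \<Rightarrow> vertex set set \<Rightarrow> vertex rel" where
  "product_edges A B =
     {(x, y). \<exists>C \<in> relabel lower A \<union> relabel upper B. x \<in> C \<and> y \<in> C}"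

definition white_vertices :: "nat \<Rightarrow> vertex set set \<Rightarrow> vertex set set \<Rightarrow> vertex set" where
  "white_vertices n A B =
     (lower ` verts n - \<Union> (relabel lower A)) \<union> (upper ` verts n - \<Union> (relabel upper B))"

definition product_dots :: "nat \<Rightarrow> vertex set set \<Rightarrow> vertex set set \<Rightarrow> vertex set" where
  "product_dots n A B =
     {x \<in> verts n. \<exists>w \<in> white_vertices n A B. (x, w) \<in> (product_edges A B)\<^sup>*}"

definition rook_product :: "nat \<Rightarrow> vertex set set \<Rightarrow> vertex set set \<Rightarrow> vertex set set" where
  "rook_product n A B =
     {{y \<in> verts n - product_dots n A B. (x, y) \<in> (product_edges A B)\<^sup>*} |x.
        x \<in> verts n - product_dots n A B}"

definition rook_monoid :: "nat \<Rightarrow> vertex set set monoid" where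
  "rook_monoid n =
     \<lparr>carrier = rook_partitions n, mult = rook_product n,
      one = {{Up j, Lo j} |j. j \<in> {1..n}}\<rparr>"

section \<open>Generators and relations\<close>

definition s_bar :: "nat \<Rightarrow> nat \<Rightarrow> vertex set set" where
  "s_bar n i = {{Up i, Lo (i + 1)}, {Up (i + 1), Lo i}} \<union>
     {{Up j, Lo j} |j. j \<in> {1..n} - {i, i + 1}}"

definition e_bar :: "nat \<Rightarrow> vertex set set" where
  "e_bar n = {{Up 1}, {Lo 1}} \<union> {{Up j, Lo j} |j. j \<in> {1..n} - {1}}"

definition q_bar :: "nat \<Rightarrow> vertex set set" where
  "q_bar n = {{Up 1, Up 2, Lo 1, Lo 2}} \<union> {{Up j, Lo j} |j. j \<in> {3..n}}"

definition o_bar :: "nat \<Rightarrow> vertex set set" where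
  "o_bar n = {{Up j, Lo j} |j. j \<in> {1..n} - {1}}"

datatype letter = LS nat | LE | LQ | LO

definition letters :: "nat \<Rightarrow> letter set" where
  "letters n = LS ` {1..n - 1} \<union> {LE, LQ, LO}"

fun letter_image :: "nat \<Rightarrow> letter \<Rightarrow> vertex set set" where
  "letter_image n (LS i) = s_bar n i"
| "letter_image n LE = e_bar n"
| "letter_image n LQ = q_bar n"
| "letter_image n LO = o_bar n"

definition xi :: "nat \<Rightarrow> letter list \<Rightarrow> vertex set set" where
  "xi n = word_hom (rook_monoid n) (letter_image n)"

text \<open>The relations expressed by a chain of equalities between consecutive words of a list.\<close>

definition chain :: "'a list list \<Rightarrow> 'a list rel" where
  "chain ws = set (zip ws (tl ws))"

definition all_relations :: "letter list rel" where
  "all_relations =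
     (\<Union>i. chain [[LS i, LS i], []]) \<union>
     (\<Union>(i, j) \<in> {(i, j). \<bar>int i - int j\<bar> > 1}. chain [[LS i, LS j], [LS j, LS i]]) \<union>
     (\<Union>(i, j) \<in> {(i, j). \<bar>int i - int j\<bar> = 1}. chain [[LS i, LS j, LS i], [LS j, LS i, LS j]]) \<union>
     chain [[LE, LE], [LE], [LE, LQ, LE], [LE, LO, LE]] \<union>
     chain [[LQ, LQ], [LQ], [LQ, LE, LQ], [LQ, LS 1], [LS 1, LQ]] \<union>
     (\<Union>i \<in> {2..}. chain [[LE, LS i], [LS i, LE]]) \<union>
     (\<Union>i \<in> {3..}. chain [[LQ, LS i], [LS i, LQ]]) \<union>
     chain [[LS 1, LE, LS 1, LE], [LE, LS 1, LE, LS 1], [LE, LS 1, LE]] \<union>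
     chain [[LQ, LS 2, LQ, LS 2], [LS 2, LQ, LS 2, LQ]] \<union>
     chain [[LQ] @ [LS 2, LS 1, LS 3, LS 2] @ [LQ] @ [LS 2, LS 1, LS 3, LS 2],
            [LS 2, LS 1, LS 3, LS 2] @ [LQ] @ [LS 2, LS 1, LS 3, LS 2] @ [LQ]] \<union>
     chain [[LQ] @ [LS 2, LS 1, LE, LS 1, LS 2], [LS 2, LS 1, LE, LS 1, LS 2] @ [LQ]] \<union>
     chain [[LO, LO], [LO], [LO, LE, LO]] \<union>
     (\<Union>i \<in> {2..}. chain [[LO, LS i], [LS i, LO]]) \<union>
     chain [[LO, LS 1, LO, LS 1], [LS 1, LO, LS 1, LO], [LO, LS 1, LO], [LO, LQ], [LQ, LO]] \<union>
     chain [[LE, LS 1, LO, LS 1], [LS 1, LO, LS 1, LE]] \<union>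
     chain [[LQ] @ [LS 2, LS 1, LO, LS 1, LS 2], [LS 2, LS 1, LO, LS 1, LS 2] @ [LQ]]"

text \<open>Intersecting with the words over \<open>letters n\<close> discards exactly the relations that
  mention some \<open>LS i\<close> with \<open>i\<close> outside \<open>{1..n - 1}\<close>.\<close>

definition relations :: "nat \<Rightarrow> letter list rel" where
  "relations n = all_relations \<inter> (lists (letters n) \<times> lists (letters n))"

end

theory Submission
  imports Defs "HOL-Combinatorics.Permutations"
begin

text \<open>
  A rook partition \<open>A\<close> is determined by the relation on subsets of \<open>{1..n}\<close> that holds for \<open>(f, g)\<close>
  when \<open>f \<union> g'\<close> is a union of blocks of \<open>A\<close>, and products of rook partitions become
  compositions of relations; so associativity and the defining relations can be checked on subsets.
  Conversely, in any monoid satisfying the relations, the \<open>s\<^sub>i\<close> generate an image of the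
  symmetric group, and conjugation yields elements \<open>e\<^sub>i\<close>, \<open>o\<^sub>i\<close> and \<open>q\<^sub>i\<^sub>j\<close>. Every word can be rewritten as
  a product of \<open>q\<^sub>i\<^sub>j\<close>'s, then a permutation cut at some vertices by \<open>e\<^sub>i\<close>'s and \<open>o\<^sub>i\<close>'s, then again a
  product of \<open>q\<^sub>i\<^sub>j\<close>'s. Among all such expressions for an element choose one with as few uncut strands, and
  then as many \<open>q\<^sub>i\<^sub>j\<close>'s, as possible, whose uncut strands moreover end at the largest vertices of their
  blocks. It can be read off from the diagram, hence words with the same diagram are congruent.
\<close>

section \<open>Rook partitions as relations between subsets\<close>

text \<open>Blocks of a product are components of a graph, and paths through three rows are awkward
  to compose. A colouring that is constant along edges and \<open>False\<close> at white vertices is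
  a local condition, and gluing two of them along the middle row is relational composition; this is
  why subsets replace blocks. The presented monoid is never built: the congruence is a variable, so
  no fixed type could be its quotient. The algebra is done over any monoid that satisfies the
  relations and carries a homomorphism \<open>rho\<close> to relations, and it is then applied to
  words acting on the classes of a given congruence. Normal words are multiplied by letters from the
  right. Permutations, \<open>q\<close> and \<open>o\<close> can be moved through the bottom factors
  \<open>Q i j\<close>, or added to them. The letter \<open>e\<close> is the obstacle, since it does
  not commute with a \<open>Q i j\<close> that shares its vertex; there the word has to be reduced
  first. Ending uncut strands at largest vertices thus serves twice: the diagram determines these
  ends, and \<open>1\<close>, where \<open>e\<close> acts, is hardly ever one of them.\<close>

primrec val :: "(nat \<Rightarrow> bool) \<Rightarrow> (nat \<Rightarrow> bool) \<Rightarrow> (nat \<Rightarrow> bool) \<Rightarrow> vertex \<Rightarrow> bool" where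
  "val f g h (Up i) = f i"
| "val f g h (Lo i) = g i"
| "val f g h (Mid i) = h i"

text \<open>Such a \<open>c\<close> is the indicator of a union of blocks. Rook dots are coloured
  \<open>False\<close> because they lie in no block.\<close>

definition compatible :: "vertex set \<Rightarrow> vertex set set \<Rightarrow> (vertex \<Rightarrow> bool) \<Rightarrow> bool" where
  "compatible V A c \<longleftrightarrow> (\<forall>C\<in>A. \<forall>x\<in>C. \<forall>y\<in>C. c x = c y) \<and> (\<forall>x\<in>V - \<Union>A. \<not> c x)"

text \<open>Colourings live on all of \<open>nat\<close> and agree outside \<open>{1..n}\<close>.
  This makes the relation of the identity partition exactly \<open>Id\<close>, and lets the
  relations of the letters be stated without \<open>n\<close>.\<close>

definition colouring_rel :: "nat \<Rightarrow> vertex set set \<Rightarrow> (nat \<Rightarrow> bool) rel" where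
  "colouring_rel n A = {(f, g). (\<forall>i. i \<notin> {1..n} \<longrightarrow> f i = g i) \<and> compatible (verts n) A (val f g g)}"

section \<open>A rook partition is determined by its colouring relation\<close>

lemma disjointE:
  assumes "disjoint A" "C \<in> A" "D \<in> A" "x \<in> C" "x \<in> D"
  shows "C = D"
  using assms by (auto simp: disjoint_def)

lemma rook_partitionsD:
  assumes "A \<in> rook_partitions n"
  shows "disjoint A" "{} \<notin> A" "\<Union>A \<subseteq> verts n"
  using assms by (auto simp: rook_partitions_def)

lemma verts_iff [simp]: "Up i \<in> verts n \<longleftrightarrow> i \<in> {1..n}" "Lo i \<in> verts n \<longleftrightarrow> i \<in> {1..n}" "Mid i \<notin> verts n"
  by (auto simp: verts_def)

lemma compatible_cong:
  assumes "A \<in> rook_partitions n" "\<And>x. x \<in> verts n \<Longrightarrow> c x = c' x"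
  shows "compatible (verts n) A c \<longleftrightarrow> compatible (verts n) A c'"
proof -
  have "c x = c' x" if "C \<in> A" "x \<in> C" for x C
    using rook_partitionsD(3)[OF assms(1)] assms(2) that by blast
  then show ?thesis using assms(2) unfolding compatible_def by simp
qed

text \<open>A single colouring of the vertices is split into its two rows, so that indicators of
  blocks can serve as test elements of \<open>colouring_rel n A\<close>.\<close>

lemma colouring_rel_of_colouring:
  assumes "\<And>x. x \<notin> verts n \<Longrightarrow> \<not> c x" "A \<in> rook_partitions n"
  shows "(\<lambda>i. c (Up i), \<lambda>i. c (Lo i)) \<in> colouring_rel n A \<longleftrightarrow> compatible (verts n) A c"
proof -
  have *: "val (\<lambda>i. c (Up i)) (\<lambda>i. c (Lo i)) h x = c x" if "x \<in> verts n" for x h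
    using that by (cases x) auto
  have "compatible (verts n) A (val (\<lambda>i. c (Up i)) (\<lambda>i. c (Lo i)) (\<lambda>i. c (Lo i))) \<longleftrightarrow> compatible (verts n) A c"
    by (rule compatible_cong[OF assms(2) *])
  moreover have "i \<notin> {1..n} \<Longrightarrow> c (Up i) = c (Lo i)" for i
    using assms(1)[of "Up i"] assms(1)[of "Lo i"] by auto
  ultimately show ?thesis
    by (auto simp: colouring_rel_def)
qed

lemma compatible_block:
  assumes "A \<in> rook_partitions n" "C \<in> A"
  shows "compatible (verts n) A (\<lambda>x. x \<in> C)"
  using assms disjointE[OF rook_partitionsD(1)[OF assms(1)]] unfolding compatible_def by blast

text \<open>Blocks are the minimal non-empty unions of blocks. The indicator of a block
  \<open>C\<close> of \<open>A\<close> is compatible with \<open>B\<close>, so \<open>C\<close>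
  contains a block \<open>D\<close> of \<open>B\<close>; with the roles exchanged, \<open>D\<close>
  is a union of blocks of \<open>A\<close> meeting \<open>C\<close>, so it contains
  \<open>C\<close>.\<close>

lemma colouring_rel_subset:
  assumes A: "A \<in> rook_partitions n" and B: "B \<in> rook_partitions n"
    and eq: "colouring_rel n A = colouring_rel n B"
  shows "A \<subseteq> B"
proof
  have tr: "compatible (verts n) A c \<longleftrightarrow> compatible (verts n) B c" if "\<And>x. x \<notin> verts n \<Longrightarrow> \<not> c x" for c
    using colouring_rel_of_colouring[of n c A] colouring_rel_of_colouring[of n c B] A B eq that by blast
  fix C assume C: "C \<in> A"
  have sub: "C \<subseteq> verts n" using C rook_partitionsD(3)[OF A] by auto
  have cB: "compatible (verts n) B (\<lambda>x. x \<in> C)"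
    using tr[of "\<lambda>x. x \<in> C"] compatible_block[OF A C] sub by auto
  obtain x where x: "x \<in> C" using C rook_partitionsD(2)[OF A] by (metis ex_in_conv)
  \<comment> \<open>\<open>x\<close> is coloured \<open>True\<close>, so it cannot be a rook dot of
    \<open>B\<close>.\<close>
  with cB sub obtain D where D: "D \<in> B" "x \<in> D" unfolding compatible_def by blast
  have "D \<subseteq> C" using cB D x unfolding compatible_def by blast
  have cA: "compatible (verts n) A (\<lambda>x. x \<in> D)"
    using tr[of "\<lambda>x. x \<in> D"] compatible_block[OF B D(1)] rook_partitionsD(3)[OF B] D(1) by auto
  have "C \<subseteq> D" using cA C x D unfolding compatible_def by blast
  with \<open>D \<subseteq> C\<close> D show "C \<in> B" by auto
qed

lemma colouring_rel_inj:
  assumes "A \<in> rook_partitions n" "B \<in> rook_partitions n" "colouring_rel n A = colouring_rel n B"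
  shows "A = B"
  using assms colouring_rel_subset by (metis subset_antisym)

section \<open>Products of rook partitions are compositions of relations\<close>

lemma sym_product_edges: "sym (product_edges A B)"
  by (auto simp: product_edges_def sym_def)

lemma rtrancl_product_edges_sym:
  "(x, y) \<in> (product_edges A B)\<^sup>* \<Longrightarrow> (y, x) \<in> (product_edges A B)\<^sup>*"
  by (meson sym_product_edges sym_rtrancl symD)

lemma connected_iff:
  "(x, z) \<in> (product_edges A B)\<^sup>* \<Longrightarrow> (x, y) \<in> (product_edges A B)\<^sup>* \<longleftrightarrow> (z, y) \<in> (product_edges A B)\<^sup>*"
  by (blast intro: rtrancl_trans rtrancl_product_edges_sym)

lemma rook_product_closed: "rook_product n A B \<in> rook_partitions n"
proof -
  let ?E = "(product_edges A B)\<^sup>*"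
  have "C = D" if CD: "C \<in> rook_product n A B" "D \<in> rook_product n A B" "z \<in> C" "z \<in> D" for C D z
  proof -
    obtain x x' where C: "C = {y \<in> verts n - product_dots n A B. (x, y) \<in> ?E}"
      and D: "D = {y \<in> verts n - product_dots n A B. (x', y) \<in> ?E}"
      using CD(1,2) unfolding rook_product_def by blast
    have "(x, z) \<in> ?E" "(x', z) \<in> ?E" using CD(3,4) C D by blast+
    then have "(x, y) \<in> ?E \<longleftrightarrow> (x', y) \<in> ?E" for y
      using connected_iff[of x z A B y] connected_iff[of x' z A B y] by simp
    then show ?thesis unfolding C D by blast
  qed
  then have "disjoint (rook_product n A B)" unfolding disjoint_def by blast
  then show ?thesis unfolding rook_partitions_def rook_product_def by auto
qed

lemma Union_rook_product: "\<Union>(rook_product n A B) = verts n - product_dots n A B"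
  unfolding rook_product_def by auto

text \<open>Blocks of the product are traces of components of the product graph on the outer rows,
  and its dots are the outer vertices joined to a white vertex.\<close>

lemma compatible_rook_product:
  assumes out: "\<forall>x. x \<notin> verts n \<longrightarrow> \<not> c x"
  shows "compatible (verts n) (rook_product n A B) c \<longleftrightarrow>
    (\<forall>x\<in>verts n. (\<forall>y\<in>verts n. (x, y) \<in> (product_edges A B)\<^sup>* \<longrightarrow> c x = c y) \<and>
       (\<forall>w\<in>white_vertices n A B. (x, w) \<in> (product_edges A B)\<^sup>* \<longrightarrow> \<not> c x))"
  (is "?L = ?R")
proof
  assume L: ?L
  have dot: "\<not> c x" if "x \<in> product_dots n A B" for x
    using L that by (auto simp: compatible_def Union_rook_product product_dots_def)
  have "c x = c y" if xy: "x \<in> verts n" "y \<in> verts n" "(x, y) \<in> (product_edges A B)\<^sup>*" for x y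
  proof (cases "x \<in> product_dots n A B")
    case True
    then have "y \<in> product_dots n A B"
      using xy(2) connected_iff[OF xy(3)] unfolding product_dots_def by blast
    with True dot show ?thesis by blast
  next
    case False
    then have "y \<notin> product_dots n A B"
      using xy(1) connected_iff[OF xy(3)] unfolding product_dots_def by blast
    define K where "K = {z \<in> verts n - product_dots n A B. (x, z) \<in> (product_edges A B)\<^sup>*}"
    have "K \<in> rook_product n A B"
      unfolding rook_product_def K_def by (rule CollectI) (use False xy in blast)
    moreover have "x \<in> K" "y \<in> K" using False xy \<open>y \<notin> product_dots n A B\<close> by (auto simp: K_def)
    ultimately show ?thesis using L unfolding compatible_def by blast
  qed
  moreover have "\<not> c x" if "x \<in> verts n" "w \<in> white_vertices n A B" "(x, w) \<in> (product_edges A B)\<^sup>*" for x w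
    using dot that unfolding product_dots_def by blast
  ultimately show ?R by blast
next
  assume R: ?R
  show ?L unfolding compatible_def Union_rook_product
  proof (intro conjI ballI)
    fix C x y assume C: "C \<in> rook_product n A B" "x \<in> C" "y \<in> C"
    then obtain z where z: "x \<in> verts n" "y \<in> verts n"
      "(z, x) \<in> (product_edges A B)\<^sup>*" "(z, y) \<in> (product_edges A B)\<^sup>*"
      unfolding rook_product_def by blast
    then have "(x, y) \<in> (product_edges A B)\<^sup>*" by (simp add: connected_iff[OF z(3)])
    with R z(1,2) show "c x = c y" by blast
  next
    fix x assume "x \<in> verts n - (verts n - product_dots n A B)"
    then have "x \<in> product_dots n A B" by blast
    then obtain w where "x \<in> verts n" "w \<in> white_vertices n A B" "(x, w) \<in> (product_edges A B)\<^sup>*"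
      unfolding product_dots_def by blast
    with R show "\<not> c x" by blast
  qed
qed

lemma compatible_path:
  assumes "\<And>C x y. C \<in> relabel lower A \<union> relabel upper B \<Longrightarrow> x \<in> C \<Longrightarrow> y \<in> C \<Longrightarrow> c x = c y"
    and "(x, y) \<in> (product_edges A B)\<^sup>*"
  shows "c x = c y"
  using assms(2)
proof (induction rule: rtrancl_induct)
  case (step y z)
  then obtain C where "C \<in> relabel lower A \<union> relabel upper B" "y \<in> C" "z \<in> C"
    unfolding product_edges_def by blast
  then have "c y = c z" by (rule assms(1))
  with step.IH show ?case by simp
qed simp

lemma compatible_relabel:
  assumes "A \<in> rook_partitions n" "inj_on h (verts n)"
  shows "(\<forall>C\<in>relabel h A. \<forall>x\<in>C. \<forall>y\<in>C. c x = c y) \<and> (\<forall>x\<in>h ` verts n - \<Union>(relabel h A). \<not> c x)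
    \<longleftrightarrow> compatible (verts n) A (c \<circ> h)"
proof -
  have "\<Union>(relabel h A) = h ` \<Union>A" by (auto simp: relabel_def)
  then have "h ` verts n - \<Union>(relabel h A) = h ` (verts n - \<Union>A)"
    using rook_partitionsD(3)[OF assms(1)] inj_on_image_set_diff[OF assms(2), of "verts n" "\<Union>A"] by auto
  then show ?thesis unfolding compatible_def by (simp add: relabel_def)
qed

lemma inj_lower: "inj_on lower (verts n)"
  by (auto simp: inj_on_def verts_def)

lemma inj_upper: "inj_on upper (verts n)"
  by (auto simp: inj_on_def verts_def)

lemma val_lower: "x \<in> verts n \<Longrightarrow> val f g h (lower x) = val f h h x"
  by (cases x) auto

lemma val_upper: "x \<in> verts n \<Longrightarrow> val f g h (upper x) = val h g g x"
  by (cases x) auto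

text \<open>One colouring of all three rows encodes two colourings glued along the middle row
  \<open>h\<close>; \<open>lower\<close> and \<open>upper\<close> pull it back to the two
  factors.\<close>

lemma compatible_middle:
  assumes "A \<in> rook_partitions n" "B \<in> rook_partitions n"
  shows "compatible (verts n) A (val f h h) \<and> compatible (verts n) B (val h g g) \<longleftrightarrow>
    (\<forall>C\<in>relabel lower A \<union> relabel upper B. \<forall>x\<in>C. \<forall>y\<in>C. val f g h x = val f g h y) \<and>
    (\<forall>x\<in>white_vertices n A B. \<not> val f g h x)"
proof -
  have 1: "compatible (verts n) A (val f h h) \<longleftrightarrow> compatible (verts n) A (val f g h \<circ> lower)"
    by (rule compatible_cong[OF assms(1)]) (simp add: val_lower)
  have 2: "compatible (verts n) B (val h g g) \<longleftrightarrow> compatible (verts n) B (val f g h \<circ> upper)"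
    by (rule compatible_cong[OF assms(2)]) (simp add: val_upper)
  show ?thesis
    unfolding white_vertices_def ball_Un 1 2 compatible_relabel[OF assms(1) inj_lower, symmetric]
      compatible_relabel[OF assms(2) inj_upper, symmetric]
    by (simp only: conj_ac)
qed

lemma product_edges_bound:
  assumes "A \<in> rook_partitions n" "B \<in> rook_partitions n" "(x, y) \<in> product_edges A B"
  shows "x \<in> verts n \<union> Mid ` {1..n}" "y \<in> verts n \<union> Mid ` {1..n}"
proof -
  have *: "lower x \<in> verts n \<union> Mid ` {1..n}" "upper x \<in> verts n \<union> Mid ` {1..n}" if "x \<in> verts n" for x
    using that by (cases x; auto)+
  have "C \<subseteq> verts n \<union> Mid ` {1..n}" if "C \<in> relabel lower A \<union> relabel upper B" for C
    using that rook_partitionsD(3)[OF assms(1)] rook_partitionsD(3)[OF assms(2)] *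
    unfolding relabel_def by blast
  then show "x \<in> verts n \<union> Mid ` {1..n}" "y \<in> verts n \<union> Mid ` {1..n}"
    using assms(3) unfolding product_edges_def by blast+
qed

text \<open>For the inclusion from right to left the middle row is given, and constancy along edges
  extends to paths. For the other one the middle row has to be invented: the colours of the outer
  vertices are propagated through their components.\<close>

lemma colouring_rel_product:
  assumes A: "A \<in> rook_partitions n" and B: "B \<in> rook_partitions n"
  shows "colouring_rel n (rook_product n A B) = colouring_rel n A O colouring_rel n B"
proof (intro equalityI subrelI)
  let ?E = "(product_edges A B)\<^sup>*"
  fix f g assume fg: "(f, g) \<in> colouring_rel n (rook_product n A B)"
  define c where "c x = (x \<in> verts n \<and> val f g g x)" for x
  have out: "\<forall>x. x \<notin> verts n \<longrightarrow> \<not> c x" by (simp add: c_def)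
  have "compatible (verts n) (rook_product n A B) c"
    using fg compatible_cong[OF rook_product_closed, of n c "val f g g" A B] by (auto simp: c_def colouring_rel_def)
  then have eq: "\<And>x y. x \<in> verts n \<Longrightarrow> y \<in> verts n \<Longrightarrow> (x, y) \<in> ?E \<Longrightarrow> c x = c y"
    and white: "\<And>x w. x \<in> verts n \<Longrightarrow> w \<in> white_vertices n A B \<Longrightarrow> (x, w) \<in> ?E \<Longrightarrow> \<not> c x"
    unfolding compatible_rook_product[OF out] by blast+
  \<comment> \<open>Components without coloured outer vertices get \<open>False\<close>, so white
    vertices in them cause no conflict.\<close>
  define c' where "c' v = (\<exists>x\<in>verts n. c x \<and> (x, v) \<in> ?E)" for v
  have c': "c' x = c x" if "x \<in> verts n" for x
    using that eq unfolding c'_def by (metis rtrancl.rtrancl_refl)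
  \<comment> \<open>Off \<open>{1..n}\<close> the middle row copies \<open>f\<close>, which agrees
    with \<open>g\<close> there.\<close>
  define h where "h i = (if i \<in> {1..n} then c' (Mid i) else f i)" for i
  have val: "val f g h x = c' x" if "x \<in> verts n \<union> Mid ` {1..n}" for x
    using that c'[of x] by (cases x) (auto simp: h_def c_def)
  have c'_eq: "c' x = c' y" if "(x, y) \<in> product_edges A B" for x y
  proof -
    have "(z, x) \<in> ?E \<longleftrightarrow> (z, y) \<in> ?E" for z
      using that rtrancl_product_edges_sym[OF r_into_rtrancl[OF that]]
      by (blast intro: rtrancl_trans)
    then show ?thesis unfolding c'_def by blast
  qed
  have edge: "\<forall>C\<in>relabel lower A \<union> relabel upper B. \<forall>x\<in>C. \<forall>y\<in>C. val f g h x = val f g h y"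
  proof (intro ballI)
    fix C x y assume "C \<in> relabel lower A \<union> relabel upper B" "x \<in> C" "y \<in> C"
    then have "(x, y) \<in> product_edges A B" unfolding product_edges_def by blast
    from c'_eq[OF this] val[OF product_edges_bound(1)[OF A B this]] val[OF product_edges_bound(2)[OF A B this]]
    show "val f g h x = val f g h y" by simp
  qed
  have "\<forall>x\<in>white_vertices n A B. \<not> val f g h x"
  proof
    fix x assume x: "x \<in> white_vertices n A B"
    then have "x \<in> lower ` verts n \<union> upper ` verts n" by (auto simp: white_vertices_def)
    then have "x \<in> verts n \<union> Mid ` {1..n}" by (auto simp: verts_def)
    from val[OF this] white[OF _ x] show "\<not> val f g h x" unfolding c'_def by blast
  qed
  with edge have "compatible (verts n) A (val f h h) \<and> compatible (verts n) B (val h g g)"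
    unfolding compatible_middle[OF A B] by (rule conjI)
  moreover have "\<forall>i. i \<notin> {1..n} \<longrightarrow> f i = h i \<and> h i = g i"
    using fg by (auto simp: h_def colouring_rel_def)
  ultimately have "(f, h) \<in> colouring_rel n A" "(h, g) \<in> colouring_rel n B"
    by (auto simp: colouring_rel_def)
  then show "(f, g) \<in> colouring_rel n A O colouring_rel n B" by blast
next
  let ?E = "(product_edges A B)\<^sup>*"
  fix f g assume "(f, g) \<in> colouring_rel n A O colouring_rel n B"
  then obtain h where fh: "(f, h) \<in> colouring_rel n A" and hg: "(h, g) \<in> colouring_rel n B" by blast
  then have "compatible (verts n) A (val f h h) \<and> compatible (verts n) B (val h g g)"
    by (auto simp: colouring_rel_def)
  from this[unfolded compatible_middle[OF A B]]
  have edge: "\<forall>C\<in>relabel lower A \<union> relabel upper B. \<forall>x\<in>C. \<forall>y\<in>C. val f g h x = val f g h y"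
    and white: "\<forall>x\<in>white_vertices n A B. \<not> val f g h x" by (rule conjunct1, rule conjunct2)
  have path: "val f g h x = val f g h y" if "(x, y) \<in> ?E" for x y
    by (rule compatible_path[OF _ that]) (rule edge[rule_format])
  define c where "c x = (x \<in> verts n \<and> val f g g x)" for x
  have out: "\<forall>x. x \<notin> verts n \<longrightarrow> \<not> c x" by (simp add: c_def)
  have c: "c x = val f g h x" if "x \<in> verts n" for x using that by (cases x) (auto simp: c_def)
  have "compatible (verts n) (rook_product n A B) c"
    unfolding compatible_rook_product[OF out] using path c white by metis
  then have "compatible (verts n) (rook_product n A B) (val f g g)"
    using compatible_cong[OF rook_product_closed, of n c "val f g g" A B] by (auto simp: c_def)
  then show "(f, g) \<in> colouring_rel n (rook_product n A B)"
    using fh hg by (auto simp: colouring_rel_def)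
qed

section \<open>The generators acting on subsets\<close>

text \<open>\<open>LE\<close> lets the value at \<open>1\<close> change freely because
  \<open>Up 1\<close> and \<open>Lo 1\<close> form separate blocks. \<open>LQ\<close> and
  \<open>LO\<close> are partial identities.\<close>

primrec sem :: "letter \<Rightarrow> (nat \<Rightarrow> bool) rel" where
  "sem (LS i) = {(f, g). g = f \<circ> transpose i (Suc i)}"
| "sem LE = {(f, g). \<exists>b. g = f(1 := b)}"
| "sem LQ = {(f, g). f = g \<and> f 1 = f 2}"
| "sem LO = {(f, g). f = g \<and> \<not> f 1}"

definition sem_word :: "letter list \<Rightarrow> (nat \<Rightarrow> bool) rel" where
  "sem_word w = foldr (O) (map sem w) Id"

lemma sem_word_Nil [simp]: "sem_word [] = Id"
  and sem_word_Cons: "sem_word (x # w) = sem x O sem_word w"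
  by (simp_all add: sem_word_def)

lemma sem_word_append: "sem_word (u @ v) = sem_word u O sem_word v"
  by (induction u) (simp_all add: sem_word_Cons O_assoc)

lemma sem_word_Cons_iff [simp]:
  "(f, g) \<in> sem_word (LS i # w) \<longleftrightarrow> (f \<circ> transpose i (Suc i), g) \<in> sem_word w"
  "(f, g) \<in> sem_word (LE # w) \<longleftrightarrow> (\<exists>b. (f(1 := b), g) \<in> sem_word w)"
  "(f, g) \<in> sem_word (LQ # w) \<longleftrightarrow> f 1 = f 2 \<and> (f, g) \<in> sem_word w"
  "(f, g) \<in> sem_word (LO # w) \<longleftrightarrow> \<not> f 1 \<and> (f, g) \<in> sem_word w"
  by (auto simp: sem_word_Cons)

lemma one_closed: "{{Up j, Lo j} |j. j \<in> {1..n}} \<in> rook_partitions n"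
  by (auto simp: rook_partitions_def disjoint_def)

lemma letter_image_closed:
  assumes "x \<in> letters n" "n \<ge> 2"
  shows "letter_image n x \<in> rook_partitions n"
  using assms unfolding letters_def
  by (auto simp: s_bar_def e_bar_def q_bar_def o_bar_def rook_partitions_def disjoint_def)

lemma blocks_diag:
  "(\<forall>C\<in>{{Up j, Lo j} |j. j \<in> J}. \<forall>x\<in>C. \<forall>y\<in>C. val f g h x = val f g h y) \<longleftrightarrow> (\<forall>j\<in>J. f j = g j)"
proof -
  have "{{Up j, Lo j} |j. j \<in> J} = (\<lambda>j. {Up j, Lo j}) ` J" by blast
  then show ?thesis by auto
qed

lemma Up_in_Union_diag: "Up i \<in> \<Union>(B \<union> {{Up j, Lo j} |j. j \<in> J}) \<longleftrightarrow> Up i \<in> \<Union>B \<or> i \<in> J"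
  and Lo_in_Union_diag: "Lo i \<in> \<Union>(B \<union> {{Up j, Lo j} |j. j \<in> J}) \<longleftrightarrow> Lo i \<in> \<Union>B \<or> i \<in> J"
proof -
  have "{{Up j, Lo j} |j. j \<in> J} = (\<lambda>j. {Up j, Lo j}) ` J" by blast
  then show "Up i \<in> \<Union>(B \<union> {{Up j, Lo j} |j. j \<in> J}) \<longleftrightarrow> Up i \<in> \<Union>B \<or> i \<in> J"
    and "Lo i \<in> \<Union>(B \<union> {{Up j, Lo j} |j. j \<in> J}) \<longleftrightarrow> Lo i \<in> \<Union>B \<or> i \<in> J"
    by simp_all
qed

lemma ball_verts_diff:
  "(\<forall>x\<in>verts n - S. P x) \<longleftrightarrow> (\<forall>i\<in>{1..n}. (Up i \<notin> S \<longrightarrow> P (Up i)) \<and> (Lo i \<notin> S \<longrightarrow> P (Lo i)))"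
  by (auto simp: verts_def)

text \<open>The identity and all four generators consist of vertical strands over \<open>J\<close>
  and a few further blocks \<open>B\<close>. The positions without vertical strand, where dots may
  occur, are collected in \<open>K\<close>.\<close>

lemma colouring_rel_diag:
  assumes "{1..n} - J = K"
  shows "(f, g) \<in> colouring_rel n (B \<union> {{Up j, Lo j} |j. j \<in> J}) \<longleftrightarrow>
    (\<forall>i. i \<notin> {1..n} \<longrightarrow> f i = g i) \<and> (\<forall>j\<in>J. f j = g j) \<and>
    (\<forall>C\<in>B. \<forall>x\<in>C. \<forall>y\<in>C. val f g g x = val f g g y) \<and>
    (\<forall>i\<in>K. (Up i \<notin> \<Union>B \<longrightarrow> \<not> f i) \<and> (Lo i \<notin> \<Union>B \<longrightarrow> \<not> g i))"
proof -
  have "(\<forall>x\<in>verts n - \<Union>(B \<union> {{Up j, Lo j} |j. j \<in> J}). \<not> val f g g x) \<longleftrightarrow>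
    (\<forall>i\<in>K. (Up i \<notin> \<Union>B \<longrightarrow> \<not> f i) \<and> (Lo i \<notin> \<Union>B \<longrightarrow> \<not> g i))"
    unfolding ball_verts_diff Up_in_Union_diag Lo_in_Union_diag assms[symmetric] by auto
  then show ?thesis
    unfolding colouring_rel_def compatible_def ball_Un blocks_diag by (auto simp only: mem_Collect_eq case_prod_conv)
qed

lemma colouring_rel_one: "colouring_rel n {{Up j, Lo j} |j. j \<in> {1..n}} = Id"
proof (intro Set.set_eqI)
  fix p show "p \<in> colouring_rel n {{Up j, Lo j} |j. j \<in> {1..n}} \<longleftrightarrow> p \<in> Id"
    using colouring_rel_diag[of n "{1..n}" "{}" "fst p" "snd p" "{}"]
    by (cases p) (auto simp: fun_eq_iff)
qed

lemma colouring_rel_letter: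
  assumes "x \<in> letters n" "n \<ge> 2"
  shows "colouring_rel n (letter_image n x) = sem x"
proof (intro Set.set_eqI)
  fix p :: "(nat \<Rightarrow> bool) \<times> (nat \<Rightarrow> bool)"
  obtain f g where p: "p = (f, g)" by force
  show "p \<in> colouring_rel n (letter_image n x) \<longleftrightarrow> p \<in> sem x"
  proof (cases x)
    case (LS i)
    then have i: "1 \<le> i" "Suc i \<le> n" using assms by (auto simp: letters_def)
    have K: "{1..n} - ({1..n} - {i, i + 1}) = {i, i + 1}" using i by auto
    have "g = f \<circ> transpose i (Suc i) \<longleftrightarrow>
        (\<forall>k. k \<noteq> i \<and> k \<noteq> Suc i \<longrightarrow> f k = g k) \<and> f i = g (Suc i) \<and> f (Suc i) = g i"
    proof (rule iffI[OF _ ext])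
      fix k assume "(\<forall>k. k \<noteq> i \<and> k \<noteq> Suc i \<longrightarrow> f k = g k) \<and> f i = g (Suc i) \<and> f (Suc i) = g i"
      then show "g k = (f \<circ> transpose i (Suc i)) k"
        by (cases "k = i"; cases "k = Suc i") (simp_all add: transpose_def)
    qed (simp add: transpose_def)
    moreover have "(\<forall>k. k \<noteq> i \<and> k \<noteq> Suc i \<longrightarrow> f k = g k) \<longleftrightarrow>
        (\<forall>k. k \<notin> {1..n} \<longrightarrow> f k = g k) \<and> (\<forall>k\<in>{1..n} - {i, i + 1}. f k = g k)"
    proof (rule iffI[OF _ allI[OF impI]])
      fix k assume "(\<forall>k. k \<notin> {1..n} \<longrightarrow> f k = g k) \<and> (\<forall>k\<in>{1..n} - {i, i + 1}. f k = g k)" "k \<noteq> i \<and> k \<noteq> Suc i"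
      then show "f k = g k" by (cases "k \<in> {1..n}") simp_all
    qed (use i in auto)
    moreover have "(\<forall>C\<in>{{Up i, Lo (i + 1)}, {Up (i + 1), Lo i}}. \<forall>x\<in>C. \<forall>y\<in>C. val f g g x = val f g g y)
        \<longleftrightarrow> f i = g (Suc i) \<and> f (Suc i) = g i"
      by auto
    ultimately show ?thesis
      unfolding LS p letter_image.simps s_bar_def colouring_rel_diag[OF K] by simp
  next
    case LE
    have K: "{1..n} - ({1..n} - {1}) = {1}" using assms by auto
    have "(\<exists>b. g = f(1 := b)) \<longleftrightarrow> (\<forall>k. k \<noteq> 1 \<longrightarrow> f k = g k)"
    proof
      assume "\<forall>k. k \<noteq> 1 \<longrightarrow> f k = g k"
      then have "g = f(1 := g 1)" by (intro ext) simp
      then show "\<exists>b. g = f(1 := b)" by blast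
    qed auto
    moreover have "(\<forall>k. k \<noteq> 1 \<longrightarrow> f k = g k) \<longleftrightarrow>
        (\<forall>k. k \<notin> {1..n} \<longrightarrow> f k = g k) \<and> (\<forall>k\<in>{1..n} - {1}. f k = g k)"
    proof (rule iffI[OF _ allI[OF impI]])
      fix k :: nat assume "(\<forall>k. k \<notin> {1..n} \<longrightarrow> f k = g k) \<and> (\<forall>k\<in>{1..n} - {1}. f k = g k)" "k \<noteq> 1"
      then show "f k = g k" by (cases "k \<in> {1..n}") simp_all
    qed (use assms in auto)
    ultimately show ?thesis
      unfolding LE p letter_image.simps e_bar_def colouring_rel_diag[OF K] by simp
  next
    case LQ
    have K: "{1..n} - {3..n} = {1, 2}" using assms by auto
    have "g = f" if "\<forall>i. i \<notin> {1..n} \<longrightarrow> f i = g i" "\<forall>i\<in>{3..n}. f i = g i" "f 1 = g 1" "f 2 = g 2"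
    proof
      fix i :: nat
      show "g i = f i"
        using that by (cases "i \<in> {1..n}"; cases "i \<in> {3..n}"; cases "i = 1"; cases "i = 2") auto
    qed
    moreover have "(\<forall>C\<in>{{Up 1, Up 2, Lo 1, Lo 2}}. \<forall>x\<in>C. \<forall>y\<in>C. val f g g x = val f g g y)
        \<longleftrightarrow> f 1 = g 1 \<and> f 2 = g 2 \<and> f 1 = f 2"
      by auto
    ultimately show ?thesis
      unfolding LQ p letter_image.simps q_bar_def colouring_rel_diag[OF K] by auto
  next
    case LO
    have K: "{1..n} - ({1..n} - {1}) = {1}" using assms by auto
    have "f = g" if "\<forall>k. k \<notin> {1..n} \<longrightarrow> f k = g k" "\<forall>k\<in>{1..n} - {1}. f k = g k" "\<not> f 1" "\<not> g 1"
    proof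
      fix k :: nat show "f k = g k" using that by (cases "k \<in> {1..n}"; cases "k = 1") simp_all
    qed
    then show ?thesis unfolding LO p letter_image.simps o_bar_def
      using colouring_rel_diag[OF K, of f g "{}"] by auto
  qed
qed

lemma xi_word:
  assumes "n \<ge> 2" "w \<in> lists (letters n)"
  shows "xi n w \<in> rook_partitions n \<and> colouring_rel n (xi n w) = sem_word w"
  using assms(2)
proof (induction w)
  case Nil
  then show ?case using one_closed colouring_rel_one
    by (simp add: xi_def word_hom_def rook_monoid_def)
next
  case (Cons x w)
  have "xi n (x # w) = rook_product n (letter_image n x) (xi n w)"
    by (simp add: xi_def word_hom_def rook_monoid_def)
  then show ?case using Cons rook_product_closed letter_image_closed assms(1)
    by (simp add: colouring_rel_product colouring_rel_letter sem_word_Cons)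
qed

text \<open>The monoid laws are inherited from composition of relations, because
  \<open>colouring_rel n\<close> is injective on rook partitions.\<close>

lemma monoid_rook_monoid: "monoid (rook_monoid n)"
proof -
  define I where "I = {{Up j, Lo j} |j. j \<in> {1..n}}"
  have I: "I \<in> rook_partitions n" "colouring_rel n I = Id"
    unfolding I_def by (rule one_closed, rule colouring_rel_one)
  have M: "carrier (rook_monoid n) = rook_partitions n" "\<one>\<^bsub>rook_monoid n\<^esub> = I"
    "\<And>x y. x \<otimes>\<^bsub>rook_monoid n\<^esub> y = rook_product n x y"
    by (simp_all add: rook_monoid_def I_def)
  have left: "rook_product n I x = x" and right: "rook_product n x I = x" if "x \<in> rook_partitions n" for x
    by (rule colouring_rel_inj[of _ n]; use that I rook_product_closed in \<open>simp add: colouring_rel_product\<close>)+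
  have assoc: "rook_product n (rook_product n x y) z = rook_product n x (rook_product n y z)"
    if "x \<in> rook_partitions n" "y \<in> rook_partitions n" "z \<in> rook_partitions n" for x y z
    by (rule colouring_rel_inj[of _ n])
      (use that rook_product_closed in \<open>simp_all add: colouring_rel_product O_assoc\<close>)
  show ?thesis
    by (rule monoidI) (use I left right assoc rook_product_closed in \<open>simp_all add: M\<close>)
qed

section \<open>Soundness of the defining relations\<close>

lemma sem_word_eqI: "(\<And>f g. (f, g) \<in> sem_word u \<longleftrightarrow> (f, g) \<in> sem_word v) \<Longrightarrow> sem_word u = sem_word v"
  by auto

lemma fun_upd_comp_transpose:
  "(f(x := b)) \<circ> transpose i j = (f \<circ> transpose i j)(transpose i j x := b)"
  by (auto simp: fun_eq_iff transpose_def)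

lemma comp_transpose_transpose: "f \<circ> transpose i j \<circ> transpose i j = f"
  by (simp add: comp_assoc)

lemma transpose_Suc_commute:
  assumes "\<bar>int i - int j\<bar> > 1"
  shows "transpose i (Suc i) \<circ> transpose j (Suc j) = transpose j (Suc j) \<circ> transpose i (Suc i)"
  using assms by (auto simp: fun_eq_iff transpose_def)

lemma transpose_Suc_braid:
  "transpose i (Suc i) \<circ> transpose (Suc i) (Suc (Suc i)) \<circ> transpose i (Suc i) =
   transpose (Suc i) (Suc (Suc i)) \<circ> transpose i (Suc i) \<circ> transpose (Suc i) (Suc (Suc i))"
  by (auto simp: fun_eq_iff transpose_def)

lemma comp_transpose_idem: "f i = f j \<Longrightarrow> f \<circ> transpose i j = f"
  by (auto simp: fun_eq_iff transpose_def)

lemma overwrite_transpose: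
  "(f \<circ> transpose i j)(i := a, j := b) = f(i := a, j := b)"
  by (auto simp: fun_eq_iff transpose_def)

lemmas sem_simps = comp_transpose_idem fun_upd_idem fun_upd_comp_transpose comp_transpose_transpose transpose_def

lemma sem_e: "sem_word [LE, LE] = sem_word [LE]"
  "sem_word [LE] = sem_word [LE, LQ, LE]"
  "sem_word [LE, LQ, LE] = sem_word [LE, LO, LE]"
  by (rule sem_word_eqI; auto simp: sem_simps simp del: One_nat_def)+

lemma sem_q: "sem_word [LQ, LQ] = sem_word [LQ]"
  "sem_word [LQ] = sem_word [LQ, LE, LQ]"
  "sem_word [LQ, LE, LQ] = sem_word [LQ, LS 1]"
  "sem_word [LQ, LS 1] = sem_word [LS 1, LQ]"
  by (rule sem_word_eqI; auto simp: sem_simps simp del: One_nat_def)+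

lemma sem_ei:
  assumes "i \<ge> 2" shows "sem_word [LE, LS i] = sem_word [LS i, LE]"
  using assms by (intro sem_word_eqI) (auto simp: sem_simps simp del: One_nat_def)

lemma sem_qi:
  assumes "i \<ge> 3" shows "sem_word [LQ, LS i] = sem_word [LS i, LQ]"
  using assms by (intro sem_word_eqI) (auto simp: sem_simps simp del: One_nat_def)

lemma sem_oi:
  assumes "i \<ge> 2" shows "sem_word [LO, LS i] = sem_word [LS i, LO]"
  using assms by (intro sem_word_eqI) (auto simp: sem_simps simp del: One_nat_def)

lemma sem_ese: "sem_word [LS 1, LE, LS 1, LE] = sem_word [LE, LS 1, LE, LS 1]"
  "sem_word [LE, LS 1, LE, LS 1] = sem_word [LE, LS 1, LE]"
  by (rule sem_word_eqI; auto simp: sem_simps fun_upd_twist[of 2 1] overwrite_transpose simp del: One_nat_def)+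

lemma sem_qsq: "sem_word [LQ, LS 2, LQ, LS 2] = sem_word [LS 2, LQ, LS 2, LQ]"
  by (intro sem_word_eqI) (auto simp: sem_simps simp del: One_nat_def)

lemma sem_qq: "sem_word [LQ, LS 2, LS 1, LS 3, LS 2, LQ, LS 2, LS 1, LS 3, LS 2] =
            sem_word [LS 2, LS 1, LS 3, LS 2, LQ, LS 2, LS 1, LS 3, LS 2, LQ]"
proof -
  have "f \<circ> transpose 3 4 \<circ> transpose 1 2 = f \<circ> transpose 1 2 \<circ> transpose 3 4" for f :: "nat \<Rightarrow> bool"
    by (auto simp: fun_eq_iff transpose_def)
  then show ?thesis
    by (intro sem_word_eqI) (auto simp: sem_simps simp del: One_nat_def)
qed

lemma sem_qe: "sem_word [LQ, LS 2, LS 1, LE, LS 1, LS 2] = sem_word [LS 2, LS 1, LE, LS 1, LS 2, LQ]"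
  by (intro sem_word_eqI) (auto simp: sem_simps simp del: One_nat_def)

lemma sem_qo: "sem_word [LQ, LS 2, LS 1, LO, LS 1, LS 2] = sem_word [LS 2, LS 1, LO, LS 1, LS 2, LQ]"
  by (intro sem_word_eqI) (auto simp: sem_simps simp del: One_nat_def)

lemma sem_o: "sem_word [LO, LO] = sem_word [LO]" "sem_word [LO] = sem_word [LO, LE, LO]"
  by (rule sem_word_eqI; auto simp: sem_simps simp del: One_nat_def)+

lemma sem_oo: "sem_word [LO, LS 1, LO, LS 1] = sem_word [LS 1, LO, LS 1, LO]"
  "sem_word [LS 1, LO, LS 1, LO] = sem_word [LO, LS 1, LO]"
  "sem_word [LO, LS 1, LO] = sem_word [LO, LQ]"
  "sem_word [LO, LQ] = sem_word [LQ, LO]"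
  by (rule sem_word_eqI; auto simp: sem_simps simp del: One_nat_def)+

lemma sem_eo: "sem_word [LE, LS 1, LO, LS 1] = sem_word [LS 1, LO, LS 1, LE]"
  by (rule sem_word_eqI; auto simp add: sem_simps simp del: One_nat_def)

lemma sem_ss: "sem_word [LS i, LS i] = sem_word []"
  by (rule sem_word_eqI) (simp add: sem_simps)

lemma sem_sisj:
  assumes "\<bar>int i - int j\<bar> > 1"
  shows "sem_word [LS i, LS j] = sem_word [LS j, LS i]"
  by (rule sem_word_eqI) (simp add: comp_assoc transpose_Suc_commute[OF assms])

lemma sem_braid:
  assumes "\<bar>int i - int j\<bar> = 1"
  shows "sem_word [LS i, LS j, LS i] = sem_word [LS j, LS i, LS j]"
proof -
  have *: "sem_word [LS i, LS (Suc i), LS i] = sem_word [LS (Suc i), LS i, LS (Suc i)]" for i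
    using transpose_Suc_braid[of i] by (intro sem_word_eqI) (simp add: comp_assoc)
  have "j = Suc i \<or> i = Suc j" using assms by auto
  then show ?thesis using *[of i] *[of j] by auto
qed

lemma sem_relation:
  assumes "(u, v) \<in> all_relations"
  shows "sem_word u = sem_word v"
proof -
  \<comment> \<open>Hiding the equation behind \<open>P\<close> keeps \<open>auto\<close> from
    rewriting it, so that the collected facts match the goals as introduction rules.\<close>
  define P where "P u v \<longleftrightarrow> sem_word u = sem_word v" for u v
  note sem = sem_ss sem_sisj sem_braid sem_e sem_q sem_ei sem_qi sem_oi sem_ese sem_qsq
    sem_qq sem_qe sem_qo sem_o sem_oo sem_eo
  have "P u v"
    using assms unfolding all_relations_def chain_def
    by (elim UnE UN_E) (auto intro: sem[folded P_def] simp del: One_nat_def)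
  then show ?thesis by (simp add: P_def)
qed

abbreviation pinv :: "('a \<Rightarrow> 'a) \<Rightarrow> 'a \<Rightarrow> 'a" where
  "pinv f \<equiv> Hilbert_Choice.inv f"

section \<open>Products of commuting idempotents\<close>

text \<open>\<open>SOME\<close> picks an arbitrary enumeration, possibly with repetitions. For
  commuting idempotents the product does not depend on it.\<close>

definition iprod :: "('i \<Rightarrow> 'm::monoid_mult) \<Rightarrow> 'i set \<Rightarrow> 'm" where
  "iprod g A = prod_list (map g (SOME xs. set xs = A))"

lemma iprod_list:
  assumes "finite A"
  obtains xs where "set xs = A" "iprod g A = prod_list (map g xs)"
  using someI_ex[OF finite_list[OF assms]] unfolding iprod_def by blast

lemma iprod_empty [simp]: "iprod g {} = 1"
  by (rule iprod_list[of "{}" g]) auto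

lemma iprod_cong:
  assumes "\<And>a. a \<in> A \<Longrightarrow> g a = g' a" "finite A"
  shows "iprod g A = iprod g' A"
proof -
  have "set (SOME xs. set xs = A) = A" by (rule someI_ex[OF finite_list[OF assms(2)]])
  then show ?thesis unfolding iprod_def using assms(1) by (intro arg_cong[of _ _ prod_list]) simp
qed

lemma iprod_commute:
  assumes "\<And>a. a \<in> A \<Longrightarrow> x * g a = g a * x" "finite A"
  shows "x * iprod g A = iprod g A * x"
proof (rule iprod_list[OF assms(2), of g])
  fix xs assume xs: "set xs = A" "iprod g A = prod_list (map g xs)"
  have "x * prod_list (map g ys) = prod_list (map g ys) * x" if "set ys \<subseteq> A" for ys
    using that
  proof (induction ys)
    case (Cons y ys)
    then show ?case using assms(1)[of y] by simp (metis mult.assoc)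
  qed simp
  with xs show ?thesis by simp
qed

lemma iprod_fix_right:
  assumes "\<And>a. a \<in> A \<Longrightarrow> x * g a = x" "finite A"
  shows "x * iprod g A = x"
proof (rule iprod_list[OF assms(2), of g])
  fix xs assume xs: "set xs = A" "iprod g A = prod_list (map g xs)"
  have "x * prod_list (map g ys) = x" if "set ys \<subseteq> A" for ys
    using that assms(1) by (induction ys) (simp_all flip: mult.assoc)
  with xs show ?thesis by simp
qed

locale commuting_idempotents =
  fixes g :: "'i \<Rightarrow> 'm::monoid_mult"
  assumes comm: "g a * g b = g b * g a"
    and idem: "g a * g a = g a"
begin

lemma prod_list_commute: "g a * prod_list (map g xs) = prod_list (map g xs) * g a"
proof (induction xs)
  case (Cons x xs)
  then show ?case using comm[of a x] by simp (metis mult.assoc)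
qed simp

lemma prod_list_absorb: "a \<in> set xs \<Longrightarrow> g a * prod_list (map g xs) = prod_list (map g xs)"
proof (induction xs)
  case (Cons x xs)
  show ?case
  proof (cases "a = x")
    case True
    then show ?thesis by (simp add: idem flip: mult.assoc)
  next
    case False
    with Cons have "g a * prod_list (map g xs) = prod_list (map g xs)" by simp
    then show ?thesis using comm[of a x] by simp (metis mult.assoc)
  qed
qed simp

lemma prod_list_absorb_list:
  "set ys \<subseteq> set xs \<Longrightarrow> prod_list (map g ys) * prod_list (map g xs) = prod_list (map g xs)"
  by (induction ys) (simp_all add: mult.assoc prod_list_absorb)

lemma prod_list_commute_list:
  "prod_list (map g ys) * prod_list (map g xs) = prod_list (map g xs) * prod_list (map g ys)"
proof (induction ys)
  case (Cons y ys)
  then show ?case using prod_list_commute[of y xs] by simp (metis mult.assoc)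
qed simp

text \<open>With equal supports each product absorbs the other, and the two commute; hence both
  equal their common product.\<close>

lemma prod_list_set_eq:
  assumes "set xs = set ys"
  shows "prod_list (map g xs) = prod_list (map g ys)"
  using prod_list_absorb_list[of ys xs] prod_list_absorb_list[of xs ys] prod_list_commute_list[of xs ys]
    assms by simp

lemma iprod_set: "iprod g (set xs) = prod_list (map g xs)"
  by (rule iprod_list[of "set xs" g]) (auto intro: prod_list_set_eq)

lemma iprod_insert: "finite A \<Longrightarrow> iprod g (insert a A) = g a * iprod g A"
proof (rule iprod_list[of A g])
  fix xs assume "set xs = A" "iprod g A = prod_list (map g xs)"
  then show ?thesis using iprod_set[of "a # xs"] by simp
qed

lemma iprod_Un:
  assumes "finite A" "finite B"
  shows "iprod g (A \<union> B) = iprod g A * iprod g B"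
proof -
  obtain xs ys where "set xs = A" "set ys = B" using assms finite_list by metis
  then show ?thesis using iprod_set[of xs] iprod_set[of ys] iprod_set[of "xs @ ys"] by simp
qed

lemma iprod_mult_commute:
  assumes "finite A"
  shows "g a * iprod g A = iprod g A * g a"
  by (rule iprod_commute) (simp_all add: comm assms)

lemma iprod_absorb:
  assumes "finite A" "a \<in> A"
  shows "g a * iprod g A = iprod g A" "iprod g A * g a = iprod g A"
  using iprod_insert[OF assms(1), of a] iprod_mult_commute[OF assms(1), of a] insert_absorb[OF assms(2)]
  by simp_all

text \<open>This is how a permutation is moved past a product. \<open>h\<close> and \<open>g\<close>
  may differ because colours attached to the indices are reindexed as well; factors that become
  equal under \<open>\<phi>\<close> are absorbed.\<close>

lemma iprod_conj:
  assumes "finite A" "\<And>a. a \<in> A \<Longrightarrow> p * h a = g (\<phi> a) * p"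
  shows "p * iprod h A = iprod g (\<phi> ` A) * p"
proof (rule iprod_list[OF assms(1), of h])
  fix xs assume xs: "set xs = A" "iprod h A = prod_list (map h xs)"
  have "p * prod_list (map h ys) = prod_list (map g (map \<phi> ys)) * p" if "set ys \<subseteq> A" for ys
    using that
  proof (induction ys)
    case (Cons y ys)
    then show ?case using assms(2)[of y] by simp (metis mult.assoc)
  qed simp
  with xs have "p * iprod h A = prod_list (map g (map \<phi> xs)) * p" by simp
  also have "prod_list (map g (map \<phi> xs)) = iprod g (\<phi> ` A)"
    using iprod_set[of "map \<phi> xs"] xs(1) by simp
  finally show ?thesis .
qed

end

section \<open>The symmetric group inside the presented monoid\<close>

text \<open>\<open>'m\<close> is an arbitrary monoid in which the relations hold, and
  \<open>rho\<close> evaluates its elements as diagrams. The relations prove elements equal, while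
  \<open>rho\<close> proves them different.\<close>

locale rook_presentation =
  fixes n :: nat and gen :: "letter \<Rightarrow> 'm::monoid_mult" and rho :: "'m \<Rightarrow> (nat \<Rightarrow> bool) rel"
  assumes n2: "n \<ge> 2"
    and rel: "(u, v) \<in> relations n \<Longrightarrow> prod_list (map gen u) = prod_list (map gen v)"
    and rho_mult: "rho (x * y) = rho x O rho y"
    and rho_one: "rho 1 = Id"
    and rho_gen: "c \<in> letters n \<Longrightarrow> rho (gen c) = sem c"
begin

abbreviation s where "s i \<equiv> gen (LS i)"

definition sprod :: "nat list \<Rightarrow> 'm" where
  "sprod w = prod_list (map s w)"

lemma sprod_simps [simp]: "sprod [] = 1" "sprod (i # w) = s i * sprod w" "sprod (u @ v) = sprod u * sprod v"
  by (simp_all add: sprod_def)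

lemma relI:
  assumes "(u, v) \<in> all_relations" "set u \<subseteq> letters n" "set v \<subseteq> letters n"
  shows "prod_list (map gen u) = prod_list (map gen v)"
  using rel assms by (auto simp: relations_def in_lists_conv_set)

lemma s_letter: "1 \<le> i \<Longrightarrow> i < n \<Longrightarrow> LS i \<in> letters n"
  by (auto simp: letters_def)

lemma other_letters: "LE \<in> letters n" "LQ \<in> letters n" "LO \<in> letters n"
  by (auto simp: letters_def)

lemma s_square: "1 \<le> i \<Longrightarrow> i < n \<Longrightarrow> s i * s i = 1"
  using relI[of "[LS i, LS i]" "[]"] s_letter by (simp add: all_relations_def chain_def)

lemma s_commute: "1 \<le> i \<Longrightarrow> Suc i < j \<Longrightarrow> j < n \<Longrightarrow> s i * s j = s j * s i"
  using relI[of "[LS i, LS j]" "[LS j, LS i]"] s_letter by (simp add: all_relations_def chain_def)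

lemma s_braid: "1 \<le> i \<Longrightarrow> Suc i < n \<Longrightarrow> s i * s (Suc i) * s i = s (Suc i) * s i * s (Suc i)"
  using relI[of "[LS i, LS (Suc i), LS i]" "[LS (Suc i), LS i, LS (Suc i)]"] s_letter
  by (simp add: all_relations_def chain_def mult.assoc)

primrec tprod :: "nat list \<Rightarrow> nat \<Rightarrow> nat" where
  "tprod [] = id"
| "tprod (i # w) = transpose i (Suc i) \<circ> tprod w"

lemma tprod_append: "tprod (u @ v) = tprod u \<circ> tprod v"
  by (induction u) (simp_all add: comp_assoc)

lemma rho_sprod: "set w \<subseteq> {1..<n} \<Longrightarrow> rho (sprod w) = {(f, g). g = f \<circ> tprod w}"
proof (induction w)
  case Nil
  show ?case by (auto simp: rho_one)
next
  case (Cons i w)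
  then have "rho (s i) = {(f, g). g = f \<circ> transpose i (Suc i)}" by (auto simp: rho_gen s_letter)
  with Cons show ?case by (auto simp: rho_mult comp_assoc relcomp_unfold)
qed

lemma graph_comp_inj:
  assumes "{(f :: nat \<Rightarrow> bool, g). g = f \<circ> p} = {(f, g). g = f \<circ> q}"
  shows "(p :: nat \<Rightarrow> nat) = q"
proof
  fix x
  \<comment> \<open>The indicator of the point \<open>p x\<close> detects any map with another value
    at \<open>x\<close>.\<close>
  have "((\<lambda>y. y = p x), (\<lambda>y. y = p x) \<circ> p) \<in> {(f, g). g = f \<circ> q}"
    unfolding assms[symmetric] by simp
  then have "(\<lambda>y. y = p x) \<circ> p = (\<lambda>y. y = p x) \<circ> q" by (simp only: mem_Collect_eq case_prod_conv)
  from fun_cong[OF this, of x] show "p x = q x" by simp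
qed

lemma sprod_eq_imp_tprod_eq:
  assumes "set u \<subseteq> {1..<n}" "set v \<subseteq> {1..<n}" "sprod u = sprod v"
  shows "tprod u = tprod v"
  using assms rho_sprod[of u] rho_sprod[of v] by (intro graph_comp_inj) simp

lemma tprod_permutes: "set w \<subseteq> {a..<b} \<Longrightarrow> tprod w permutes {a..b}"
proof (induction w)
  case Nil
  show ?case using permutes_id[of "{a..b}"] by (simp only: tprod.simps)
next
  case (Cons i w)
  then have "transpose i (Suc i) permutes {a..b}" by (intro permutes_swap_id) auto
  moreover have "tprod w permutes {a..b}" using Cons by simp
  ultimately show ?case using permutes_compose by (simp only: tprod.simps)
qed

section \<open>Coset representatives and the presentation of the symmetric group\<close>

text \<open>The word with indices \<open>k, k - 1, ..., j\<close>. For \<open>j\<close> from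
  \<open>1\<close> to \<open>Suc k\<close>, the last giving the empty word, these represent the
  cosets of the permutations of \<open>{1..k}\<close> in those of \<open>{1..Suc k}\<close>.\<close>

definition desc :: "nat \<Rightarrow> nat \<Rightarrow> nat list" where
  "desc k j = rev [j..<Suc k]"

lemma desc_empty [simp]: "desc k (Suc k) = []"
  by (simp add: desc_def)

lemma desc_rec: "j \<le> k \<Longrightarrow> desc k j = desc k (Suc j) @ [j]"
  unfolding desc_def by (subst upt_conv_Cons) auto

lemma set_desc [simp]: "set (desc k j) = {j..k}"
  by (auto simp: desc_def)

lemma sprod_commute:
  assumes "\<And>j. j \<in> set w \<Longrightarrow> s i * s j = s j * s i"
  shows "s i * sprod w = sprod w * s i"
  using assms
proof (induction w)
  case (Cons j w)
  then have "s i * s j = s j * s i" "s i * sprod w = sprod w * s i" by simp_all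
  then show ?case by simp (metis mult.assoc)
qed simp

text \<open>\<open>s i\<close> commutes leftwards until it meets \<open>s i * s (i - 1)\<close>. The
  braid relation turns this into a word starting with \<open>s (i - 1)\<close>, which commutes with
  all remaining factors on its left.\<close>

lemma desc_mult_greater:
  assumes "1 \<le> j" "j < i" "i \<le> k" "k < n"
  shows "sprod (desc k j) * s i = s (i - 1) * sprod (desc k j)"
  using assms
proof (induction "k - j" arbitrary: j rule: less_induct)
  case less
  show ?case
  proof (cases "i = Suc j")
    case True
    have "desc k j = desc k (Suc i) @ [i, j]"
      using desc_rec[of j k] desc_rec[of i k] less.prems True by simp
    then have "sprod (desc k j) * s i = sprod (desc k (Suc i)) * (s i * s j * s i)"
      by (simp add: mult.assoc)
    also have "s i * s j * s i = s j * s i * s j" using s_braid[of j] True less.prems by simp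
    also have "sprod (desc k (Suc i)) * (s j * s i * s j) = sprod (desc k (Suc i)) * s j * (s i * s j)"
      by (simp add: mult.assoc)
    also have "sprod (desc k (Suc i)) * s j = s j * sprod (desc k (Suc i))"
      by (rule sprod_commute[symmetric]) (use s_commute True less.prems in auto)
    finally show ?thesis using \<open>desc k j = _\<close> True by (simp add: mult.assoc)
  next
    case False
    have "sprod (desc k j) * s i = sprod (desc k (Suc j)) * (s j * s i)"
      using desc_rec[of j k] less.prems by (simp add: mult.assoc)
    also have "s j * s i = s i * s j" using s_commute[of j i] False less.prems by simp
    also have "sprod (desc k (Suc j)) * (s i * s j) = sprod (desc k (Suc j)) * s i * s j"
      by (simp add: mult.assoc)
    also have "sprod (desc k (Suc j)) * s i = s (i - 1) * sprod (desc k (Suc j))"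
      by (rule less.hyps) (use False less.prems in auto)
    finally show ?thesis using desc_rec[of j k] less.prems by (simp add: mult.assoc)
  qed
qed

text \<open>Multiplying \<open>desc k j\<close> by \<open>s i\<close> has four outcomes: far below
  \<open>j\<close> the factor commutes to the left, at \<open>j - 1\<close> and \<open>j\<close> it
  lengthens or shortens the representative, and above \<open>j\<close> it emerges on the left as
  \<open>s (i - 1)\<close>.\<close>

lemma coset_form:
  assumes "set w \<subseteq> {1..<Suc k}" "k < n"
  shows "\<exists>v j. set v \<subseteq> {1..<k} \<and> 1 \<le> j \<and> j \<le> Suc k \<and> sprod w = sprod (v @ desc k j)"
  using assms
proof (induction w rule: rev_induct)
  case Nil
  have "sprod [] = sprod ([] @ desc k (Suc k))" by simp
  then show ?case by (intro exI[of _ "[]"] exI[of _ "Suc k"]) simp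
next
  case (snoc i w)
  then obtain v j where v: "set v \<subseteq> {1..<k}" "1 \<le> j" "j \<le> Suc k" "sprod w = sprod (v @ desc k j)"
    by auto
  have i: "1 \<le> i" "i \<le> k" using snoc.prems by auto
  have w: "sprod (w @ [i]) = sprod v * (sprod (desc k j) * s i)" using v by (simp add: mult.assoc)
  consider "Suc i < j" | "j = Suc i" | "i = j" | "j < i" by linarith
  then show ?case
  proof cases
    case 1
    have "sprod (desc k j) * s i = s i * sprod (desc k j)"
      by (rule sprod_commute[symmetric]) (use s_commute[of i] 1 i snoc.prems in auto)
    then have "sprod (w @ [i]) = sprod ((v @ [i]) @ desc k j)" unfolding w by (simp add: mult.assoc)
    moreover have "set (v @ [i]) \<subseteq> {1..<k}" using v i 1 by auto
    ultimately show ?thesis using v by blast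
  next
    case 2
    then have "sprod (w @ [i]) = sprod (v @ desc k i)" using desc_rec[of i k] i unfolding w by simp
    then show ?thesis using v i by (intro exI[of _ v] exI[of _ i]) auto
  next
    case 3
    then have "sprod (desc k j) * s i = sprod (desc k (Suc j)) * (s i * s i)"
      using desc_rec[of j k] i by (simp add: mult.assoc)
    then have "sprod (w @ [i]) = sprod (v @ desc k (Suc j))"
      using s_square[of i] i snoc.prems unfolding w by simp
    then show ?thesis using v i 3 by (intro exI[of _ v] exI[of _ "Suc j"]) auto
  next
    case 4
    then have "sprod (w @ [i]) = sprod ((v @ [i - 1]) @ desc k j)"
      using desc_mult_greater[of j i k] v i snoc.prems unfolding w by (simp add: mult.assoc)
    moreover have "set (v @ [i - 1]) \<subseteq> {1..<k}" using v i 4 by auto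
    ultimately show ?thesis using v by blast
  qed
qed

lemma tprod_desc: "j \<le> Suc k \<Longrightarrow> tprod (desc k j) j = Suc k"
proof (induction "Suc k - j" arbitrary: j)
  case (Suc m)
  then have "j \<le> k" by auto
  moreover have "tprod (desc k (Suc j)) (Suc j) = Suc k" using Suc by (intro Suc.hyps) auto
  ultimately show ?case by (simp add: desc_rec tprod_append)
qed simp

text \<open>Words over \<open>{1..<k}\<close> fix \<open>Suc k\<close>, so the coset index
  \<open>j\<close> is recovered from the permutation as the preimage of
  \<open>Suc k\<close>.\<close>

lemma tprod_coset:
  assumes "set v \<subseteq> {1..<k}" "j \<le> Suc k"
  shows "tprod (v @ desc k j) j = Suc k"
  using tprod_desc[OF assms(2)] permutes_not_in[OF tprod_permutes[OF assms(1)], of "Suc k"]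
  by (simp add: tprod_append)

lemma bij_tprod: "bij (tprod w)"
proof (induction w)
  case (Cons i w)
  then show ?case using bij_comp[OF Cons bij_transpose] by (simp only: tprod.simps)
qed (simp add: bij_id[unfolded id_def] id_def)

text \<open>Moore's presentation of the symmetric group, by induction along the cosets of
  \<open>S\<^sub>k\<close> in \<open>S\<^sub>k\<^sub>+\<^sub>1\<close>.\<close>

lemma tprod_eq_imp_sprod_eq:
  assumes "set u \<subseteq> {1..<k}" "set v \<subseteq> {1..<k}" "k \<le> n" "tprod u = tprod v"
  shows "sprod u = sprod v"
  using assms
proof (induction k arbitrary: u v)
  case 0
  then show ?case by simp
next
  case (Suc k)
  obtain u' i where u': "set u' \<subseteq> {1..<k}" "1 \<le> i" "i \<le> Suc k" "sprod u = sprod (u' @ desc k i)"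
    using coset_form[of u k] Suc.prems by auto
  obtain v' j where v': "set v' \<subseteq> {1..<k}" "1 \<le> j" "j \<le> Suc k" "sprod v = sprod (v' @ desc k j)"
    using coset_form[of v k] Suc.prems by auto
  have u: "tprod u = tprod (u' @ desc k i)"
    by (rule sprod_eq_imp_tprod_eq) (use u' Suc.prems in auto)
  have v: "tprod v = tprod (v' @ desc k j)"
    by (rule sprod_eq_imp_tprod_eq) (use v' Suc.prems in auto)
  have "tprod v i = Suc k" using tprod_coset[of u' k i] u u' Suc.prems by simp
  moreover have "tprod v j = Suc k" using tprod_coset[of v' k j] v v' by simp
  \<comment> \<open>Equal permutations have the same coset index, so the common representative can
    be cancelled.\<close>
  ultimately have "i = j" using bij_tprod[of v] by (metis bij_pointE)
  then have eq: "tprod u' \<circ> tprod (desc k j) = tprod v' \<circ> tprod (desc k j)"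
    using u v Suc.prems by (simp only: tprod_append)
  have inv: "tprod (desc k j) \<circ> pinv (tprod (desc k j)) = id"
    using bij_is_surj[OF bij_tprod] by (simp only: surj_iff)
  have "tprod u' = tprod v'"
    using arg_cong[OF eq, of "\<lambda>p. p \<circ> pinv (tprod (desc k j))"] by (simp only: comp_assoc inv comp_id)
  then have "sprod u' = sprod v'" using Suc.IH[OF u'(1) v'(1)] Suc.prems(3) by auto
  then show ?case by (simp only: u'(4) v'(4) \<open>i = j\<close> sprod_simps)
qed

section \<open>Permutations as elements of the monoid\<close>

text \<open>The lower end \<open>a\<close> is kept general because the stabilisers of
  \<open>1\<close>, and of \<open>1\<close> and \<open>2\<close>, need words avoiding the first
  generators.\<close>

lemma permutation_word:
  assumes "p permutes {a..b}" "1 \<le> a"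
  shows "\<exists>w. set w \<subseteq> {a..<b} \<and> tprod w = p"
  using assms
proof (induction b arbitrary: p)
  case 0
  then have "p = id" by (simp add: permutes_empty)
  then show ?case by (intro exI[of _ "[]"]) simp
next
  case (Suc k)
  show ?case
  proof (cases "a \<le> Suc k")
    case False
    then have "p = id" using Suc.prems by (simp add: permutes_empty)
    then show ?thesis by (intro exI[of _ "[]"]) simp
  next
    case True
    obtain j where j: "p j = Suc k" using permutes_surj[OF Suc.prems(1)] by (metis surjD)
    have "j \<in> {a..Suc k}" using j True Suc.prems permutes_in_image[OF Suc.prems(1), of j] by auto
    define c where "c = tprod (desc k j)"
    have c: "c permutes {a..Suc k}"
      unfolding c_def by (rule tprod_permutes) (use \<open>j \<in> _\<close> in auto)
    have "c j = Suc k" unfolding c_def by (rule tprod_desc) (use \<open>j \<in> _\<close> in auto)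
    \<comment> \<open>Stripping the cycle \<open>c\<close>, which carries the preimage
      \<open>j\<close> of \<open>Suc k\<close> under \<open>p\<close> to \<open>Suc k\<close>,
      leaves a permutation that fixes \<open>Suc k\<close>.\<close>
    define q where "q = p \<circ> pinv c"
    have q: "q permutes {a..Suc k}"
      unfolding q_def by (rule permutes_compose[OF permutes_inv[OF c] Suc.prems(1)])
    have "q (Suc k) = Suc k"
      unfolding q_def using j \<open>c j = Suc k\<close> permutes_inverses(2)[OF c, of j] by simp
    then have "q permutes {a..k}"
      using q by (intro permutes_superset[OF q]) (auto simp: le_Suc_eq)
    then obtain w where w: "set w \<subseteq> {a..<k}" "tprod w = q" using Suc.IH Suc.prems(2) by blast
    have "tprod (w @ desc k j) = p"
      using w(2) permutes_inv_o(2)[OF c] by (simp add: tprod_append c_def[symmetric] q_def comp_assoc)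
    moreover have "set (w @ desc k j) \<subseteq> {a..<Suc k}" using w(1) \<open>j \<in> _\<close> by auto
    ultimately show ?thesis by blast
  qed
qed

text \<open>The choice of the word is immaterial by \<open>tprod_eq_imp_sprod_eq\<close>, which is
  what makes \<open>perm\<close> multiplicative.\<close>

definition perm :: "(nat \<Rightarrow> nat) \<Rightarrow> 'm" where
  "perm p = sprod (SOME w. set w \<subseteq> {1..<n} \<and> tprod w = p)"

lemma perm_tprod:
  assumes "set w \<subseteq> {1..<n}"
  shows "perm (tprod w) = sprod w"
proof -
  have "set (SOME v. set v \<subseteq> {1..<n} \<and> tprod v = tprod w) \<subseteq> {1..<n} \<and>
      tprod (SOME v. set v \<subseteq> {1..<n} \<and> tprod v = tprod w) = tprod w"
    by (rule someI_ex) (use assms in blast)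
  then show ?thesis unfolding perm_def
    using tprod_eq_imp_sprod_eq assms by blast
qed

lemma perm_id [simp]: "perm id = 1"
  using perm_tprod[of "[]"] by simp

lemma perm_comp:
  assumes "p permutes {1..n}" "q permutes {1..n}"
  shows "perm (p \<circ> q) = perm p * perm q"
proof -
  obtain u v where "set u \<subseteq> {1..<n}" "tprod u = p" "set v \<subseteq> {1..<n}" "tprod v = q"
    using assms permutation_word by (metis order_refl)
  then show ?thesis using perm_tprod[of u] perm_tprod[of v] perm_tprod[of "u @ v"] by (simp add: tprod_append)
qed

lemma perm_inverse:
  assumes "p permutes {1..n}"
  shows "perm (pinv p) * perm p = 1" "perm p * perm (pinv p) = 1"
  using perm_comp[OF permutes_inv[OF assms] assms] perm_comp[OF assms permutes_inv[OF assms]]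
    permutes_inv_o[OF assms] by simp_all

lemma perm_transpose: "1 \<le> i \<Longrightarrow> i < n \<Longrightarrow> perm (transpose i (Suc i)) = s i"
  using perm_tprod[of "[i]"] by simp

lemma rho_perm: "p permutes {1..n} \<Longrightarrow> rho (perm p) = {(f, g). g = f \<circ> p}"
  using permutation_word[of p 1 n] perm_tprod rho_sprod by (metis order_refl)

end

text \<open>\<open>A\<close> and its injective image have complements of equal size in
  \<open>B\<close>, and any bijection between these completes \<open>f\<close>. It yields
  permutations with up to four prescribed values and, for surjectivity, one that joins the ends of
  transversal blocks.\<close>

lemma extend_to_permutation:
  assumes "finite B" "A \<subseteq> B" "inj_on f A" "f ` A \<subseteq> B"
  shows "\<exists>p. p permutes B \<and> (\<forall>a\<in>A. p a = f a)"
proof -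
  have "card (B - A) = card (B - f ` A)"
    using assms by (simp add: card_Diff_subset finite_subset card_image)
  then obtain h where h: "bij_betw h (B - A) (B - f ` A)"
    using assms(1) by (metis finite_Diff finite_same_card_bij)
  define p where "p x = (if x \<in> A then f x else if x \<in> B then h x else x)" for x
  have "bij_betw p A (f ` A)"
    using assms(3) by (simp add: bij_betw_def p_def inj_on_def)
  moreover have "bij_betw p (B - A) (B - f ` A)"
    using h by (rule bij_betw_cong[THEN iffD1, rotated]) (simp add: p_def)
  ultimately have "bij_betw p (A \<union> (B - A)) (f ` A \<union> (B - f ` A))"
    by (rule bij_betw_combine) auto
  then have "bij_betw p B B" using assms(2,4) by (simp add: Un_absorb1)
  then have "p permutes B" by (rule bij_imp_permutes) (use assms(2) in \<open>auto simp: p_def\<close>)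
  then show ?thesis by (auto simp: p_def)
qed

context rook_presentation
begin

section \<open>Conjugates of the generators\<close>

text \<open>Intended for \<open>a = 2\<close> with \<open>gen LE\<close> and \<open>gen LO\<close>,
  which involve only vertex \<open>1\<close>, and for \<open>a = 3\<close> with
  \<open>gen LQ\<close>, which involves \<open>1\<close> and \<open>2\<close>.\<close>

lemma perm_commute:
  assumes "\<And>i. a \<le> i \<Longrightarrow> i < n \<Longrightarrow> x * s i = s i * x" "p permutes {a..n}" "1 \<le> a"
  shows "x * perm p = perm p * x"
proof -
  obtain w where w: "set w \<subseteq> {a..<n}" "tprod w = p"
    using permutation_word[OF assms(2,3)] by blast
  have "x * sprod w = sprod w * x"
    using w(1)
  proof (induction w)
    case (Cons i w)
    then have "x * s i = s i * x" "x * sprod w = sprod w * x" using assms(1) by auto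
    then show ?case by simp (metis mult.assoc)
  qed simp
  moreover have "set w \<subseteq> {1..<n}" using w(1) assms(3) by auto
  then have "perm p = sprod w" using perm_tprod[of w] w(2) by simp
  ultimately show ?thesis by simp
qed

text \<open>The colour \<open>True\<close> marks a singleton block, \<open>False\<close> a rook dot.\<close>

definition point :: "bool \<Rightarrow> 'm" where
  "point c = (if c then gen LE else gen LO)"

text \<open>The transposition is one choice among the permutations taking \<open>1\<close> to
  \<open>i\<close>; by \<open>perm_G\<close> all conjugate \<open>point c\<close> to the same
  element. The value \<open>1\<close> outside \<open>{1..n}\<close> lets many identities hold for
  all indices.\<close>

definition G :: "bool \<Rightarrow> nat \<Rightarrow> 'm" where
  "G c i = (if i \<in> {1..n} then perm (transpose 1 i) * point c * perm (transpose 1 i) else 1)"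

text \<open>The chosen conjugator is again immaterial, by \<open>perm_Q\<close>. Since
  \<open>Q i i\<close> is \<open>1\<close>, reflexive pairs are harmless in products over a
  relation.\<close>

definition Q :: "nat \<Rightarrow> nat \<Rightarrow> 'm" where
  "Q i j = (if i \<in> {1..n} \<and> j \<in> {1..n} \<and> i \<noteq> j
    then let p = (SOME p. p permutes {1..n} \<and> p 1 = i \<and> p 2 = j) in perm p * gen LQ * perm (pinv p)
    else 1)"

lemma point_commute: "2 \<le> i \<Longrightarrow> i < n \<Longrightarrow> point c * s i = s i * point c"
  using relI[of "[LE, LS i]" "[LS i, LE]"] relI[of "[LO, LS i]" "[LS i, LO]"] s_letter[of i] other_letters
  by (simp add: all_relations_def chain_def point_def)

lemma q_commute: "3 \<le> i \<Longrightarrow> i < n \<Longrightarrow> gen LQ * s i = s i * gen LQ"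
  using relI[of "[LQ, LS i]" "[LS i, LQ]"] s_letter[of i] other_letters
  by (simp add: all_relations_def chain_def)

lemma transpose_permutes: "i \<in> {1..n} \<Longrightarrow> j \<in> {1..n} \<Longrightarrow> transpose i j permutes {1..n}"
  by (rule permutes_swap_id)

lemma one_in: "1 \<in> {1..n}" "2 \<in> {1..n}" using n2 by auto

text \<open>\<open>\<sigma>\<close> compares the two conjugating transpositions. It fixes
  \<open>1\<close>, so it commutes with \<open>point c\<close> and carries one conjugate to the
  other.\<close>

lemma perm_G:
  assumes p: "p permutes {1..n}"
  shows "perm p * G c i = G c (p i) * perm p"
proof (cases "i \<in> {1..n}")
  case False
  then show ?thesis using permutes_not_in[OF p False] unfolding G_def by auto
next
  case True
  then have pi: "p i \<in> {1..n}" using permutes_in_image[OF p] by simp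
  define t t' \<sigma> where "t = transpose 1 i" and "t' = transpose 1 (p i)" and "\<sigma> = t' \<circ> p \<circ> t"
  have t: "t permutes {1..n}" "t' permutes {1..n}"
    unfolding t_def t'_def using transpose_permutes one_in True pi by blast+
  have \<sigma>: "\<sigma> permutes {1..n}"
    unfolding \<sigma>_def by (intro permutes_compose t p)
  have "\<sigma> 1 = 1" by (simp add: \<sigma>_def t_def t'_def)
  then have "\<sigma> permutes {2..n}"
    by (intro permutes_superset[OF \<sigma>]) (metis DiffE atLeastAtMost_iff le_neq_implies_less less_eq_Suc_le numeral_2_eq_2 One_nat_def)
  then have comm: "point c * perm \<sigma> = perm \<sigma> * point c"
    by (rule perm_commute[rotated]) (use point_commute in auto)
  have tt: "t \<circ> t = id" "t' \<circ> t' = id" by (simp_all add: t_def t'_def)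
  have 1: "p \<circ> t = t' \<circ> \<sigma>" unfolding \<sigma>_def comp_assoc[symmetric] tt by simp
  have 2: "\<sigma> \<circ> t = t' \<circ> p" unfolding \<sigma>_def comp_assoc tt by simp
  have "perm p * G c i = perm p * perm t * point c * perm t"
    using True by (simp add: G_def t_def mult.assoc)
  also have "perm p * perm t = perm t' * perm \<sigma>"
    using arg_cong[OF 1, of perm] by (simp only: perm_comp p t \<sigma>)
  also have "perm t' * perm \<sigma> * point c * perm t = perm t' * point c * (perm \<sigma> * perm t)"
    using comm by (metis mult.assoc)
  also have "perm \<sigma> * perm t = perm t' * perm p"
    using arg_cong[OF 2, of perm] by (simp only: perm_comp p t \<sigma>)
  finally show ?thesis using pi by (simp add: G_def t'_def mult.assoc)
qed

lemma perm_SOME: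
  assumes "i \<in> {1..n}" "j \<in> {1..n}" "i \<noteq> j"
  shows "(SOME p. p permutes {1..n} \<and> p 1 = i \<and> p 2 = j) permutes {1..n}"
    "(SOME p. p permutes {1..n} \<and> p 1 = i \<and> p 2 = j) 1 = i"
    "(SOME p. p permutes {1..n} \<and> p 1 = i \<and> p 2 = j) 2 = j"
proof -
  have "\<exists>p. p permutes {1..n} \<and> (\<forall>a\<in>{1,2}. p a = (if a = 1 then i else j))"
    by (rule extend_to_permutation) (use assms n2 in \<open>auto simp: inj_on_def\<close>)
  then have "\<exists>p. p permutes {1..n} \<and> p 1 = i \<and> p 2 = j" by auto
  from someI_ex[OF this] show "(SOME p. p permutes {1..n} \<and> p 1 = i \<and> p 2 = j) permutes {1..n}"
    "(SOME p. p permutes {1..n} \<and> p 1 = i \<and> p 2 = j) 1 = i"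
    "(SOME p. p permutes {1..n} \<and> p 1 = i \<and> p 2 = j) 2 = j" by blast+
qed

text \<open>Here \<open>\<sigma>\<close> compares the two chosen conjugators. It fixes both
  \<open>1\<close> and \<open>2\<close>, hence commutes with \<open>gen LQ\<close>.\<close>

lemma perm_Q:
  assumes p: "p permutes {1..n}"
  shows "perm p * Q i j = Q (p i) (p j) * perm p"
proof (cases "i \<in> {1..n} \<and> j \<in> {1..n} \<and> i \<noteq> j")
  case False
  then have "\<not> (p i \<in> {1..n} \<and> p j \<in> {1..n} \<and> p i \<noteq> p j)"
    using permutes_in_image[OF p] permutes_inj[OF p] by (auto dest: injD)
  with False show ?thesis unfolding Q_def by auto
next
  case True
  then have pij: "p i \<in> {1..n}" "p j \<in> {1..n}" "p i \<noteq> p j"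
    using permutes_in_image[OF p] permutes_inj[OF p] by (auto dest: injD)
  define r r' \<sigma> where "r = (SOME p. p permutes {1..n} \<and> p 1 = i \<and> p 2 = j)"
    and "r' = (SOME r. r permutes {1..n} \<and> r 1 = p i \<and> r 2 = p j)" and "\<sigma> = pinv r' \<circ> p \<circ> r"
  have r: "r permutes {1..n}" "r 1 = i" "r 2 = j"
    unfolding r_def using perm_SOME True by blast+
  have r': "r' permutes {1..n}" "r' 1 = p i" "r' 2 = p j"
    unfolding r'_def using perm_SOME pij by blast+
  have \<sigma>: "\<sigma> permutes {1..n}"
    unfolding \<sigma>_def by (intro permutes_compose permutes_inv r r' p)
  have "\<sigma> 1 = 1" "\<sigma> 2 = 2"
    using permutes_inverses(2)[OF r'(1), of 1] permutes_inverses(2)[OF r'(1), of 2]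
    by (simp_all add: \<sigma>_def r r' del: One_nat_def)
  then have "\<sigma> x = x" if "x \<in> {1..n} - {3..n}" for x
  proof -
    have "x = 1 \<or> x = 2" using that by auto
    then show ?thesis using \<open>\<sigma> 1 = 1\<close> \<open>\<sigma> 2 = 2\<close> by auto
  qed
  then have "\<sigma> permutes {3..n}" by (intro permutes_superset[OF \<sigma>]) auto
  then have comm: "gen LQ * perm \<sigma> = perm \<sigma> * gen LQ"
    by (rule perm_commute[rotated]) (use q_commute in auto)
  have 1: "p \<circ> r = r' \<circ> \<sigma>"
    unfolding \<sigma>_def comp_assoc[symmetric] permutes_inv_o(1)[OF r'(1)] by simp
  have 2: "\<sigma> \<circ> pinv r = pinv r' \<circ> p"
    unfolding \<sigma>_def comp_assoc permutes_inv_o(1)[OF r(1)] by simp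
  have "perm p * Q i j = perm p * perm r * gen LQ * perm (pinv r)"
    using True by (simp add: Q_def r_def Let_def mult.assoc)
  also have "perm p * perm r = perm r' * perm \<sigma>"
    using arg_cong[OF 1, of perm] by (simp only: perm_comp p r r' \<sigma>)
  also have "perm r' * perm \<sigma> * gen LQ * perm (pinv r) = perm r' * gen LQ * (perm \<sigma> * perm (pinv r))"
    using comm by (metis mult.assoc)
  also have "perm \<sigma> * perm (pinv r) = perm (pinv r') * perm p"
    using arg_cong[OF 2, of perm] by (simp only: perm_comp p permutes_inv[OF r(1)] permutes_inv[OF r'(1)] \<sigma>)
  finally show ?thesis using pij by (simp add: Q_def r'_def Let_def mult.assoc)
qed

section \<open>Transport of identities along permutations\<close>

text \<open>For fixed \<open>p\<close> and \<open>x\<close> the element \<open>y\<close> is the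
  conjugate of \<open>x\<close> by \<open>perm p\<close>. An identity at the indices
  \<open>1\<close> to \<open>4\<close> is carried to arbitrary indices by computing this conjugate
  from both of its sides.\<close>

definition intertwines :: "(nat \<Rightarrow> nat) \<Rightarrow> 'm \<Rightarrow> 'm \<Rightarrow> bool" where
  "intertwines p x y \<longleftrightarrow> p permutes {1..n} \<and> perm p * x = y * perm p"

lemma intertwines_mult:
  "intertwines p x y \<Longrightarrow> intertwines p x' y' \<Longrightarrow> intertwines p (x * x') (y * y')"
  unfolding intertwines_def by (metis mult.assoc)

lemma intertwines_eq:
  assumes "intertwines p x y" "intertwines p x y'"
  shows "y = y'"
proof -
  have "y * perm p * perm (pinv p) = y' * perm p * perm (pinv p)"
    using assms by (simp add: intertwines_def)
  then show ?thesis using assms(1) perm_inverse(2) by (simp add: mult.assoc intertwines_def)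
qed

lemma intertwines_G: "p permutes {1..n} \<Longrightarrow> p i = i' \<Longrightarrow> intertwines p (G c i) (G c i')"
  by (auto simp: intertwines_def perm_G)

lemma intertwines_Q: "p permutes {1..n} \<Longrightarrow> p i = i' \<Longrightarrow> p j = j' \<Longrightarrow> intertwines p (Q i j) (Q i' j')"
  by (auto simp: intertwines_def perm_Q)

lemma intertwines_perm:
  assumes p: "p permutes {1..n}" and "i \<in> {1..n}" "j \<in> {1..n}" "p i = i'" "p j = j'"
  shows "intertwines p (perm (transpose i j)) (perm (transpose i' j'))"
proof -
  have "i' \<in> {1..n}" "j' \<in> {1..n}" using permutes_in_image[OF p] assms by auto
  moreover have eq: "p \<circ> transpose i j = transpose i' j' \<circ> p"
    using assms(4,5) permutes_inj[OF p] by (auto simp: fun_eq_iff transpose_def dest: injD)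
  ultimately show ?thesis
    using perm_comp[OF p transpose_permutes[OF assms(2,3)]]
      perm_comp[OF transpose_permutes p, of i' j'] p
    unfolding intertwines_def eq by simp
qed

lemmas intertwines_intros = intertwines_mult intertwines_G intertwines_Q intertwines_perm

lemma s_G: "1 \<le> k \<Longrightarrow> k < n \<Longrightarrow> s k * G c i * s k = G c (transpose k (Suc k) i)"
  using perm_G[of "transpose k (Suc k)" c i] transpose_permutes[of k "Suc k"] s_square[of k]
  by (simp add: perm_transpose mult.assoc)

lemma s_Q: "1 \<le> k \<Longrightarrow> k < n \<Longrightarrow>
    s k * Q i j * s k = Q (transpose k (Suc k) i) (transpose k (Suc k) j)"
  using perm_Q[of "transpose k (Suc k)" i j] transpose_permutes[of k "Suc k"] s_square[of k]
  by (simp add: perm_transpose mult.assoc)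

lemma G_1: "G c 1 = point c"
  using n2 by (simp add: G_def transpose_same)

lemma Q_1_2: "Q 1 2 = gen LQ"
proof -
  define r where "r = (SOME p. p permutes {1..n} \<and> p 1 = 1 \<and> p 2 = 2)"
  have r: "r permutes {1..n}" "r 1 = 1" "r 2 = 2"
    unfolding r_def using perm_SOME[OF one_in] by simp_all
  have "r x = x" if "x \<in> {1..n} - {3..n}" for x
  proof -
    have "x = 1 \<or> x = 2" using that by auto
    then show ?thesis using r by auto
  qed
  then have "r permutes {3..n}" by (intro permutes_superset[OF r(1)]) auto
  then have "gen LQ * perm r = perm r * gen LQ"
    by (rule perm_commute[rotated]) (use q_commute in auto)
  then have "perm r * gen LQ * perm (pinv r) = gen LQ"
    using perm_inverse(2)[OF r(1)] by (metis mult.assoc mult.right_neutral)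
  then show ?thesis using one_in unfolding Q_def r_def by simp
qed

lemma s1: "1 \<le> (1::nat)" "1 < n" using n2 by auto

lemma G_2: "G c 2 = s 1 * point c * s 1"
  using s_G[OF s1, of c 1] by (simp add: G_1[unfolded One_nat_def] numeral_2_eq_2)

lemma G_3: "3 \<le> n \<Longrightarrow> G c 3 = s 2 * s 1 * point c * s 1 * s 2"
  using s_G[of 2 c 2] by (simp add: G_2 mult.assoc del: One_nat_def)

lemma Q_2_1: "Q 2 1 = gen LQ" "s 1 * gen LQ = gen LQ" "gen LQ * s 1 = gen LQ"
proof -
  show 1: "gen LQ * s 1 = gen LQ"
    using relI[of "[LQ]" "[LQ, LE, LQ]"] relI[of "[LQ, LE, LQ]" "[LQ, LS 1]"] other_letters s_letter[OF s1]
    by (simp add: all_relations_def chain_def)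
  show 2: "s 1 * gen LQ = gen LQ"
    using 1 relI[of "[LQ, LS 1]" "[LS 1, LQ]"] other_letters s_letter[OF s1]
    by (simp add: all_relations_def chain_def)
  show "Q 2 1 = gen LQ"
    using s_Q[OF s1, of 1 2] by (simp add: Q_1_2 1 2 del: One_nat_def)
qed

lemma Q_1_3: "3 \<le> n \<Longrightarrow> Q 1 3 = s 2 * gen LQ * s 2"
  using s_Q[of 2 1 2] by (simp add: Q_1_2 transpose_def del: One_nat_def)

lemma Q_3_4: "4 \<le> n \<Longrightarrow> Q 3 4 = s 2 * s 1 * s 3 * s 2 * gen LQ * s 2 * s 1 * s 3 * s 2"
proof -
  assume n: "4 \<le> n"
  have "Q 1 4 = s 3 * s 2 * gen LQ * s 2 * s 3"
    using s_Q[of 3 1 3] n by (simp add: Q_1_3 transpose_def mult.assoc del: One_nat_def)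
  then have "Q 2 4 = s 1 * s 3 * s 2 * gen LQ * s 2 * s 3 * s 1"
    using s_Q[of 1 1 4] n by (simp add: transpose_def mult.assoc numeral_2_eq_2)
  then have "Q 3 4 = s 2 * s 1 * s 3 * s 2 * gen LQ * s 2 * (s 3 * s 1) * s 2"
    using s_Q[of 2 2 4] n by (simp add: transpose_def mult.assoc del: One_nat_def)
  \<comment> \<open>This brings the right-hand factor into the form
    \<open>s\<^sub>2 s\<^sub>1 s\<^sub>3 s\<^sub>2\<close> in which it occurs in the relation for
    disjoint \<open>q\<close>'s.\<close>
  also have "s 3 * s 1 = s 1 * s 3" using s_commute[of 1 3] n by simp
  finally show ?thesis by (simp add: mult.assoc)
qed

section \<open>Relations between the conjugates\<close>

lemma point_relations:
  "gen LE * gen LE = gen LE" "gen LE * gen LQ * gen LE = gen LE" "gen LE * gen LO * gen LE = gen LE"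
  "gen LO * gen LO = gen LO" "gen LO * gen LE * gen LO = gen LO"
proof -
  show 1: "gen LE * gen LE = gen LE"
    using relI[of "[LE, LE]" "[LE]"] other_letters by (simp add: all_relations_def chain_def)
  show 2: "gen LE * gen LQ * gen LE = gen LE"
    using relI[of "[LE]" "[LE, LQ, LE]"] other_letters by (simp add: all_relations_def chain_def mult.assoc)
  show "gen LE * gen LO * gen LE = gen LE"
    using 2 relI[of "[LE, LQ, LE]" "[LE, LO, LE]"] other_letters by (simp add: all_relations_def chain_def mult.assoc)
  show "gen LO * gen LO = gen LO"
    using relI[of "[LO, LO]" "[LO]"] other_letters by (simp add: all_relations_def chain_def)
  show "gen LO * gen LE * gen LO = gen LO"
    using relI[of "[LO]" "[LO, LE, LO]"] other_letters by (simp add: all_relations_def chain_def mult.assoc)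
qed

lemma q_relations: "gen LQ * gen LQ = gen LQ" "gen LQ * gen LE * gen LQ = gen LQ"
  using relI[of "[LQ, LQ]" "[LQ]"] relI[of "[LQ]" "[LQ, LE, LQ]"] other_letters
  by (simp_all add: all_relations_def chain_def mult.assoc)

lemma exists_perm2:
  assumes "i \<in> {1..n}" "j \<in> {1..n}" "i \<noteq> j"
  obtains p where "p permutes {1..n}" "p 1 = i" "p 2 = j"
  using perm_SOME[OF assms] by blast

lemma exists_perm3:
  assumes "i \<in> {1..n}" "j \<in> {1..n}" "k \<in> {1..n}" "i \<noteq> j" "i \<noteq> k" "j \<noteq> k"
  obtains p where "p permutes {1..n}" "p 1 = i" "p 2 = j" "p 3 = k" "3 \<le> n"
proof -
  have "card {i, j, k} \<le> card {1..n}" by (rule card_mono) (use assms in auto)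
  then have n: "3 \<le> n" using assms by simp
  have "\<exists>p. p permutes {1..n} \<and> (\<forall>a\<in>{1,2,3}. p a = (if a = 1 then i else if a = 2 then j else k))"
    by (rule extend_to_permutation) (use assms n in \<open>auto simp: inj_on_def\<close>)
  then show ?thesis using that n by auto
qed

lemma exists_perm4:
  assumes "i \<in> {1..n}" "j \<in> {1..n}" "k \<in> {1..n}" "l \<in> {1..n}"
    "i \<noteq> j" "i \<noteq> k" "i \<noteq> l" "j \<noteq> k" "j \<noteq> l" "k \<noteq> l"
  obtains p where "p permutes {1..n}" "p 1 = i" "p 2 = j" "p 3 = k" "p 4 = l" "4 \<le> n"
proof -
  have "card {i, j, k, l} \<le> card {1..n}" by (rule card_mono) (use assms in auto)
  then have n: "4 \<le> n" using assms by simp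
  have "\<exists>p. p permutes {1..n} \<and>
      (\<forall>a\<in>{1,2,3,4}. p a = (if a = 1 then i else if a = 2 then j else if a = 3 then k else l))"
    by (rule extend_to_permutation) (use assms n in \<open>auto simp: inj_on_def\<close>)
  then show ?thesis using that n by auto
qed

lemma G_outside: "i \<notin> {1..n} \<Longrightarrow> G c i = 1"
  unfolding G_def by auto

lemma Q_outside: "\<not> (i \<in> {1..n} \<and> j \<in> {1..n} \<and> i \<noteq> j) \<Longrightarrow> Q i j = 1"
  unfolding Q_def by auto

lemma G_commute:
  assumes "i \<noteq> j"
  shows "G c i * G d j = G d j * G c i"
proof (cases "i \<in> {1..n} \<and> j \<in> {1..n}")
  case False
  then show ?thesis using G_outside by auto
next
  case True
  have E: "gen LE * s 1 * gen LE * s 1 = s 1 * gen LE * s 1 * gen LE"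
    using relI[of "[LS 1, LE, LS 1, LE]" "[LE, LS 1, LE, LS 1]"] other_letters s_letter[OF s1]
    by (simp add: all_relations_def chain_def mult.assoc)
  have O: "gen LO * s 1 * gen LO * s 1 = s 1 * gen LO * s 1 * gen LO"
    using relI[of "[LO, LS 1, LO, LS 1]" "[LS 1, LO, LS 1, LO]"] other_letters s_letter[OF s1]
    by (simp add: all_relations_def chain_def mult.assoc)
  have EO: "gen LE * s 1 * gen LO * s 1 = s 1 * gen LO * s 1 * gen LE"
    using relI[of "[LE, LS 1, LO, LS 1]" "[LS 1, LO, LS 1, LE]"] other_letters s_letter[OF s1]
    by (simp add: all_relations_def chain_def mult.assoc)
  have base: "G c 1 * G c 2 = G c 2 * G c 1" "G True 1 * G False 2 = G False 2 * G True 1" for c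
    unfolding G_1 G_2 by (cases c) (use E O EO in \<open>simp_all add: point_def mult.assoc\<close>)
  have general: "G c i * G d j = G d j * G c i"
    if eq: "G c 1 * G d 2 = G d 2 * G c 1" and ij: "i \<in> {1..n}" "j \<in> {1..n}" "i \<noteq> j" for i j c d
  proof -
    obtain p where p: "p permutes {1..n}" "p 1 = i" "p 2 = j" by (rule exists_perm2[OF ij])
    show ?thesis
      by (rule intertwines_eq[of p "G c 1 * G d 2"]) 
        (intro intertwines_intros p, simp only: eq, intro intertwines_intros p)
  qed
  consider "c = d" | "c" "\<not> d" | "\<not> c" "d" by blast
  then show ?thesis
  proof cases
    case 1
    then show ?thesis using general[OF base(1)] True assms by blast
  next
    case 2
    then show ?thesis using general[OF base(2), of i j] True assms by simp
  next
    case 3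
    \<comment> \<open>The other mixed pair is the same identity with the two vertices
      exchanged.\<close>
    then show ?thesis using general[OF base(2), of j i] True assms by simp
  qed
qed

lemma exists_perm1:
  assumes "i \<in> {1..n}"
  obtains p where "p permutes {1..n}" "p 1 = i"
  using transpose_permutes[OF one_in(1) assms] that[of "transpose 1 i"] by auto

lemma G_band: "G c i * G d i * G c i = G c i"
proof (cases "i \<in> {1..n}")
  case True
  then obtain p where p: "p permutes {1..n}" "p 1 = i" by (rule exists_perm1)
  have eq: "G c 1 * G d 1 * G c 1 = G c 1"
    unfolding G_1 using point_relations by (cases c; cases d) (simp_all add: point_def)
  show ?thesis
    by (rule intertwines_eq[of p "G c 1 * G d 1 * G c 1"])
      (intro intertwines_intros p, simp only: eq, intro intertwines_intros p)
qed (simp add: G_outside del: atLeastAtMost_iff)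

lemma G_idem: "G c i * G c i = G c i"
proof (cases "i \<in> {1..n}")
  case True
  then obtain p where p: "p permutes {1..n}" "p 1 = i" by (rule exists_perm1)
  have eq: "G c 1 * G c 1 = G c 1"
    unfolding G_1 using point_relations by (cases c) (simp_all add: point_def)
  show ?thesis
    by (rule intertwines_eq[of p "G c 1 * G c 1"])
      (intro intertwines_intros p, simp only: eq, intro intertwines_intros p)
qed (simp add: G_outside del: atLeastAtMost_iff)

text \<open>There are only two colours, so either neighbouring factors coincide or the outer two do,
  and then \<open>G_band\<close> applies. The colours at a vertex form a rectangular band.\<close>

lemma G_rect: "G a i * G b i * G c i = G a i * G c i"
  using G_band[of a i b] G_idem[of a i] G_idem[of c i] by (cases a; cases b; cases c) (simp_all add: mult.assoc)

text \<open>Once both strands are cut into singletons, a swap is invisible; in letters,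
  \<open>e s\<^sub>1 e s\<^sub>1 = e s\<^sub>1 e\<close>.\<close>

lemma GG_transpose:
  assumes "i \<in> {1..n}" "j \<in> {1..n}" "i \<noteq> j"
  shows "G True i * G True j * perm (transpose i j) = G True i * G True j"
proof -
  obtain p where p: "p permutes {1..n}" "p 1 = i" "p 2 = j" by (rule exists_perm2[OF assms])
  have "gen LE * s 1 * gen LE * s 1 = gen LE * s 1 * gen LE"
    using relI[of "[LE, LS 1, LE, LS 1]" "[LE, LS 1, LE]"] other_letters s_letter[OF s1]
    by (simp add: all_relations_def chain_def mult.assoc)
  moreover have "perm (transpose 1 2) = s 1" using perm_transpose[OF s1] by (simp add: numeral_2_eq_2)
  ultimately have eq: "G True 1 * G True 2 * perm (transpose 1 2) = G True 1 * G True 2"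
    using s_square[OF s1] unfolding G_1 G_2 by (simp add: point_def mult.assoc)
  show ?thesis
    by (rule intertwines_eq[of p "G True 1 * G True 2 * perm (transpose 1 2)"])
      (intro intertwines_intros p one_in, simp only: eq, intro intertwines_intros p)
qed

lemma Q_sym: "Q i j = Q j i"
proof (cases "i \<in> {1..n} \<and> j \<in> {1..n} \<and> i \<noteq> j")
  case True
  then obtain p where p: "p permutes {1..n}" "p 1 = i" "p 2 = j" using exists_perm2 by metis
  show ?thesis
    by (rule intertwines_eq[of p "Q 1 2"]) (intro intertwines_intros p, simp only: Q_1_2 Q_2_1(1)[symmetric], intro intertwines_intros p)
next
  case False
  then show ?thesis using Q_outside[of i j] Q_outside[of j i] by auto
qed

lemma Q_idem: "Q i j * Q i j = Q i j"
proof (cases "i \<in> {1..n} \<and> j \<in> {1..n} \<and> i \<noteq> j")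
  case True
  then obtain p where p: "p permutes {1..n}" "p 1 = i" "p 2 = j" using exists_perm2 by metis
  have eq: "Q 1 2 * Q 1 2 = Q 1 2" unfolding Q_1_2 by (rule q_relations)
  show ?thesis
    by (rule intertwines_eq[of p "Q 1 2 * Q 1 2"]) (intro intertwines_intros p, simp only: eq, intro intertwines_intros p)
qed (simp add: Q_outside del: atLeastAtMost_iff)

lemma Q_transpose:
  assumes "i \<in> {1..n}" "j \<in> {1..n}"
  shows "Q i j * perm (transpose i j) = Q i j" "perm (transpose i j) * Q i j = Q i j"
proof -
  show 1: "Q i j * perm (transpose i j) = Q i j"
  proof (cases "i = j")
    case False
    then obtain p where p: "p permutes {1..n}" "p 1 = i" "p 2 = j" using exists_perm2 assms by metis
    have "perm (transpose 1 2) = s 1" using perm_transpose[OF s1] by (simp add: numeral_2_eq_2)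
    then have eq: "Q 1 2 * perm (transpose 1 2) = Q 1 2" unfolding Q_1_2 by (simp only: Q_2_1)
    show ?thesis
      by (rule intertwines_eq[of p "Q 1 2 * perm (transpose 1 2)"])
        (intro intertwines_intros p one_in, simp only: eq, intro intertwines_intros p)
  qed simp
  have "perm (transpose i j) * Q i j = Q j i * perm (transpose i j)"
    using perm_Q[OF transpose_permutes[OF assms], of i j] by simp
  then show "perm (transpose i j) * Q i j = Q i j" using 1 Q_sym[of i j] by simp
qed

lemma QGQ:
  assumes "i \<in> {1..n}" "j \<in> {1..n}" "i \<noteq> j"
  shows "Q i j * G True i * Q i j = Q i j" "G True i * Q i j * G True i = G True i"
proof -
  obtain p where p: "p permutes {1..n}" "p 1 = i" "p 2 = j" by (rule exists_perm2[OF assms])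
  have eq: "Q 1 2 * G True 1 * Q 1 2 = Q 1 2" "G True 1 * Q 1 2 * G True 1 = G True 1"
    unfolding Q_1_2 G_1 using q_relations point_relations by (simp_all add: point_def)
  show "Q i j * G True i * Q i j = Q i j"
    by (rule intertwines_eq[of p "Q 1 2 * G True 1 * Q 1 2"])
      (intro intertwines_intros p, simp only: eq, intro intertwines_intros p)
  show "G True i * Q i j * G True i = G True i"
    by (rule intertwines_eq[of p "G True 1 * Q 1 2 * G True 1"])
      (intro intertwines_intros p, simp only: eq, intro intertwines_intros p)
qed

text \<open>A dot spreads over its block: \<open>oq\<close>, \<open>qo\<close> and
  \<open>o s\<^sub>1 o\<close> all equal the product of the dots at \<open>1\<close> and
  \<open>2\<close>.\<close>

lemma Q_dot:
  assumes "i \<in> {1..n}" "j \<in> {1..n}" "i \<noteq> j"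
  shows "G False i * Q i j = G False i * G False j" "Q i j * G False i = G False i * G False j"
proof -
  obtain p where p: "p permutes {1..n}" "p 1 = i" "p 2 = j" by (rule exists_perm2[OF assms])
  have 1: "gen LO * gen LQ = gen LO * s 1 * gen LO"
    using relI[of "[LO, LS 1, LO]" "[LO, LQ]"] other_letters s_letter[OF s1]
    by (simp add: all_relations_def chain_def mult.assoc)
  have 2: "gen LQ * gen LO = gen LO * gen LQ"
    using relI[of "[LO, LQ]" "[LQ, LO]"] other_letters s_letter[OF s1]
    by (simp add: all_relations_def chain_def mult.assoc)
  have 3: "gen LO * s 1 * gen LO = s 1 * gen LO * s 1 * gen LO"
    using relI[of "[LS 1, LO, LS 1, LO]" "[LO, LS 1, LO]"] other_letters s_letter[OF s1]
    by (simp add: all_relations_def chain_def mult.assoc)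
  have 4: "s 1 * gen LO * s 1 * gen LO = gen LO * s 1 * gen LO * s 1"
    using relI[of "[LO, LS 1, LO, LS 1]" "[LS 1, LO, LS 1, LO]"] other_letters s_letter[OF s1]
    by (simp add: all_relations_def chain_def mult.assoc)
  have eq: "G False 1 * Q 1 2 = G False 1 * G False 2" "Q 1 2 * G False 1 = G False 1 * G False 2"
    unfolding Q_1_2 G_1 G_2 using 1 2 3 4 by (simp_all add: point_def mult.assoc)
  show "G False i * Q i j = G False i * G False j"
    by (rule intertwines_eq[of p "G False 1 * Q 1 2"])
      (intro intertwines_intros p, simp only: eq, intro intertwines_intros p)
  show "Q i j * G False i = G False i * G False j"
    by (rule intertwines_eq[of p "Q 1 2 * G False 1"])
      (intro intertwines_intros p, simp only: eq, intro intertwines_intros p)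
qed

lemma Q_G_commute:
  assumes "k \<noteq> i" "k \<noteq> j"
  shows "Q i j * G c k = G c k * Q i j"
proof (cases "i \<in> {1..n} \<and> j \<in> {1..n} \<and> i \<noteq> j \<and> k \<in> {1..n}")
  case True
  then obtain p where p: "p permutes {1..n}" "p 1 = i" "p 2 = j" "p 3 = k" and n: "3 \<le> n"
    using exists_perm3[of i j k] assms by metis
  have E: "gen LQ * s 2 * s 1 * gen LE * s 1 * s 2 = s 2 * s 1 * gen LE * s 1 * s 2 * gen LQ"
    using relI[of "[LQ, LS 2, LS 1, LE, LS 1, LS 2]" "[LS 2, LS 1, LE, LS 1, LS 2, LQ]"]
      other_letters s_letter[OF s1] s_letter[of 2] n
    by (simp add: all_relations_def chain_def mult.assoc)
  have O: "gen LQ * s 2 * s 1 * gen LO * s 1 * s 2 = s 2 * s 1 * gen LO * s 1 * s 2 * gen LQ"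
    using relI[of "[LQ, LS 2, LS 1, LO, LS 1, LS 2]" "[LS 2, LS 1, LO, LS 1, LS 2, LQ]"]
      other_letters s_letter[OF s1] s_letter[of 2] n
    by (simp add: all_relations_def chain_def mult.assoc)
  have eq: "Q 1 2 * G c 3 = G c 3 * Q 1 2"
    unfolding Q_1_2 G_3[OF n] using E O by (cases c) (simp_all add: point_def mult.assoc)
  show ?thesis
    by (rule intertwines_eq[of p "Q 1 2 * G c 3"])
      (intro intertwines_intros p, simp only: eq, intro intertwines_intros p)
next
  case False
  then show ?thesis using Q_outside[of i j] G_outside[of k c] by auto
qed

text \<open>Unlike a singleton, a dot commutes with \<open>Q\<close> even at a shared vertex: both
  products then turn the two vertices into dots.\<close>

lemma Q_O_commute: "Q i j * G False k = G False k * Q i j"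
proof (cases "i \<in> {1..n} \<and> j \<in> {1..n} \<and> i \<noteq> j \<and> (k = i \<or> k = j)")
  case True
  then show ?thesis
    using Q_dot[of i j] Q_dot[of j i] Q_sym[of i j] G_commute[of i j False False] by auto
next
  case False
  then show ?thesis using Q_outside[of i j] Q_G_commute[of k i j False] by (metis mult_1 mult_1_right)
qed

lemma Q_commute_share: "Q i j * Q i k = Q i k * Q i j"
proof (cases "i \<in> {1..n} \<and> j \<in> {1..n} \<and> k \<in> {1..n} \<and> i \<noteq> j \<and> i \<noteq> k \<and> j \<noteq> k")
  case True
  then obtain p where p: "p permutes {1..n}" "p 1 = i" "p 2 = j" "p 3 = k" and n: "3 \<le> n"
    using exists_perm3[of i j k] by metis
  have "gen LQ * s 2 * gen LQ * s 2 = s 2 * gen LQ * s 2 * gen LQ"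
    using relI[of "[LQ, LS 2, LQ, LS 2]" "[LS 2, LQ, LS 2, LQ]"] other_letters s_letter[of 2] n
    by (simp add: all_relations_def chain_def mult.assoc)
  then have eq: "Q 1 2 * Q 1 3 = Q 1 3 * Q 1 2"
    unfolding Q_1_2 Q_1_3[OF n] by (simp add: mult.assoc)
  show ?thesis
    by (rule intertwines_eq[of p "Q 1 2 * Q 1 3"])
      (intro intertwines_intros p, simp only: eq, intro intertwines_intros p)
next
  case False
  then show ?thesis using Q_outside[of i j] Q_outside[of i k] by auto
qed

lemma Q_commute: "Q i j * Q k l = Q k l * Q i j"
proof (cases "i = k \<or> i = l \<or> j = k \<or> j = l")
  case True
  then show ?thesis
    using Q_commute_share Q_sym[of i j] Q_sym[of k l] by metis
next
  case ne: False
  show ?thesis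
  proof (cases "i \<in> {1..n} \<and> j \<in> {1..n} \<and> k \<in> {1..n} \<and> l \<in> {1..n} \<and> i \<noteq> j \<and> k \<noteq> l")
    case True
    then obtain p where p: "p permutes {1..n}" "p 1 = i" "p 2 = j" "p 3 = k" "p 4 = l" and n: "4 \<le> n"
      using exists_perm4[of i j k l] ne by metis
    have "prod_list (map gen [LQ, LS 2, LS 1, LS 3, LS 2, LQ, LS 2, LS 1, LS 3, LS 2]) =
        prod_list (map gen [LS 2, LS 1, LS 3, LS 2, LQ, LS 2, LS 1, LS 3, LS 2, LQ])"
      by (rule relI) (use other_letters s_letter[OF s1] s_letter[of 2] s_letter[of 3] n in
        \<open>simp_all add: all_relations_def chain_def\<close>)
    then have eq: "Q 1 2 * Q 3 4 = Q 3 4 * Q 1 2"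
      unfolding Q_1_2 Q_3_4[OF n] by (simp add: mult.assoc)
    show ?thesis
      by (rule intertwines_eq[of p "Q 1 2 * Q 3 4"])
        (intro intertwines_intros p, simp only: eq, intro intertwines_intros p)
  next
    case False
    then show ?thesis using Q_outside[of i j] Q_outside[of k l] by auto
  qed
qed

text \<open>\<open>Q i j\<close> absorbs the transposition of \<open>i\<close> and \<open>j\<close>,
  which turns \<open>Q j k\<close> into \<open>Q i k\<close>; so these two agree after
  \<open>Q i j\<close>.\<close>

lemma Q_trans:
  assumes "i \<in> {1..n}" "j \<in> {1..n}" "k \<in> {1..n}"
  shows "Q i j * Q j k * Q i k = Q i j * Q j k"
proof (cases "i = k \<or> j = k")
  case True
  then show ?thesis using Q_outside[of i k] Q_outside[of j k] Q_idem[of i j] by auto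
next
  case False
  have "Q i j * Q j k = Q i j * perm (transpose i j) * Q j k" using assms by (simp add: Q_transpose)
  also have "\<dots> = Q i j * Q i k * perm (transpose i j)"
    using perm_Q[OF transpose_permutes[OF assms(1,2)], of j k] False by (simp add: mult.assoc transpose_def)
  also have "\<dots> = Q i k * (Q i j * perm (transpose i j))"
    using Q_commute[of i j i k] by (simp add: mult.assoc)
  also have "\<dots> = Q i j * Q i k" using assms by (simp add: Q_transpose Q_commute)
  finally have "Q i j * Q j k = Q i j * Q i k" .
  then show ?thesis by (simp add: mult.assoc Q_idem)
qed

section \<open>Normal words\<close>

text \<open>The first colour faces the top row, the second the bottom row. By \<open>G_rect\<close>
  every longer product of colours at one vertex collapses to this form.\<close>

definition H :: "(nat \<Rightarrow> bool) \<Rightarrow> (nat \<Rightarrow> bool) \<Rightarrow> nat \<Rightarrow> 'm" where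
  "H b e i = G (b i) i * G (e i) i"

definition D :: "nat set \<Rightarrow> (nat \<Rightarrow> bool) \<Rightarrow> (nat \<Rightarrow> bool) \<Rightarrow> 'm" where
  "D T b e = iprod (H b e) T"

definition Qs :: "(nat \<times> nat) set \<Rightarrow> 'm" where
  "Qs R = iprod (\<lambda>(i, j). Q i j) R"

definition F :: "nat set \<Rightarrow> (nat \<Rightarrow> bool) \<Rightarrow> (nat \<Rightarrow> bool) \<Rightarrow> (nat \<Rightarrow> nat) \<Rightarrow> 'm" where
  "F T b e p = D T b e * perm p"

lemma commute_mult: "x * y = y * x \<Longrightarrow> x * z = z * x \<Longrightarrow> x * (y * z) = y * z * (x :: 'm)"
  by (metis mult.assoc)

lemma H_G_commute: "i \<noteq> j \<Longrightarrow> H b e i * G c j = G c j * H b e i"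
  unfolding H_def using G_commute by (intro commute_mult[symmetric]) metis+

lemma commuting_idempotents_H: "commuting_idempotents (H b e)"
proof
  fix i j
  show "H b e i * H b e j = H b e j * H b e i"
  proof (cases "i = j")
    case False
    show ?thesis unfolding H_def[of b e j] by (intro commute_mult H_G_commute False)
  qed simp
  show "H b e i * H b e i = H b e i"
    unfolding H_def using G_band[of "b i" i "e i"] by (simp flip: mult.assoc)
qed

lemma commuting_idempotents_Q: "commuting_idempotents (\<lambda>(i, j). Q i j)"
  by unfold_locales (auto simp: Q_idem intro: Q_commute)

lemma D_insert: "finite T \<Longrightarrow> D (insert i T) b e = H b e i * D T b e"
  unfolding D_def by (rule commuting_idempotents.iprod_insert[OF commuting_idempotents_H])

lemma Qs_insert: "finite R \<Longrightarrow> Qs (insert (i, j) R) = Q i j * Qs R"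
  unfolding Qs_def using commuting_idempotents.iprod_insert[OF commuting_idempotents_Q, of R "(i, j)"] by simp

lemma Qs_Un: "finite R \<Longrightarrow> finite R' \<Longrightarrow> Qs (R \<union> R') = Qs R * Qs R'"
  unfolding Qs_def by (rule commuting_idempotents.iprod_Un[OF commuting_idempotents_Q])

lemma Qs_absorb:
  assumes "finite R" "(i, j) \<in> R"
  shows "Q i j * Qs R = Qs R" "Qs R * Q i j = Qs R"
  unfolding Qs_def using commuting_idempotents.iprod_absorb[OF commuting_idempotents_Q assms] by simp_all

lemma Q_Qs_commute: "finite R \<Longrightarrow> Q i j * Qs R = Qs R * Q i j"
  unfolding Qs_def using commuting_idempotents.iprod_mult_commute[OF commuting_idempotents_Q, of R "(i, j)"] by simp

lemma D_empty [simp]: "D {} b e = 1"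
  by (simp add: D_def)

lemma D_cong:
  assumes "\<And>i. i \<in> T \<Longrightarrow> b i = b' i" "\<And>i. i \<in> T \<Longrightarrow> e i = e' i" "finite T"
  shows "D T b e = D T b' e'"
  unfolding D_def using assms by (intro iprod_cong) (simp_all add: H_def)

lemma D_G_commute:
  assumes "finite T" "i \<notin> T"
  shows "G c i * D T b e = D T b e * G c i"
  unfolding D_def by (rule iprod_commute[OF _ assms(1)]) (use assms(2) H_G_commute in metis)

lemma D_remove:
  assumes "finite T" "i \<in> T"
  shows "D T b e = H b e i * D (T - {i}) b e"
  using D_insert[of "T - {i}" i b e] assms by (simp add: insert_absorb)

lemma D_upd:
  assumes "finite T" "i \<notin> T"
  shows "D (insert i T) (b(i := x)) (e(i := y)) = G x i * G y i * D T b e"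
proof -
  have "D T (b(i := x)) (e(i := y)) = D T b e" by (rule D_cong) (use assms in auto)
  then show ?thesis using D_insert[OF assms(1), of i "b(i := x)" "e(i := y)"] by (simp add: H_def)
qed

text \<open>On a cut strand \<open>G_rect\<close> lets only the colour facing down be overwritten.
  On an uncut one, \<open>G c i\<close> doubles by idempotence and colours both ends with
  \<open>c\<close>.\<close>

lemma D_mult_G:
  assumes "finite T"
  shows "D T b e * G c i = D (insert i T) (if i \<in> T then b else b(i := c)) (e(i := c))"
proof (cases "i \<in> T")
  case True
  have "D T b e * G c i = G (b i) i * G (e i) i * (D (T - {i}) b e * G c i)"
    using D_remove[OF assms True, of b e] by (simp add: H_def mult.assoc)
  also have "D (T - {i}) b e * G c i = G c i * D (T - {i}) b e"
    using D_G_commute[of "T - {i}" i c b e] assms by simp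
  also have "G (b i) i * G (e i) i * (G c i * D (T - {i}) b e) = G (b i) i * G c i * D (T - {i}) b e"
    using G_rect[of "b i" i "e i" c] by (simp add: mult.assoc[symmetric])
  also have "\<dots> = D T b (e(i := c))"
    using D_upd[of "T - {i}" i b "b i" e c] assms True by (simp add: insert_absorb)
  finally show ?thesis using True by (simp add: insert_absorb)
next
  case False
  have "D T b e * G c i = G c i * G c i * D T b e"
    using D_G_commute[OF assms False, of c b e] G_idem[of c i] by simp
  then show ?thesis using D_upd[OF assms False, of b c e c] False by simp
qed

lemma G_mult_D:
  assumes "finite T"
  shows "G c i * D T b e = D (insert i T) (b(i := c)) (if i \<in> T then e else e(i := c))"
proof (cases "i \<in> T")
  case True
  have "G c i * D T b e = G c i * G (b i) i * G (e i) i * D (T - {i}) b e"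
    using D_remove[OF assms True, of b e] by (simp add: H_def mult.assoc)
  also have "\<dots> = D T (b(i := c)) e"
    using D_upd[of "T - {i}" i b c e "e i"] G_rect[of c i "b i" "e i"] assms True by (simp add: insert_absorb)
  finally show ?thesis using True by (simp add: insert_absorb)
next
  case False
  have "G c i * D T b e = G c i * G c i * D T b e" using G_idem[of c i] by simp
  then show ?thesis using D_upd[OF assms False, of b c e c] False by simp
qed

lemma perm_D:
  assumes "p permutes {1..n}" "finite T"
  shows "perm p * D T b e = D (p ` T) (b \<circ> pinv p) (e \<circ> pinv p) * perm p"
  unfolding D_def
proof (rule commuting_idempotents.iprod_conj[OF commuting_idempotents_H assms(2)])
  fix i
  have "perm p * (G x i * G y i) = G x (p i) * G y (p i) * perm p" for x y
    using perm_G[OF assms(1)] by (metis mult.assoc)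
  then show "perm p * H b e i = H (b \<circ> pinv p) (e \<circ> pinv p) (p i) * perm p"
    using permutes_inverses(2)[OF assms(1)] by (simp add: H_def)
qed

lemma perm_Qs:
  assumes "p permutes {1..n}" "finite R"
  shows "perm p * Qs R = Qs (map_prod p p ` R) * perm p"
  unfolding Qs_def
  by (rule commuting_idempotents.iprod_conj[OF commuting_idempotents_Q assms(2)])
    (use perm_Q[OF assms(1)] in auto)

text \<open>\<open>G_rect\<close> allows a factor \<open>G True\<close> to be inserted between the
  two colours at each vertex. The transposition then moves left past the lower colours, exchanging
  them, and is absorbed by the inserted pair through \<open>GG_transpose\<close>.\<close>

lemma HH_transpose:
  assumes "i \<in> {1..n}" "j \<in> {1..n}" "i \<noteq> j"
  shows "(G a i * G a' i) * (G c j * G c' j) * perm (transpose i j) = (G a i * G c' i) * (G c j * G a' j)"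
proof -
  let ?t = "perm (transpose i j)"
  have comm: "G x i * G y j = G y j * G x i" for x y using G_commute[OF assms(3)] .
  have swap: "G x i * (G y j * z) = G y j * (G x i * z)" for x y z
    using comm[of x y] by (metis mult.assoc)
  have t: "G a' i * G c' j * ?t = ?t * (G a' j * G c' i)"
  proof -
    have "?t * (G a' j * G c' i) = ?t * G a' j * G c' i" by (simp only: mult.assoc)
    also have "\<dots> = G a' i * (?t * G c' i)"
      using perm_G[OF transpose_permutes[OF assms(1,2)], of a' j] by (simp add: mult.assoc)
    also have "?t * G c' i = G c' j * ?t"
      using perm_G[OF transpose_permutes[OF assms(1,2)], of c' i] by simp
    finally show ?thesis by (simp only: mult.assoc)
  qed
  have "(G a i * G a' i) * (G c j * G c' j) * ?t
      = (G a i * G True i * G a' i) * (G c j * G True j * G c' j) * ?t"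
    by (simp only: G_rect)
  also have "\<dots> = G a i * G c j * (G True i * G True j) * (G a' i * G c' j * ?t)"
    by (simp only: mult.assoc comm swap)
  also have "\<dots> = G a i * G c j * (G True i * G True j * ?t) * (G a' j * G c' i)"
    unfolding t by (simp only: mult.assoc)
  also have "\<dots> = G a i * G c j * (G True i * G True j) * (G a' j * G c' i)"
    by (simp only: GG_transpose[OF assms])
  also have "\<dots> = (G a i * G True i * G c' i) * (G c j * G True j * G a' j)"
    by (simp only: mult.assoc comm swap)
  finally show ?thesis by (simp only: G_rect)
qed

lemma D_transpose:
  assumes "T \<subseteq> {1..n}" "i \<in> T" "j \<in> T"
  shows "D T b e * perm (transpose i j) = D T b (e \<circ> transpose i j)"
proof (cases "i = j")
  case False
  let ?R = "T - {i, j}"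
  have fin: "finite T" using assms(1) finite_subset by blast
  have T: "T = insert i (insert j ?R)" using assms by auto
  have split: "D T b e = H b e i * H b e j * D ?R b e" for e
    using D_insert[of ?R j b e] D_insert[of "insert j ?R" i b e] T fin by (simp add: mult.assoc)
  let ?t = "perm (transpose i j)"
  have tp: "transpose i j permutes {1..n}" using assms transpose_permutes by blast
  have "?t * D ?R b e = D (transpose i j ` ?R) (b \<circ> transpose i j) (e \<circ> transpose i j) * ?t"
    using perm_D[OF tp, of ?R b e] fin by (simp add: inv_transpose_eq)
  also have "transpose i j ` ?R = ?R" by (rule image_cong[THEN trans, OF refl _ image_ident]) (auto simp: transpose_def)
  also have "D ?R (b \<circ> transpose i j) (e \<circ> transpose i j) = D ?R b e"
    by (rule D_cong) (use fin in \<open>auto simp: transpose_def\<close>)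
  finally have comm: "D ?R b e * ?t = ?t * D ?R b e" by simp
  have cong: "D ?R b e = D ?R b (e \<circ> transpose i j)"
    by (rule D_cong) (use fin in \<open>auto simp: transpose_def\<close>)
  have "H b e i * H b e j * ?t = H b (e \<circ> transpose i j) i * H b (e \<circ> transpose i j) j"
    unfolding H_def using HH_transpose[of i j] assms False by (simp add: subset_iff mult.assoc)
  from arg_cong[OF this, of "\<lambda>x. x * D ?R b e"] show ?thesis
    unfolding split cong[symmetric] by (simp only: mult.assoc comm)
qed (simp only: transpose_same perm_id comp_id mult_1_right)

lemma D_perm:
  assumes "\<sigma> permutes T" "T \<subseteq> {1..n}"
  shows "D T b e * perm \<sigma> = D T b (e \<circ> \<sigma>)"
proof -
  have "finite T" using assms(2) finite_subset by blast
  from assms(1) this show ?thesis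
  proof (induction arbitrary: e rule: permutes_induct)
    case id
    then show ?case by (simp only: perm_id comp_id mult_1_right)
  next
    case (swap i j p)
    have "transpose i j permutes {1..n}" "p permutes {1..n}"
      using swap assms(2) transpose_permutes permutes_subset by blast+
    then have "D T b e * perm (transpose i j \<circ> p) = D T b e * perm (transpose i j) * perm p"
      by (simp add: perm_comp mult.assoc)
    also have "\<dots> = D T b (e \<circ> (transpose i j \<circ> p))"
      by (simp only: D_transpose[OF assms(2) swap(1,2)] swap.IH comp_assoc)
    finally show ?case .
  qed
qed

section \<open>Cut permutations multiplied by generators\<close>

lemma F_mult_G:
  assumes "finite T" "p permutes {1..n}"
  shows "F T b e p * G c j = F (insert (p j) T) (if p j \<in> T then b else b(p j := c)) (e(p j := c)) p"
proof -
  have "F T b e p * G c j = D T b e * G c (p j) * perm p"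
    unfolding F_def using perm_G[OF assms(2), of c j] by (simp add: mult.assoc)
  then show ?thesis by (simp only: D_mult_G[OF assms(1)] F_def)
qed

lemma G_mult_F:
  assumes "finite T"
  shows "G c i * F T b e p = F (insert i T) (b(i := c)) (if i \<in> T then e else e(i := c)) p"
  unfolding F_def by (simp only: G_mult_D[OF assms] mult.assoc[symmetric])

lemma F_mult_perm:
  assumes "p permutes {1..n}" "q permutes {1..n}"
  shows "F T b e p * perm q = F T b e (p \<circ> q)"
  unfolding F_def by (simp only: perm_comp[OF assms] mult.assoc)

lemma perm_mult_F:
  assumes "p permutes {1..n}" "q permutes {1..n}" "finite T"
  shows "perm q * F T b e p = F (q ` T) (b \<circ> pinv q) (e \<circ> pinv q) (q \<circ> p)"
  unfolding F_def perm_comp[OF assms(2,1)]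
  using arg_cong[OF perm_D[OF assms(2,3), of b e], of "\<lambda>x. x * perm p"] by (simp only: mult.assoc)

text \<open>\<open>p\<close> and \<open>q\<close> agree on uncut strands, so they differ by a
  permutation \<open>\<sigma>\<close> of \<open>T\<close>, which \<open>D\<close> absorbs up to a
  change of the lower colours. On cut strands a normal word thus remembers only the colour of each
  bottom vertex.\<close>

lemma F_cong:
  assumes "p permutes {1..n}" "q permutes {1..n}" "T \<subseteq> {1..n}"
    and "\<And>j. p j \<notin> T \<Longrightarrow> p j = q j" "\<And>i. i \<in> T \<Longrightarrow> b i = b' i"
    and "\<And>j. p j \<in> T \<Longrightarrow> e (p j) = e' (q j)"
  shows "F T b e p = F T b' e' q"
proof -
  define \<sigma> where "\<sigma> = q \<circ> pinv p"
  have fin: "finite T" using assms(3) finite_subset by blast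
  have \<sigma>1: "\<sigma> permutes {1..n}"
    unfolding \<sigma>_def by (rule permutes_compose[OF permutes_inv[OF assms(1)] assms(2)])
  have "\<sigma> i = i" if "i \<notin> T" for i
    using assms(4)[of "pinv p i"] that permutes_inverses(1)[OF assms(1), of i] by (simp add: \<sigma>_def)
  then have \<sigma>: "\<sigma> permutes T" by (intro permutes_superset[OF \<sigma>1]) auto
  have q: "q = \<sigma> \<circ> p" unfolding \<sigma>_def comp_assoc permutes_inv_o(2)[OF assms(1)] by simp
  have "F T b' e' q = D T b' e' * perm \<sigma> * perm p"
    unfolding F_def q perm_comp[OF \<sigma>1 assms(1)] by (simp add: mult.assoc)
  also have "D T b' e' * perm \<sigma> = D T b' (e' \<circ> \<sigma>)" by (rule D_perm[OF \<sigma> assms(3)])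
  also have "\<dots> = D T b e"
  proof (rule D_cong)
    fix i assume "i \<in> T"
    then show "(e' \<circ> \<sigma>) i = e i" "b' i = b i"
      using assms(5,6)[of "pinv p i"] assms(5)[of i] permutes_inverses(1)[OF assms(1), of i]
      by (simp_all add: \<sigma>_def)
  qed (rule fin)
  finally show ?thesis by (simp add: F_def)
qed

text \<open>A \<open>Q\<close> joining two uncut strands misses all cut vertices, so it can be slid
  from the bottom to the top.\<close>

lemma F_mult_Q:
  assumes "p permutes {1..n}" "p i \<notin> T" "p j \<notin> T" "finite T"
  shows "F T b e p * Q i j = Q (p i) (p j) * F T b e p"
proof -
  have "D T b e * Q (p i) (p j) = Q (p i) (p j) * D T b e"
    unfolding D_def
  proof (rule iprod_commute[OF _ assms(4), symmetric])
    fix k assume "k \<in> T"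
    then have "k \<noteq> p i" "k \<noteq> p j" using assms by auto
    then show "Q (p i) (p j) * H b e k = H b e k * Q (p i) (p j)"
      unfolding H_def using Q_G_commute by (intro commute_mult) blast+
  qed
  from arg_cong[OF this, of "\<lambda>x. x * perm p"] show ?thesis
    unfolding F_def by (simp only: mult.assoc perm_Q[OF assms(1), of i j])
qed

text \<open>In terms of diagrams: the top blocks and the bottom blocks are generated by \<open>\<epsilon>\<close> and \<open>\<eta>\<close>,
  \<open>p j\<close> is joined to \<open>j'\<close> when \<open>p j \<notin> T\<close>, and for \<open>i \<in> T\<close> the colours \<open>b i\<close> and \<open>e i\<close> say whether
  \<open>i\<close>, respectively \<open>j'\<close> with \<open>p j = i\<close>, is a singleton or a rook dot.\<close>

definition W :: "(nat \<times> nat) set \<Rightarrow> nat set \<Rightarrow> (nat \<Rightarrow> bool) \<Rightarrow> (nat \<Rightarrow> bool) \<Rightarrow> (nat \<Rightarrow> nat) \<Rightarrow>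
    (nat \<times> nat) set \<Rightarrow> 'm" where
  "W \<epsilon> T b e p \<eta> = Qs \<epsilon> * F T b e p * Qs \<eta>"

section \<open>Diagrams of normal words\<close>

lemma rho_generators: "rho (gen LE) = {(f, g). \<forall>j. j \<noteq> 1 \<longrightarrow> f j = g j}"
  "rho (gen LO) = {(f, g). f = g \<and> \<not> f 1}" "rho (gen LQ) = {(f, g). f = g \<and> f 1 = f 2}"
proof -
  have "(\<exists>b. g = f(1 := b)) \<longleftrightarrow> (\<forall>j. j \<noteq> 1 \<longrightarrow> f j = g j)" for f g :: "nat \<Rightarrow> bool"
  proof
    assume "\<forall>k. k \<noteq> 1 \<longrightarrow> f k = g k"
    then have "g = f(1 := g 1)" by (intro ext) simp
    then show "\<exists>b. g = f(1 := b)" by blast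
  qed auto
  then show "rho (gen LE) = {(f, g). \<forall>j. j \<noteq> 1 \<longrightarrow> f j = g j}"
    by (simp add: rho_gen other_letters)
qed (simp_all add: rho_gen other_letters)

text \<open>One formula covers both colours: for a dot both sets avoid \<open>i\<close>, which
  together with agreement elsewhere amounts to a partial identity.\<close>

lemma rho_G:
  assumes "i \<in> {1..n}"
  shows "rho (G c i) = {(f, g). (\<forall>j. j \<noteq> i \<longrightarrow> f j = g j) \<and> (\<not> c \<longrightarrow> \<not> f i \<and> \<not> g i)}"
proof -
  let ?t = "transpose 1 i"
  have t: "?t permutes {1..n}" using transpose_permutes one_in assms by blast
  have point: "rho (point c) = {(f, g). (\<forall>j. j \<noteq> 1 \<longrightarrow> f j = g j) \<and> (\<not> c \<longrightarrow> \<not> f 1 \<and> \<not> g 1)}"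
  proof (cases c)
    case False
    have "f = g" if "\<forall>j. j \<noteq> 1 \<longrightarrow> f j = g j" "\<not> f 1" "\<not> g 1" for f g :: "nat \<Rightarrow> bool"
    proof
      fix j show "f j = g j" using that by (cases "j = 1") auto
    qed
    then show ?thesis using False by (auto simp: point_def rho_generators simp del: One_nat_def)
  qed (simp add: point_def rho_generators)
  have "(f, g) \<in> rho (G c i) \<longleftrightarrow> (f \<circ> ?t, g \<circ> ?t) \<in> rho (point c)" for f g
  proof -
    have "G c i = perm ?t * point c * perm ?t" using assms unfolding G_def by presburger
    then have "(f, g) \<in> rho (G c i) \<longleftrightarrow> (\<exists>h. (f \<circ> ?t, h) \<in> rho (point c) \<and> g = h \<circ> ?t)"
      by (simp only: rho_mult rho_perm[OF t]) blast
    also have "\<dots> \<longleftrightarrow> (f \<circ> ?t, g \<circ> ?t) \<in> rho (point c)"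
    proof
      assume "(f \<circ> ?t, g \<circ> ?t) \<in> rho (point c)"
      then show "\<exists>h. (f \<circ> ?t, h) \<in> rho (point c) \<and> g = h \<circ> ?t"
        by (intro exI[of _ "g \<circ> ?t"]) (simp add: comp_transpose_transpose)
    qed (auto simp: comp_transpose_transpose)
    finally show ?thesis .
  qed
  moreover have "(f \<circ> ?t, g \<circ> ?t) \<in> rho (point c) \<longleftrightarrow>
      (\<forall>j. j \<noteq> i \<longrightarrow> f j = g j) \<and> (\<not> c \<longrightarrow> \<not> f i \<and> \<not> g i)" for f g
  proof -
    have "(\<forall>j. j \<noteq> 1 \<longrightarrow> f (?t j) = g (?t j)) \<longleftrightarrow> (\<forall>j. j \<noteq> i \<longrightarrow> f j = g j)"
    proof
      assume *: "\<forall>j. j \<noteq> 1 \<longrightarrow> f (?t j) = g (?t j)"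
      show "\<forall>j. j \<noteq> i \<longrightarrow> f j = g j"
      proof (intro allI impI)
        fix j assume "j \<noteq> i"
        then have "?t j \<noteq> 1" by (auto simp: transpose_def split: if_splits)
        with * have "f (?t (?t j)) = g (?t (?t j))" by blast
        then show "f j = g j" by simp
      qed
    next
      assume *: "\<forall>j. j \<noteq> i \<longrightarrow> f j = g j"
      have "?t j \<noteq> i" if "j \<noteq> 1" for j using that by (auto simp: transpose_def split: if_splits)
      with * show "\<forall>j. j \<noteq> 1 \<longrightarrow> f (?t j) = g (?t j)" by blast
    qed
    then show ?thesis
      unfolding point by (simp only: mem_Collect_eq case_prod_conv comp_apply transpose_apply_first)
  qed
  ultimately show ?thesis
    by (intro equalityI subrelI) (simp_all only: mem_Collect_eq case_prod_conv)
qed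

lemma rho_Q:
  assumes "i \<in> {1..n}" "j \<in> {1..n}"
  shows "rho (Q i j) = {(f, g). f = g \<and> f i = f j}"
proof (cases "i = j")
  case True
  then show ?thesis using Q_outside[of i j] by (auto simp: rho_one)
next
  case False
  then obtain p where p: "p permutes {1..n}" "p 1 = i" "p 2 = j" using exists_perm2 assms by metis
  have pi: "pinv p permutes {1..n}" by (rule permutes_inv[OF p(1)])
  have "Q i j = Q i j * perm p * perm (pinv p)" using perm_inverse(2)[OF p(1)] by (simp add: mult.assoc)
  also have "Q i j * perm p = perm p * gen LQ" using perm_Q[OF p(1), of 1 2] p Q_1_2 by simp
  finally have "(f, g) \<in> rho (Q i j) \<longleftrightarrow> f (p 1) = f (p 2) \<and> g = f \<circ> p \<circ> pinv p" for f g
    by (simp only: rho_mult rho_perm[OF p(1)] rho_perm[OF pi] rho_generators relcomp_unfold) (auto simp: comp_apply)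
  moreover have "f \<circ> p \<circ> pinv p = f" for f :: "nat \<Rightarrow> bool"
    by (simp only: comp_assoc permutes_inv_o(1)[OF p(1)] comp_id)
  ultimately have "(f, g) \<in> rho (Q i j) \<longleftrightarrow> f i = f j \<and> g = f" for f g
    by (simp only: p)
  then show ?thesis by auto
qed

lemma rho_D:
  assumes "T \<subseteq> {1..n}"
  shows "rho (D T b e) = {(f, g). (\<forall>j. j \<notin> T \<longrightarrow> f j = g j) \<and> (\<forall>i\<in>T. (\<not> b i \<longrightarrow> \<not> f i) \<and> (\<not> e i \<longrightarrow> \<not> g i))}"
proof -
  have "finite T" using assms finite_subset by blast
  from this assms show ?thesis
  proof (induction T)
    case empty
    show ?case by (auto simp: rho_one)
  next
    case (insert k T)
    have "(f, g) \<in> rho (H b e k) \<longleftrightarrow> (\<forall>j. j \<noteq> k \<longrightarrow> f j = g j) \<and> (\<not> b k \<longrightarrow> \<not> f k) \<and> (\<not> e k \<longrightarrow> \<not> g k)"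
      (is "_ \<longleftrightarrow> ?R f g") for f g
    proof
      assume "?R f g"
      \<comment> \<open>The middle set must avoid \<open>k\<close> as soon as one of the two colours
        is a dot.\<close>
      then have "(f, f(k := b k \<and> e k \<and> f k)) \<in> rho (G (b k) k)" "(f(k := b k \<and> e k \<and> f k), g) \<in> rho (G (e k) k)"
        using insert.prems by (auto simp: rho_G)
      then show "(f, g) \<in> rho (H b e k)" unfolding H_def rho_mult by blast
    qed (use insert.prems in \<open>auto simp: H_def rho_mult rho_G\<close>)
    then have H: "rho (H b e k) = {(f, g). ?R f g}"
      by (intro equalityI subrelI) (simp_all only: mem_Collect_eq case_prod_conv)
    have IH: "(f, g) \<in> rho (D T b e) \<longleftrightarrow>
        (\<forall>j. j \<notin> T \<longrightarrow> f j = g j) \<and> (\<forall>i\<in>T. (\<not> b i \<longrightarrow> \<not> f i) \<and> (\<not> e i \<longrightarrow> \<not> g i))" for f g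
      unfolding insert.IH[OF order_trans[OF subset_insertI insert.prems]]
      by (simp only: mem_Collect_eq case_prod_conv)
    have "(f, g) \<in> rho (D (insert k T) b e) \<longleftrightarrow> (\<forall>j. j \<notin> insert k T \<longrightarrow> f j = g j) \<and>
        (\<forall>i\<in>insert k T. (\<not> b i \<longrightarrow> \<not> f i) \<and> (\<not> e i \<longrightarrow> \<not> g i))" (is "_ \<longleftrightarrow> ?S f g") for f g
    proof -
      have "(f, g) \<in> rho (D (insert k T) b e) \<longleftrightarrow> (\<exists>h. ?R f h \<and> (h, g) \<in> rho (D T b e))"
        unfolding D_insert[OF insert.hyps(1)] rho_mult relcomp_unfold H
        by (simp only: mem_Collect_eq case_prod_conv)
      also have "\<dots> \<longleftrightarrow> ?S f g"
      proof
        assume "\<exists>h. ?R f h \<and> (h, g) \<in> rho (D T b e)"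
        then obtain h where h: "?R f h" "(h, g) \<in> rho (D T b e)" by blast
        note h' = h(2)[unfolded IH]
        have "h k = g k" using h' insert.hyps(2) by blast
        moreover have "f j = h j" if "j \<noteq> k" for j using h(1) that by blast
        ultimately show "?S f g" using h(1) h' insert.hyps(2) by (metis insert_iff)
      next
        assume S: "?S f g"
        have "?R f (f(k := g k))" using S by simp
        moreover have "(f(k := g k), g) \<in> rho (D T b e)" unfolding IH using S insert.hyps(2) by auto
        ultimately show "\<exists>h. ?R f h \<and> (h, g) \<in> rho (D T b e)" by blast
      qed
      finally show ?thesis .
    qed
    then show ?case by (intro equalityI subrelI) (simp_all only: mem_Collect_eq case_prod_conv)
  qed
qed

lemma rho_F:
  assumes "T \<subseteq> {1..n}" "p permutes {1..n}"
  shows "(f, g) \<in> rho (F T b e p) \<longleftrightarrow> (\<forall>j. p j \<notin> T \<longrightarrow> f (p j) = g j) \<and>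
    (\<forall>i\<in>T. \<not> b i \<longrightarrow> \<not> f i) \<and> (\<forall>j. p j \<in> T \<longrightarrow> \<not> e (p j) \<longrightarrow> \<not> g j)"
proof -
  have "(f, g) \<in> rho (F T b e p) \<longleftrightarrow> (\<exists>h. (f, h) \<in> rho (D T b e) \<and> g = h \<circ> p)"
    unfolding F_def rho_mult rho_perm[OF assms(2)] by blast
  also have "\<dots> \<longleftrightarrow> (f, g \<circ> pinv p) \<in> rho (D T b e)"
  proof
    assume "(f, g \<circ> pinv p) \<in> rho (D T b e)"
    moreover have "g = g \<circ> pinv p \<circ> p" by (simp add: comp_assoc permutes_inv_o(2)[OF assms(2)])
    ultimately show "\<exists>h. (f, h) \<in> rho (D T b e) \<and> g = h \<circ> p" by blast
  qed (auto simp: comp_assoc permutes_inv_o(1)[OF assms(2)])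
  also have "\<dots> \<longleftrightarrow> (\<forall>i. i \<notin> T \<longrightarrow> f i = g (pinv p i)) \<and>
      (\<forall>i\<in>T. (\<not> b i \<longrightarrow> \<not> f i) \<and> (\<not> e i \<longrightarrow> \<not> g (pinv p i)))"
    by (simp add: rho_D[OF assms(1)])
  also have "\<dots> \<longleftrightarrow> (\<forall>j. p j \<notin> T \<longrightarrow> f (p j) = g j) \<and>
    (\<forall>i\<in>T. \<not> b i \<longrightarrow> \<not> f i) \<and> (\<forall>j. p j \<in> T \<longrightarrow> \<not> e (p j) \<longrightarrow> \<not> g j)"
  proof -
    have all: "(\<forall>i. P i (pinv p i)) \<longleftrightarrow> (\<forall>j. P (p j) j)" for P :: "nat \<Rightarrow> nat \<Rightarrow> bool"
      using permutes_inverses[OF assms(2)] by metis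
    show ?thesis
      by (simp only: ball_conj_distrib Ball_def all[of "\<lambda>i j. i \<notin> T \<longrightarrow> f i = g j"]
          all[of "\<lambda>i j. i \<in> T \<longrightarrow> \<not> e i \<longrightarrow> \<not> g j"])
  qed
  finally show ?thesis .
qed

lemma rho_Qs:
  assumes "R \<subseteq> {1..n} \<times> {1..n}"
  shows "rho (Qs R) = {(f, g). f = g \<and> (\<forall>(i, j)\<in>R. f i = f j)}"
proof -
  have "finite R" using assms finite_subset by blast
  from this assms show ?thesis
  proof (induction R)
    case empty
    show ?case by (auto simp: rho_one Qs_def)
  next
    case (insert r R)
    obtain i j where r: "r = (i, j)" by force
    have "rho (Q i j) = {(f, g). f = g \<and> f i = f j}" using insert.prems r by (intro rho_Q) auto
    then show ?case using insert by (auto simp: r Qs_insert rho_mult)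
  qed
qed

lemma rho_W:
  assumes "\<epsilon> \<subseteq> {1..n} \<times> {1..n}" "\<eta> \<subseteq> {1..n} \<times> {1..n}" "T \<subseteq> {1..n}" "p permutes {1..n}"
  shows "(f, g) \<in> rho (W \<epsilon> T b e p \<eta>) \<longleftrightarrow> (\<forall>(i, j)\<in>\<epsilon>. f i = f j) \<and> (\<forall>(i, j)\<in>\<eta>. g i = g j) \<and>
    (\<forall>j. p j \<notin> T \<longrightarrow> f (p j) = g j) \<and>
    (\<forall>i\<in>T. \<not> b i \<longrightarrow> \<not> f i) \<and> (\<forall>j. p j \<in> T \<longrightarrow> \<not> e (p j) \<longrightarrow> \<not> g j)"
proof -
  have "(f, g) \<in> rho (W \<epsilon> T b e p \<eta>) \<longleftrightarrow>
      (\<forall>(i, j)\<in>\<epsilon>. f i = f j) \<and> (f, g) \<in> rho (F T b e p) \<and> (\<forall>(i, j)\<in>\<eta>. g i = g j)"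
    unfolding W_def rho_mult rho_Qs[OF assms(1)] rho_Qs[OF assms(2)] by blast
  then show ?thesis unfolding rho_F[OF assms(3,4)] by blast
qed

section \<open>Reduced words\<close>

definition valid :: "(nat \<times> nat) set \<Rightarrow> nat set \<Rightarrow> (nat \<Rightarrow> nat) \<Rightarrow> (nat \<times> nat) set \<Rightarrow> bool" where
  "valid \<epsilon> T p \<eta> \<longleftrightarrow> \<epsilon> \<subseteq> {1..n} \<times> {1..n} \<and> \<eta> \<subseteq> {1..n} \<times> {1..n} \<and> T \<subseteq> {1..n} \<and> p permutes {1..n}"

text \<open>The factor \<open>3\<close> makes the weight decrease when a strand is cut, which adds at most one
  vertex of colour \<open>True\<close> at either end.\<close>

definition weight :: "nat set \<Rightarrow> (nat \<Rightarrow> bool) \<Rightarrow> (nat \<Rightarrow> bool) \<Rightarrow> nat" where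
  "weight T b e = 3 * (n - card T) + card {i\<in>T. b i} + card {i\<in>T. e i}"

text \<open>Minimising it saturates \<open>\<epsilon>\<close> and \<open>\<eta>\<close>: every pair
  whose \<open>Q\<close> can be inserted without changing the element is present.\<close>

definition defect :: "(nat \<times> nat) set \<Rightarrow> (nat \<times> nat) set \<Rightarrow> nat" where
  "defect \<epsilon> \<eta> = card ({1..n} \<times> {1..n} - \<epsilon>) + card ({1..n} \<times> {1..n} - \<eta>)"

text \<open>The preimage of \<open>T\<close> under \<open>p\<close> is the set of cut bottom
  vertices. Small sums put the cuts at small vertices and leave the large ones to the uncut
  strands.\<close>

definition height :: "nat set \<Rightarrow> (nat \<Rightarrow> nat) \<Rightarrow> nat" where
  "height T p = \<Sum>T + \<Sum>(p -` T)"

text \<open>Lexicographic minimality. Besides cutting strands, a small weight favours dots over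
  singletons at the cut ends, so dots spread as far as they can.\<close>

definition reduced :: "(nat \<times> nat) set \<Rightarrow> nat set \<Rightarrow> (nat \<Rightarrow> bool) \<Rightarrow> (nat \<Rightarrow> bool) \<Rightarrow> (nat \<Rightarrow> nat) \<Rightarrow>
    (nat \<times> nat) set \<Rightarrow> bool" where
  "reduced \<epsilon> T b e p \<eta> \<longleftrightarrow> valid \<epsilon> T p \<eta> \<and>
    (\<forall>\<epsilon>' T' b' e' p' \<eta>'. valid \<epsilon>' T' p' \<eta>' \<longrightarrow> W \<epsilon>' T' b' e' p' \<eta>' = W \<epsilon> T b e p \<eta> \<longrightarrow>
      \<not> (weight T' b' e' < weight T b e \<or> weight T' b' e' = weight T b e \<and>
          (defect \<epsilon>' \<eta>' < defect \<epsilon> \<eta> \<or> defect \<epsilon>' \<eta>' = defect \<epsilon> \<eta> \<and> height T' p' < height T p)))"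

lemma exists_reduced:
  assumes "valid \<epsilon> T p \<eta>"
  shows "\<exists>\<epsilon>' T' b' e' p' \<eta>'. reduced \<epsilon>' T' b' e' p' \<eta>' \<and> W \<epsilon>' T' b' e' p' \<eta>' = W \<epsilon> T b e p \<eta>"
proof -
  define m where "m = measures [\<lambda>(\<epsilon>, T, b, e, p, \<eta>). weight T b e,
    \<lambda>(\<epsilon>, T, b :: nat \<Rightarrow> bool, e :: nat \<Rightarrow> bool, p :: nat \<Rightarrow> nat, \<eta>). defect \<epsilon> \<eta>, \<lambda>(\<epsilon>, T, b, e, p, \<eta>). height T p]"
  define X where "X = {(\<epsilon>', T', b', e', p', \<eta>'). valid \<epsilon>' T' p' \<eta>' \<and> W \<epsilon>' T' b' e' p' \<eta>' = W \<epsilon> T b e p \<eta>}"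
  have inX: "(\<epsilon>, T, b, e, p, \<eta>) \<in> X" using assms by (simp add: X_def)
  have wfm: "wf m" unfolding m_def by simp
  obtain d where d: "d \<in> X" "\<And>d'. (d', d) \<in> m \<Longrightarrow> d' \<notin> X"
    using wfE_min[OF wfm inX] by blast
  obtain \<epsilon>0 T0 b0 e0 p0 \<eta>0 where d0: "d = (\<epsilon>0, T0, b0, e0, p0, \<eta>0)" by (cases d)
  have "reduced \<epsilon>0 T0 b0 e0 p0 \<eta>0"
    unfolding reduced_def
  proof (intro conjI allI impI notI)
    show "valid \<epsilon>0 T0 p0 \<eta>0" using d(1) by (simp add: d0 X_def)
    fix \<epsilon>' T' b' e' p' \<eta>'
    assume *: "valid \<epsilon>' T' p' \<eta>'" "W \<epsilon>' T' b' e' p' \<eta>' = W \<epsilon>0 T0 b0 e0 p0 \<eta>0"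
      and less: "weight T' b' e' < weight T0 b0 e0 \<or> weight T' b' e' = weight T0 b0 e0 \<and>
          (defect \<epsilon>' \<eta>' < defect \<epsilon>0 \<eta>0 \<or> defect \<epsilon>' \<eta>' = defect \<epsilon>0 \<eta>0 \<and> height T' p' < height T0 p0)"
    have "((\<epsilon>', T', b', e', p', \<eta>'), d) \<in> m" using less by (auto simp: m_def d0)
    with d(2) have "(\<epsilon>', T', b', e', p', \<eta>') \<notin> X" by blast
    with * d(1) show False by (simp add: d0 X_def)
  qed
  moreover have "W \<epsilon>0 T0 b0 e0 p0 \<eta>0 = W \<epsilon> T b e p \<eta>" using d(1) by (simp add: d0 X_def)
  ultimately show ?thesis by blast
qed

section \<open>How single changes affect weight and defect\<close>

lemma weight_recolour_top:
  assumes "finite T" "i \<in> T" "b i"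
  shows "weight T (b(i := False)) e < weight T b e"
proof -
  have "{j\<in>T. (b(i := False)) j} = {j\<in>T. b j} - {i}" by auto
  then have "{j\<in>T. (b(i := False)) j} \<subset> {j\<in>T. b j}" using assms by blast
  then have "card {j\<in>T. (b(i := False)) j} < card {j\<in>T. b j}"
    by (rule psubset_card_mono[rotated]) (use assms in simp)
  then show ?thesis by (simp add: weight_def)
qed

lemma weight_recolour_bottom:
  assumes "finite T" "i \<in> T" "e i"
  shows "weight T b (e(i := False)) < weight T b e"
  using weight_recolour_top[where b = e and e = b, OF assms] by (simp add: weight_def)

lemma weight_insert:
  assumes "T \<subseteq> {1..n}" "i \<in> {1..n} - T"
  shows "weight (insert i T) (b(i := x)) (e(i := y)) < weight T b e"
proof -
  have fin: "finite T" using assms(1) finite_subset by blast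
  have "card (insert i T) \<le> card {1..n}" by (rule card_mono) (use assms in auto)
  then have n: "card (insert i T) = Suc (card T)" "Suc (card T) \<le> n" using assms fin by auto
  have *: "card {j\<in>insert i T. (c(i := z)) j} \<le> Suc (card {j\<in>T. c j})" for c :: "nat \<Rightarrow> bool" and z
  proof -
    have "{j\<in>insert i T. (c(i := z)) j} \<subseteq> insert i {j\<in>T. c j}" by auto
    then have "card {j\<in>insert i T. (c(i := z)) j} \<le> card (insert i {j\<in>T. c j})"
      by (rule card_mono[rotated]) (use fin in simp)
    also have "\<dots> \<le> Suc (card {j\<in>T. c j})" by (rule card_insert_le_m1) auto
    finally show ?thesis .
  qed
  show ?thesis unfolding weight_def n(1) using *[of b x] *[of e y] n(2) by simp
qed

lemma defect_insert:
  assumes "i \<in> {1..n}" "j \<in> {1..n}"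
  shows "(i, j) \<notin> \<epsilon> \<Longrightarrow> defect (insert (i, j) \<epsilon>) \<eta> < defect \<epsilon> \<eta>"
    and "(i, j) \<notin> \<eta> \<Longrightarrow> defect \<epsilon> (insert (i, j) \<eta>) < defect \<epsilon> \<eta>"
proof -
  have "card ({1..n} \<times> {1..n} - insert (i, j) R) < card ({1..n} \<times> {1..n} - R)" if "(i, j) \<notin> R" for R
    by (rule psubset_card_mono) (simp, use that assms in blast)
  then show "(i, j) \<notin> \<epsilon> \<Longrightarrow> defect (insert (i, j) \<epsilon>) \<eta> < defect \<epsilon> \<eta>"
    and "(i, j) \<notin> \<eta> \<Longrightarrow> defect \<epsilon> (insert (i, j) \<eta>) < defect \<epsilon> \<eta>"
    unfolding defect_def by simp_all
qed

lemma finite_rel: "R \<subseteq> {1..n} \<times> {1..n} \<Longrightarrow> finite R"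
  by (rule finite_subset) auto

text \<open>\<open>Qs R\<close> absorbs each step of the equivalence closure of \<open>R\<close>, so
  saturation will turn \<open>\<epsilon>\<close> and \<open>\<eta>\<close> into equivalence
  relations.\<close>

lemma Qs_closure:
  assumes "R \<subseteq> {1..n} \<times> {1..n}"
  shows "i \<in> {1..n} \<Longrightarrow> Q i i * Qs R = Qs R"
    and "(i, j) \<in> R \<Longrightarrow> Q j i * Qs R = Qs R"
    and "(i, j) \<in> R \<Longrightarrow> (j, k) \<in> R \<Longrightarrow> Q i k * Qs R = Qs R"
proof -
  note fin = finite_rel[OF assms]
  show "Q i i * Qs R = Qs R" by (simp add: Q_outside)
  show "Q j i * Qs R = Qs R" if "(i, j) \<in> R" using Qs_absorb(1)[OF fin that] Q_sym[of i j] by simp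
  assume ij: "(i, j) \<in> R" and jk: "(j, k) \<in> R"
  have "Q i k * (Q i j * Q j k) = Q i j * Q j k"
  proof -
    have "i \<in> {1..n}" "j \<in> {1..n}" "k \<in> {1..n}" using ij jk assms by blast+
    note trans = Q_trans[OF this]
    have "Q i k * (Q i j * Q j k) = Q i j * Q i k * Q j k"
      using Q_commute[of i k i j] by (simp add: mult.assoc[symmetric])
    also have "\<dots> = Q i j * Q j k * Q i k"
      using Q_commute[of i k j k] by (simp add: mult.assoc)
    finally show ?thesis using trans by simp
  qed
  moreover have "Q i j * Q j k * Qs R = Qs R"
    using Qs_absorb(1)[OF fin ij] Qs_absorb(1)[OF fin jk] by (simp add: mult.assoc)
  ultimately show "Q i k * Qs R = Qs R" by (metis mult.assoc)
qed

lemma F_G_absorb: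
  assumes "finite T" "p permutes {1..n}" "p j \<in> T" "e (p j) = c"
  shows "F T b e p * G c j = F T b e p"
  using F_mult_G[OF assms(1,2), of b e c j] assms(3,4) by (auto simp: insert_absorb fun_upd_idem)

lemma G_F_absorb:
  assumes "finite T" "i \<in> T" "b i = c"
  shows "G c i * F T b e p = F T b e p"
  using G_mult_F[OF assms(1), of c i b e p] assms(2,3) by (auto simp: insert_absorb fun_upd_idem)

text \<open>A representation of least weight, then of least defect, then of least height, satisfies all
  compatibility conditions between its components.\<close>

context
  fixes \<epsilon> T b e p \<eta>
  assumes red: "reduced \<epsilon> T b e p \<eta>"
begin

lemma red_valid: "valid \<epsilon> T p \<eta>"
  and red_\<epsilon>: "\<epsilon> \<subseteq> {1..n} \<times> {1..n}" and red_\<eta>: "\<eta> \<subseteq> {1..n} \<times> {1..n}"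
  and red_T: "T \<subseteq> {1..n}" and red_p: "p permutes {1..n}"
  using red unfolding reduced_def valid_def by blast+

lemma red_finite: "finite T" "finite \<epsilon>" "finite \<eta>"
  using red_T finite_subset finite_rel red_\<epsilon> red_\<eta> by blast+

lemma red_weight:
  assumes "valid \<epsilon>' T' p' \<eta>'" "W \<epsilon>' T' b' e' p' \<eta>' = W \<epsilon> T b e p \<eta>"
  shows "\<not> weight T' b' e' < weight T b e"
  using red assms unfolding reduced_def by blast

lemma red_defect:
  assumes "valid \<epsilon>' T p \<eta>'" "W \<epsilon>' T b e p \<eta>' = W \<epsilon> T b e p \<eta>"
  shows "\<not> defect \<epsilon>' \<eta>' < defect \<epsilon> \<eta>"
  using red assms unfolding reduced_def by blast

lemma red_height:
  assumes "valid \<epsilon> T' p' \<eta>" "W \<epsilon> T' b' e' p' \<eta> = W \<epsilon> T b e p \<eta>" "weight T' b' e' = weight T b e"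
  shows "\<not> height T' p' < height T p"
  using red assms unfolding reduced_def by blast

section \<open>Consequences of minimality\<close>

text \<open>Adding a pair whose \<open>Q\<close> is absorbed would lower the defect and leave the
  weight unchanged.\<close>

lemma red_bottom_maximal:
  assumes "i \<in> {1..n}" "j \<in> {1..n}" "F T b e p * (Q i j * Qs \<eta>) = F T b e p * Qs \<eta>"
  shows "(i, j) \<in> \<eta>"
proof (rule ccontr)
  assume ij: "(i, j) \<notin> \<eta>"
  have "W \<epsilon> T b e p (insert (i, j) \<eta>) = W \<epsilon> T b e p \<eta>"
    unfolding W_def Qs_insert[OF red_finite(3)] mult.assoc assms(3) ..
  moreover have "valid \<epsilon> T p (insert (i, j) \<eta>)" using red_valid assms by (auto simp: valid_def)
  moreover have "defect \<epsilon> (insert (i, j) \<eta>) < defect \<epsilon> \<eta>"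
    by (rule defect_insert(2)[OF assms(1,2) ij])
  ultimately show False using red_defect by blast
qed

lemma red_top_maximal:
  assumes "i \<in> {1..n}" "j \<in> {1..n}" "Qs \<epsilon> * Q i j * F T b e p = Qs \<epsilon> * F T b e p"
  shows "(i, j) \<in> \<epsilon>"
proof (rule ccontr)
  assume ij: "(i, j) \<notin> \<epsilon>"
  have "W (insert (i, j) \<epsilon>) T b e p \<eta> = W \<epsilon> T b e p \<eta>"
    unfolding W_def Qs_insert[OF red_finite(2)] Q_Qs_commute[OF red_finite(2)] assms(3) ..
  moreover have "valid (insert (i, j) \<epsilon>) T p \<eta>" using red_valid assms by (auto simp: valid_def)
  moreover have "defect (insert (i, j) \<epsilon>) \<eta> < defect \<epsilon> \<eta>"
    by (rule defect_insert(1)[OF assms(1,2) ij])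
  ultimately show False using red_defect by blast
qed

lemma red_bottom_equiv:
  shows "i \<in> {1..n} \<Longrightarrow> (i, i) \<in> \<eta>"
    and "(i, j) \<in> \<eta> \<Longrightarrow> (j, i) \<in> \<eta>"
    and "(i, j) \<in> \<eta> \<Longrightarrow> (j, k) \<in> \<eta> \<Longrightarrow> (i, k) \<in> \<eta>"
proof -
  note cl = Qs_closure[OF red_\<eta>]
  have *: "(i, j) \<in> \<eta> \<Longrightarrow> i \<in> {1..n} \<and> j \<in> {1..n}" for i j using red_\<eta> by blast
  show "i \<in> {1..n} \<Longrightarrow> (i, i) \<in> \<eta>" by (rule red_bottom_maximal) (simp_all only: cl)
  show "(i, j) \<in> \<eta> \<Longrightarrow> (j, i) \<in> \<eta>" by (rule red_bottom_maximal) (simp_all only: * cl)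
  show "(i, j) \<in> \<eta> \<Longrightarrow> (j, k) \<in> \<eta> \<Longrightarrow> (i, k) \<in> \<eta>"
    by (rule red_bottom_maximal) (use * cl in metis)+
qed

lemma red_top_equiv:
  shows "i \<in> {1..n} \<Longrightarrow> (i, i) \<in> \<epsilon>"
    and "(i, j) \<in> \<epsilon> \<Longrightarrow> (j, i) \<in> \<epsilon>"
    and "(i, j) \<in> \<epsilon> \<Longrightarrow> (j, k) \<in> \<epsilon> \<Longrightarrow> (i, k) \<in> \<epsilon>"
proof -
  note cl = Qs_closure[OF red_\<epsilon>, unfolded Q_Qs_commute[OF red_finite(2)]]
  have *: "(i, j) \<in> \<epsilon> \<Longrightarrow> i \<in> {1..n} \<and> j \<in> {1..n}" for i j using red_\<epsilon> by blast
  show "i \<in> {1..n} \<Longrightarrow> (i, i) \<in> \<epsilon>" by (rule red_top_maximal) (simp_all only: cl)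
  show "(i, j) \<in> \<epsilon> \<Longrightarrow> (j, i) \<in> \<epsilon>" by (rule red_top_maximal) (simp_all only: * cl)
  show "(i, j) \<in> \<epsilon> \<Longrightarrow> (j, k) \<in> \<epsilon> \<Longrightarrow> (i, k) \<in> \<epsilon>"
    by (rule red_top_maximal) (use * cl in metis)+
qed

text \<open>\<open>F\<close> absorbs the dot at \<open>i\<close>, and the factor
  \<open>Q i j\<close> of \<open>Qs \<eta>\<close> copies it to \<open>j\<close>. Were
  \<open>j\<close> uncut or a singleton, cutting or recolouring it would lower the weight.\<close>

lemma red_bottom_dots_closed:
  assumes "p i \<in> T" "\<not> e (p i)" "(i, j) \<in> \<eta>"
  shows "p j \<in> T \<and> \<not> e (p j)"
proof (rule ccontr)
  assume j: "\<not> (p j \<in> T \<and> \<not> e (p j))"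
  have ij: "i \<in> {1..n}" "j \<in> {1..n}" "i \<noteq> j" using assms red_\<eta> j by auto
  have abs: "F T b e p * G False i = F T b e p"
    by (rule F_G_absorb[OF red_finite(1) red_p]) (use assms in auto)
  have "F T b e p * Qs \<eta> = F T b e p * (G False i * Q i j) * Qs \<eta>"
    using Qs_absorb(1)[OF red_finite(3) assms(3)] abs by (simp add: mult.assoc[symmetric]) (simp add: mult.assoc)
  also have "\<dots> = F T b e p * G False j * Qs \<eta>"
    unfolding Q_dot(1)[OF ij] using abs by (simp add: mult.assoc[symmetric])
  finally have "F T b e p * Qs \<eta> = F T b e p * G False j * Qs \<eta>" .
  then have W: "W \<epsilon> (insert (p j) T) (if p j \<in> T then b else b(p j := False)) (e(p j := False)) p \<eta> = W \<epsilon> T b e p \<eta>"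
    unfolding W_def F_mult_G[OF red_finite(1) red_p] by (simp only: mult.assoc)
  have pj: "p j \<in> {1..n}" using ij permutes_in_image[OF red_p] by blast
  have v: "valid \<epsilon> (insert (p j) T) p \<eta>" using red_valid pj by (auto simp: valid_def)
  show False
  proof (cases "p j \<in> T")
    case True
    then show False
      using red_weight[OF v W] weight_recolour_bottom[OF red_finite(1) True, of e b] j
      by (simp add: insert_absorb)
  next
    case False
    then show False using red_weight[OF v W] weight_insert[OF red_T, of "p j" b False e False] pj by simp
  qed
qed

lemma red_top_dots_closed:
  assumes "i \<in> T" "\<not> b i" "(i, j) \<in> \<epsilon>"
  shows "j \<in> T \<and> \<not> b j"
proof (rule ccontr)
  assume j: "\<not> (j \<in> T \<and> \<not> b j)"
  have ij: "i \<in> {1..n}" "j \<in> {1..n}" "i \<noteq> j" using assms red_\<epsilon> j by auto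
  have abs: "G False i * F T b e p = F T b e p"
    by (rule G_F_absorb[OF red_finite(1)]) (use assms in auto)
  have "Qs \<epsilon> * F T b e p = Qs \<epsilon> * (Q i j * G False i) * F T b e p"
    using Qs_absorb(2)[OF red_finite(2) assms(3)] abs by (simp add: mult.assoc[symmetric]) (simp add: mult.assoc)
  also have "\<dots> = Qs \<epsilon> * (G False j * F T b e p)"
    unfolding Q_dot(2)[OF ij] G_commute[OF ij(3)] using abs by (simp add: mult.assoc)
  finally have "Qs \<epsilon> * F T b e p = Qs \<epsilon> * (G False j * F T b e p)" .
  then have W: "W \<epsilon> (insert j T) (b(j := False)) (if j \<in> T then e else e(j := False)) p \<eta> = W \<epsilon> T b e p \<eta>"
    unfolding W_def G_mult_F[OF red_finite(1)] by simp
  have v: "valid \<epsilon> (insert j T) p \<eta>" using red_valid ij by (auto simp: valid_def)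
  show False
  proof (cases "j \<in> T")
    case True
    then show False
      using red_weight[OF v W] weight_recolour_top[OF red_finite(1) True, of b e] j
      by (simp add: insert_absorb)
  next
    case False
    then show False using red_weight[OF v W] weight_insert[OF red_T, of j b False e False] ij by simp
  qed
qed

text \<open>Of two uncut strands joined at the bottom one is redundant. By \<open>q = qeq\<close>,
  one copy of \<open>Q i j\<close> slides to the top and keeps the upper ends joined, the other
  stays below, and the \<open>e\<close> in between cuts a strand, lowering the weight.\<close>

lemma red_bottom_separated:
  assumes "p i \<notin> T" "p j \<notin> T" "(i, j) \<in> \<eta>"
  shows "i = j"
proof (rule ccontr)
  assume "i \<noteq> j"
  then have ij: "i \<in> {1..n}" "j \<in> {1..n}" "i \<noteq> j" using assms red_\<eta> by auto
  have pij: "p i \<in> {1..n}" "p j \<in> {1..n}" using ij permutes_in_image[OF red_p] by blast+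
  have Q: "Q i j * Qs \<eta> = Qs \<eta>" by (rule Qs_absorb(1)[OF red_finite(3) assms(3)])
  have "F T b e p * Qs \<eta> = F T b e p * (Q i j * G True i * Q i j) * Qs \<eta>"
    unfolding QGQ(1)[OF ij] by (simp only: mult.assoc Q)
  also have "\<dots> = Q (p i) (p j) * (F T b e p * G True i) * Qs \<eta>"
    using F_mult_Q[OF red_p assms(1,2) red_finite(1), of b e] Q by (simp add: mult.assoc[symmetric]) (simp add: mult.assoc)
  finally have "W (insert (p i, p j) \<epsilon>) (insert (p i) T) (b(p i := True)) (e(p i := True)) p \<eta> = W \<epsilon> T b e p \<eta>"
    unfolding W_def Qs_insert[OF red_finite(2)] Q_Qs_commute[OF red_finite(2)]
      F_mult_G[OF red_finite(1) red_p] using assms(1) by (simp add: mult.assoc)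
  moreover have "valid (insert (p i, p j) \<epsilon>) (insert (p i) T) p \<eta>"
    using red_valid pij by (auto simp: valid_def)
  ultimately show False using red_weight weight_insert[OF red_T, of "p i" b True e True] assms(1) pij by blast
qed

text \<open>This is reduced to the bottom case: the pair slides through \<open>F\<close> to the
  bottom, where minimal defect puts it into \<open>\<eta>\<close>.\<close>

lemma red_top_separated:
  assumes "i \<notin> T" "j \<notin> T" "(i, j) \<in> \<epsilon>"
  shows "i = j"
proof -
  define i' j' where "i' = pinv p i" and "j' = pinv p j"
  have p: "p i' = i" "p j' = j" using permutes_inverses(1)[OF red_p] by (simp_all add: i'_def j'_def)
  have ij: "i' \<in> {1..n}" "j' \<in> {1..n}"
    using assms(3) red_\<epsilon> permutes_in_image[OF red_p, of i'] permutes_in_image[OF red_p, of j'] p by auto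
  have "Qs \<epsilon> * F T b e p = Qs \<epsilon> * Q i j * F T b e p"
    using Qs_absorb(2)[OF red_finite(2) assms(3)] by simp
  also have "\<dots> = Qs \<epsilon> * F T b e p * Q i' j'"
    using F_mult_Q[OF red_p, of i' T j' b e] assms red_finite(1) p by (simp add: mult.assoc)
  finally have "W \<epsilon> T b e p (insert (i', j') \<eta>) = W \<epsilon> T b e p \<eta>"
    unfolding W_def Qs_insert[OF red_finite(3)] by (simp only: mult.assoc[symmetric])
  moreover have "valid \<epsilon> T p (insert (i', j') \<eta>)" using red_valid ij by (auto simp: valid_def)
  moreover have "defect \<epsilon> (insert (i', j') \<eta>) < defect \<epsilon> \<eta>" if "(i', j') \<notin> \<eta>"
    by (rule defect_insert(2)[OF ij that])
  ultimately have "(i', j') \<in> \<eta>" using red_defect by blast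
  then have "i' = j'" using red_bottom_separated assms p by metis
  then show ?thesis using p by simp
qed

text \<open>A larger \<open>j\<close> in the class would be cut, and exchanging \<open>i\<close>
  with \<open>j\<close> is absorbed by \<open>Qs \<eta>\<close>. The exchange moves the cut from
  \<open>j\<close> to \<open>i\<close> and lowers the height.\<close>

lemma red_bottom_greatest:
  assumes "p i \<notin> T" "(i, j) \<in> \<eta>"
  shows "j \<le> i"
proof (rule ccontr)
  assume "\<not> j \<le> i"
  then have less: "i < j" by simp
  have pj: "p j \<in> T" using red_bottom_separated assms less by blast
  have ij: "i \<in> {1..n}" "j \<in> {1..n}" using assms red_\<eta> by auto
  define t where "t = transpose i j"
  have t: "t permutes {1..n}" unfolding t_def by (rule transpose_permutes[OF ij])
  have "perm t * Qs \<eta> = perm t * Q i j * Qs \<eta>"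
    using Qs_absorb(1)[OF red_finite(3) assms(2)] by (simp add: mult.assoc)
  also have "\<dots> = Qs \<eta>"
    using Q_transpose(2)[OF ij] Qs_absorb(1)[OF red_finite(3) assms(2)] by (simp add: t_def)
  finally have W: "W \<epsilon> T b e (p \<circ> t) \<eta> = W \<epsilon> T b e p \<eta>"
    unfolding W_def F_mult_perm[OF red_p t, symmetric] by (simp only: mult.assoc)
  have v: "valid \<epsilon> T (p \<circ> t) \<eta>"
    using red_valid permutes_compose[OF t red_p] by (simp add: valid_def)
  have fin: "finite (p -` T)" by (rule finite_vimageI[OF red_finite(1) permutes_inj[OF red_p]])
  have "(p \<circ> t) -` T = insert i (p -` T - {j})"
    using pj assms(1) less by (auto simp: t_def transpose_def split: if_splits)
  then have "\<Sum>((p \<circ> t) -` T) = i + \<Sum>(p -` T - {j})" using assms(1) fin by simp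
  moreover have "\<Sum>(p -` T) = j + \<Sum>(p -` T - {j})"
    using sum.remove[OF fin, of j "\<lambda>x. x"] pj by simp
  ultimately have "height T (p \<circ> t) < height T p" using less by (simp add: height_def)
  then show False using red_height[OF v W] by simp
qed

text \<open>Exchanging top vertices relabels \<open>T\<close> and both colourings. The weight and
  the cut bottom vertices stay the same, so the drop in the sum over \<open>T\<close>
  decides.\<close>

lemma red_top_greatest:
  assumes "i \<notin> T" "(i, j) \<in> \<epsilon>"
  shows "j \<le> i"
proof (rule ccontr)
  assume "\<not> j \<le> i"
  then have less: "i < j" by simp
  have jT: "j \<in> T" using red_top_separated assms less by blast
  have ij: "i \<in> {1..n}" "j \<in> {1..n}" using assms red_\<epsilon> by auto
  define t where "t = transpose i j"
  have t: "t permutes {1..n}" unfolding t_def by (rule transpose_permutes[OF ij])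
  have pt: "pinv t = t" by (simp add: t_def inv_transpose_eq)
  have tt: "t (t x) = x" for x by (simp add: t_def)
  have "Qs \<epsilon> * perm t = Qs \<epsilon> * Q i j * perm t"
    using Qs_absorb(2)[OF red_finite(2) assms(2)] by simp
  also have "\<dots> = Qs \<epsilon>"
    unfolding t_def mult.assoc Q_transpose(1)[OF ij] by (rule Qs_absorb(2)[OF red_finite(2) assms(2)])
  finally have W: "W \<epsilon> (t ` T) (b \<circ> t) (e \<circ> t) (t \<circ> p) \<eta> = W \<epsilon> T b e p \<eta>"
    unfolding W_def using perm_mult_F[OF red_p t red_finite(1), of b e, unfolded pt, symmetric]
    by (simp only: mult.assoc[symmetric])
  have sub: "t ` T \<subseteq> {1..n}" using red_T permutes_image[OF t] by blast
  have v: "valid \<epsilon> (t ` T) (t \<circ> p) \<eta>"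
    using red_valid permutes_compose[OF red_p t] sub by (simp add: valid_def)
  have inj: "inj t" by (rule permutes_inj[OF t])
  have "{x \<in> t ` T. (c \<circ> t) x} = t ` {x\<in>T. c x}" for c :: "nat \<Rightarrow> bool" by (auto simp: tt)
  then have "card {x \<in> t ` T. (c \<circ> t) x} = card {x\<in>T. c x}" for c :: "nat \<Rightarrow> bool"
    using card_image[OF inj_on_subset[OF inj subset_UNIV], of "{x\<in>T. c x}"] by simp
  then have w: "weight (t ` T) (b \<circ> t) (e \<circ> t) = weight T b e"
    unfolding weight_def using card_image[OF inj_on_subset[OF inj subset_UNIV], of T] by simp
  have "t ` T = insert i (T - {j})"
    using jT assms(1) less by (auto simp: t_def transpose_def image_iff split: if_splits)
  then have "\<Sum>(t ` T) = i + \<Sum>(T - {j})" using assms(1) red_finite(1) by simp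
  moreover have "\<Sum>T = j + \<Sum>(T - {j})"
    using sum.remove[OF red_finite(1) jT, of "\<lambda>x. x"] by simp
  moreover have "(t \<circ> p) -` (t ` T) = p -` T"
    using inj_vimage_image_eq[OF inj, of T] by (simp only: vimage_comp[symmetric])
  ultimately have "height (t ` T) (t \<circ> p) < height T p" using less by (simp add: height_def)
  then show False using red_height[OF v W w] by simp
qed

text \<open>Dots are \<open>False\<close> in all colourings, so a diagram cannot distinguish them.
  Joining two dots is free by \<open>Q_dot\<close>; saturation therefore puts them into one class,
  which makes \<open>\<eta>\<close> readable from the diagram.\<close>

lemma red_bottom_dots_related:
  assumes "p i \<in> T" "\<not> e (p i)" "p j \<in> T" "\<not> e (p j)"
  shows "(i, j) \<in> \<eta>"
proof (cases "i = j")
  case True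
  have "i \<in> {1..n}" using assms(1) red_T permutes_in_image[OF red_p] by blast
  then show ?thesis using True red_bottom_equiv(1) by blast
next
  case False
  have ij: "i \<in> {1..n}" "j \<in> {1..n}" using assms(1,3) red_T permutes_in_image[OF red_p] by blast+
  have 1: "F T b e p * G False i = F T b e p"
    by (rule F_G_absorb[OF red_finite(1) red_p]) (use assms in auto)
  have 2: "F T b e p * G False j = F T b e p"
    by (rule F_G_absorb[OF red_finite(1) red_p]) (use assms in auto)
  have "F T b e p * Q i j = F T b e p * (G False i * Q i j)"
    using 1 by (simp add: mult.assoc[symmetric])
  also have "\<dots> = F T b e p"
    unfolding Q_dot(1)[OF ij False] using 1 2 by (simp add: mult.assoc[symmetric])
  finally have "F T b e p * (Q i j * Qs \<eta>) = F T b e p * Qs \<eta>" by (simp add: mult.assoc[symmetric])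
  then show ?thesis by (rule red_bottom_maximal[OF ij])
qed

lemma red_top_dots_related:
  assumes "i \<in> T" "\<not> b i" "j \<in> T" "\<not> b j"
  shows "(i, j) \<in> \<epsilon>"
proof (cases "i = j")
  case True
  then show ?thesis using assms red_T red_top_equiv(1) by blast
next
  case False
  have ij: "i \<in> {1..n}" "j \<in> {1..n}" using assms(1,3) red_T by blast+
  have 1: "G False i * F T b e p = F T b e p"
    by (rule G_F_absorb[OF red_finite(1)]) (use assms in auto)
  have 2: "G False j * F T b e p = F T b e p"
    by (rule G_F_absorb[OF red_finite(1)]) (use assms in auto)
  have "Q i j * F T b e p = Q i j * G False i * F T b e p"
    using 1 by (simp add: mult.assoc)
  also have "\<dots> = F T b e p"
    unfolding Q_dot(2)[OF ij False] using 1 2 by (simp add: mult.assoc)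
  finally have "Qs \<epsilon> * Q i j * F T b e p = Qs \<epsilon> * F T b e p" by (simp add: mult.assoc)
  then show ?thesis by (rule red_top_maximal[OF ij])
qed

lemma Qs_G_commute:
  assumes "R \<subseteq> {1..n} \<times> {1..n}" "\<And>i j. (i, j) \<in> R \<Longrightarrow> i \<noteq> k \<and> j \<noteq> k"
  shows "Qs R * G c k = G c k * Qs R"
  unfolding Qs_def
proof (rule iprod_commute[symmetric])
  fix r assume "r \<in> R"
  then show "G c k * (case r of (i, j) \<Rightarrow> Q i j) = (case r of (i, j) \<Rightarrow> Q i j) * G c k"
    using assms(2)[of "fst r" "snd r"] Q_G_commute[of k "fst r" "snd r" c] by (simp add: case_prod_unfold)
qed (rule finite_rel[OF assms(1)])

text \<open>Since \<open>1\<close> is the smallest bottom vertex, it can only be a chosen representative if it is alone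
  in its \<open>\<eta>\<close>-class.\<close>

lemma red_mult_e: "\<exists>\<epsilon>' T' b' e' p' \<eta>'. valid \<epsilon>' T' p' \<eta>' \<and> W \<epsilon> T b e p \<eta> * gen LE = W \<epsilon>' T' b' e' p' \<eta>'"
proof -
  \<comment> \<open>\<open>\<eta>'\<close> drops all pairs that involve \<open>1\<close>. The aim is
    that, after \<open>F\<close>, the product of \<open>Qs \<eta>\<close> and \<open>e\<close>
    equals that of \<open>e\<close> and \<open>Qs \<eta>'\<close>.\<close>
  define \<eta>' where "\<eta>' = {(i, j) \<in> \<eta>. i \<noteq> 1 \<and> j \<noteq> 1}"
  have sub: "\<eta>' \<subseteq> \<eta>" and \<eta>': "\<eta>' \<subseteq> {1..n} \<times> {1..n}" using red_\<eta> by (auto simp: \<eta>'_def)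
  note fin = finite_rel[OF \<eta>'] red_finite(3)
  have split: "Qs \<eta> = Qs \<eta>' * Qs (\<eta> - \<eta>')" "Qs \<eta> = Qs (\<eta> - \<eta>') * Qs \<eta>'"
    using Qs_Un[of \<eta>' "\<eta> - \<eta>'"] Qs_Un[of "\<eta> - \<eta>'" \<eta>'] fin sub
    by (simp_all add: Un_absorb1 Un_absorb2)
  have in_diff: "\<exists>k. (r = (1, k) \<or> r = (k, 1)) \<and> (1, k) \<in> \<eta>" if "r \<in> \<eta> - \<eta>'" for r
    using that red_bottom_equiv(2) by (cases r) (auto simp: \<eta>'_def)
  have comm: "Qs \<eta>' * G True 1 = G True 1 * Qs \<eta>'"
    by (rule Qs_G_commute[OF \<eta>']) (auto simp: \<eta>'_def)
  have alone: "Qs \<eta> = Qs \<eta>'" if "\<And>k. (1, k) \<in> \<eta> \<Longrightarrow> k = 1"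
  proof -
    have "Qs \<eta>' * Qs (\<eta> - \<eta>') = Qs \<eta>'"
      unfolding Qs_def[of "\<eta> - \<eta>'"]
    proof (rule iprod_fix_right)
      fix r assume "r \<in> \<eta> - \<eta>'"
      then have "r = (1, 1)" using in_diff that by blast
      then show "Qs \<eta>' * (case r of (i, j) \<Rightarrow> Q i j) = Qs \<eta>'" by (simp add: Q_outside)
    qed (use fin in simp)
    then show ?thesis using split(1) by simp
  qed
  have "F T b e p * Qs \<eta> * G True 1 = F T b e p * G True 1 * Qs \<eta>'"
  proof (cases "p 1 \<in> T")
    case False
    have "k = 1" if "(1, k) \<in> \<eta>" for k
      using red_bottom_greatest[OF False that] red_\<eta> that by auto
    from alone[OF this] show ?thesis by (simp only: mult.assoc comm)
  next
    case True
    show ?thesis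
    proof (cases "e (p 1)")
      case False
      \<comment> \<open>If \<open>1\<close> is a dot, so is every \<open>k\<close> in its class, and
        \<open>F\<close> absorbs \<open>Q 1 k\<close> through these two dots.\<close>
      have "F T b e p * Qs (\<eta> - \<eta>') = F T b e p"
        unfolding Qs_def
      proof (rule iprod_fix_right)
        fix r assume "r \<in> \<eta> - \<eta>'"
        then obtain k where k: "r = (1, k) \<or> r = (k, 1)" "(1, k) \<in> \<eta>" using in_diff by blast
        have "(case r of (i, j) \<Rightarrow> Q i j) = Q 1 k" using k(1) Q_sym[of 1 k] by auto
        moreover have "F T b e p * Q 1 k = F T b e p"
        proof (cases "k = 1")
          case False
          have 1: "1 \<in> {1..n}" "k \<in> {1..n}" "1 \<noteq> k" using k(2) red_\<eta> False by auto
          have "F T b e p * G False 1 = F T b e p"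
            by (rule F_G_absorb[OF red_finite(1) red_p]) (use True \<open>\<not> e (p 1)\<close> in auto)
          moreover have "F T b e p * G False k = F T b e p"
            by (rule F_G_absorb[OF red_finite(1) red_p])
              (use red_bottom_dots_closed[OF True \<open>\<not> e (p 1)\<close> k(2)] in auto)
          ultimately show ?thesis using Q_dot(1)[OF 1] by (metis mult.assoc)
        qed (simp add: Q_outside)
        ultimately show "F T b e p * (case r of (i, j) \<Rightarrow> Q i j) = F T b e p" by simp
      qed (use fin in simp)
      then have "F T b e p * Qs \<eta> = F T b e p * Qs \<eta>'" unfolding split(2) by (simp add: mult.assoc[symmetric])
      then show ?thesis by (simp only: mult.assoc comm)
    next
      case e: True
      show ?thesis
      proof (cases "\<exists>k. (1, k) \<in> \<eta> \<and> k \<noteq> 1")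
        case False
        then show ?thesis using alone by (metis mult.assoc comm)
      next
        case True
        then obtain k where k: "(1, k) \<in> \<eta>" "k \<noteq> 1" by blast
        have 1: "1 \<in> {1..n}" "k \<in> {1..n}" "1 \<noteq> k" using k red_\<eta> by auto
        \<comment> \<open>\<open>\<eta>'\<close> joins the rest of the class of \<open>1\<close>, so
          a single pair with \<open>1\<close> implies all the others.\<close>
        let ?R = "insert (1, k) \<eta>'"
        have R: "?R \<subseteq> {1..n} \<times> {1..n}" using \<eta>' 1 by blast
        have "Qs ?R * Qs (\<eta> - \<eta>') = Qs ?R"
          unfolding Qs_def[of "\<eta> - \<eta>'"]
        proof (rule iprod_fix_right)
          fix r assume "r \<in> \<eta> - \<eta>'"
          then obtain l where l: "r = (1, l) \<or> r = (l, 1)" "(1, l) \<in> \<eta>" using in_diff by blast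
          have "(case r of (i, j) \<Rightarrow> Q i j) = Q 1 l" using l(1) Q_sym[of 1 l] by auto
          moreover have "Q 1 l * Qs ?R = Qs ?R"
          proof (cases "l = 1")
            case False
            have "(k, l) \<in> \<eta>'"
              using red_bottom_equiv(3)[OF red_bottom_equiv(2)[OF k(1)] l(2)] k(2) False by (simp add: \<eta>'_def)
            then show ?thesis using Qs_closure(3)[OF R, of 1 k l] by blast
          qed (simp add: Q_outside)
          ultimately show "Qs ?R * (case r of (i, j) \<Rightarrow> Q i j) = Qs ?R"
            using Q_Qs_commute[OF finite_rel[OF R]] by simp
        qed (use fin in simp)
        moreover have "Qs \<eta> = Qs ?R * Qs (\<eta> - \<eta>')"
        proof -
          have "\<eta> = ?R \<union> (\<eta> - \<eta>')" using sub k by blast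
          then show ?thesis using Qs_Un[of ?R "\<eta> - \<eta>'"] fin by simp
        qed
        ultimately have "Qs \<eta> = Qs \<eta>' * Q 1 k"
          using Qs_insert[OF fin(1), of 1 k] Q_Qs_commute[OF fin(1)] by simp
        moreover have abs: "F T b e p * G True 1 = F T b e p"
          by (rule F_G_absorb[OF red_finite(1) red_p]) (use \<open>p 1 \<in> T\<close> e in auto)
        \<comment> \<open>\<open>F\<close> supplies a second \<open>e\<close> to the left of
          \<open>Q 1 k\<close>, so that \<open>eqe = e\<close> can remove this factor.\<close>
        ultimately have "F T b e p * Qs \<eta> * G True 1 = F T b e p * G True 1 * (Qs \<eta>' * Q 1 k) * G True 1"
          by simp
        also have "\<dots> = F T b e p * (G True 1 * Qs \<eta>') * Q 1 k * G True 1"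
          by (simp only: mult.assoc)
        also have "\<dots> = F T b e p * Qs \<eta>' * (G True 1 * Q 1 k * G True 1)"
          by (simp only: comm[symmetric] mult.assoc)
        also have "\<dots> = F T b e p * G True 1 * Qs \<eta>'"
          unfolding QGQ(2)[OF 1] by (simp only: comm mult.assoc)
        finally show ?thesis .
      qed
    qed
  qed
  moreover have "gen LE = G True 1" unfolding G_1 point_def by simp
  ultimately have "W \<epsilon> T b e p \<eta> * gen LE = W \<epsilon> (insert (p 1) T) (if p 1 \<in> T then b else b(p 1 := True)) (e(p 1 := True)) p \<eta>'"
    unfolding W_def F_mult_G[OF red_finite(1) red_p, symmetric] by (simp only: mult.assoc)
  moreover have "valid \<epsilon> (insert (p 1) T) p \<eta>'"
    using red_valid \<eta>' permutes_in_image[OF red_p, of 1] one_in(1) by (auto simp: valid_def)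
  ultimately show ?thesis by blast
qed

section \<open>Reduced words are determined by their diagrams\<close>

lemma red_rho: "(f, g) \<in> rho (W \<epsilon> T b e p \<eta>) \<longleftrightarrow> (\<forall>(i, j)\<in>\<epsilon>. f i = f j) \<and> (\<forall>(i, j)\<in>\<eta>. g i = g j) \<and>
    (\<forall>j. p j \<notin> T \<longrightarrow> f (p j) = g j) \<and>
    (\<forall>i\<in>T. \<not> b i \<longrightarrow> \<not> f i) \<and> (\<forall>j. p j \<in> T \<longrightarrow> \<not> e (p j) \<longrightarrow> \<not> g j)"
  by (rule rho_W[OF red_\<epsilon> red_\<eta> red_T red_p])

lemma red_rhoD:
  assumes "(f, g) \<in> rho (W \<epsilon> T b e p \<eta>)"
  shows "(i, j) \<in> \<epsilon> \<Longrightarrow> f i = f j" "(i, j) \<in> \<eta> \<Longrightarrow> g i = g j" "p j \<notin> T \<Longrightarrow> f (p j) = g j"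
    "i \<in> T \<Longrightarrow> \<not> b i \<Longrightarrow> \<not> f i" "p j \<in> T \<Longrightarrow> \<not> e (p j) \<Longrightarrow> \<not> g j"
proof -
  note * = assms[unfolded red_rho]
  show "(i, j) \<in> \<epsilon> \<Longrightarrow> f i = f j" using bspec[OF conjunct1[OF *], of "(i, j)"] by simp
  show "(i, j) \<in> \<eta> \<Longrightarrow> g i = g j" using bspec[OF conjunct1[OF conjunct2[OF *]], of "(i, j)"] by simp
  show "p j \<notin> T \<Longrightarrow> f (p j) = g j" using * by simp
  show "i \<in> T \<Longrightarrow> \<not> b i \<Longrightarrow> \<not> f i" using * by simp
  show "p j \<in> T \<Longrightarrow> \<not> e (p j) \<Longrightarrow> \<not> g j" using * by simp
qed

lemma ball_pairI:
  assumes "\<And>f g. (f, g) \<in> r \<Longrightarrow> P f g"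
  shows "\<forall>(f, g)\<in>r. P f g"
  using assms by auto

lemma red_edge_range: "p j \<notin> T \<Longrightarrow> (p j, a) \<in> \<epsilon> \<Longrightarrow> j \<in> {1..n}"
  using red_\<epsilon> permutes_in_image[OF red_p, of j] by blast

text \<open>The test element is the block containing \<open>a\<close>: its
  \<open>\<epsilon>\<close>-class together with the \<open>\<eta>\<close>-classes reached by uncut
  strands from there. Being reduced makes this consistent with the other strands and with the
  dots.\<close>

lemma red_top_indicator:
  assumes "a \<in> {1..n}" "\<not> (a \<in> T \<and> \<not> b a)"
  shows "(\<lambda>x. (x, a) \<in> \<epsilon>, \<lambda>y. \<exists>j. p j \<notin> T \<and> (p j, a) \<in> \<epsilon> \<and> (j, y) \<in> \<eta>) \<in> rho (W \<epsilon> T b e p \<eta>)"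
  unfolding red_rho
proof (intro conjI ballI allI impI; (clarify)?)
  show "((i, a) \<in> \<epsilon>) = ((j, a) \<in> \<epsilon>)" if "(i, j) \<in> \<epsilon>" for i j
    using that red_top_equiv(2,3) by blast
  show "(\<exists>k. p k \<notin> T \<and> (p k, a) \<in> \<epsilon> \<and> (k, i) \<in> \<eta>) = (\<exists>k. p k \<notin> T \<and> (p k, a) \<in> \<epsilon> \<and> (k, j) \<in> \<eta>)"
    if "(i, j) \<in> \<eta>" for i j
    using that red_bottom_equiv(2,3) by blast
  show "((p j, a) \<in> \<epsilon>) = (\<exists>k. p k \<notin> T \<and> (p k, a) \<in> \<epsilon> \<and> (k, j) \<in> \<eta>)" if "p j \<notin> T" for j
    using that red_bottom_separated red_bottom_equiv(1) red_edge_range by metis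
  show False if "i \<in> T" "\<not> b i" "(i, a) \<in> \<epsilon>" for i
    using red_top_dots_closed[OF that] assms(2) by blast
  show False if "p y \<in> T" "\<not> e (p y)" "p j \<notin> T" "(j, y) \<in> \<eta>" for y j
    using red_bottom_dots_closed[OF that(1,2) red_bottom_equiv(2)[OF that(4)]] that(3) by blast
qed

lemma red_bottom_indicator:
  assumes "c \<in> {1..n}" "\<not> (p c \<in> T \<and> \<not> e (p c))"
  shows "(\<lambda>x. \<exists>j. p j \<notin> T \<and> (j, c) \<in> \<eta> \<and> (p j, x) \<in> \<epsilon>, \<lambda>y. (y, c) \<in> \<eta>) \<in> rho (W \<epsilon> T b e p \<eta>)"
  unfolding red_rho
proof (intro conjI ballI allI impI; (clarify)?)
  show "((i, c) \<in> \<eta>) = ((j, c) \<in> \<eta>)" if "(i, j) \<in> \<eta>" for i j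
    using that red_bottom_equiv(2,3) by blast
  show "(\<exists>k. p k \<notin> T \<and> (k, c) \<in> \<eta> \<and> (p k, i) \<in> \<epsilon>) = (\<exists>k. p k \<notin> T \<and> (k, c) \<in> \<eta> \<and> (p k, j) \<in> \<epsilon>)"
    if "(i, j) \<in> \<epsilon>" for i j
    using that red_top_equiv(2,3) by blast
  show "(\<exists>k. p k \<notin> T \<and> (k, c) \<in> \<eta> \<and> (p k, p j) \<in> \<epsilon>) = ((j, c) \<in> \<eta>)" if "p j \<notin> T" for j
  proof
    assume "\<exists>k. p k \<notin> T \<and> (k, c) \<in> \<eta> \<and> (p k, p j) \<in> \<epsilon>"
    then obtain k where k: "p k \<notin> T" "(k, c) \<in> \<eta>" "(p k, p j) \<in> \<epsilon>" by blast
    have "p k = p j" by (rule red_top_separated[OF k(1) that k(3)])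
    then have "k = j" using permutes_inj[OF red_p] by (simp add: inj_eq)
    with k show "(j, c) \<in> \<eta>" by simp
  next
    assume j: "(j, c) \<in> \<eta>"
    then have "p j \<in> {1..n}" using red_\<eta> permutes_in_image[OF red_p] by blast
    with j that show "\<exists>k. p k \<notin> T \<and> (k, c) \<in> \<eta> \<and> (p k, p j) \<in> \<epsilon>" using red_top_equiv(1) by blast
  qed
  show False if "i \<in> T" "\<not> b i" "p j \<notin> T" "(p j, i) \<in> \<epsilon>" for i j
    using red_top_dots_closed[OF that(1,2) red_top_equiv(2)[OF that(4)]] that(3) by blast
  show False if "p y \<in> T" "\<not> e (p y)" "(y, c) \<in> \<eta>" for y
    using red_bottom_dots_closed[OF that] assms(2) by blast
qed

text \<open>Dots avoid every union of blocks, whereas any other vertex lies in the one given by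
  \<open>red_top_indicator\<close>.\<close>

lemma red_top_dot_iff:
  "a \<in> T \<and> \<not> b a \<longleftrightarrow> a \<in> {1..n} \<and> (\<forall>(f, g)\<in>rho (W \<epsilon> T b e p \<eta>). \<not> f a)"
proof
  assume "a \<in> T \<and> \<not> b a"
  then show "a \<in> {1..n} \<and> (\<forall>(f, g)\<in>rho (W \<epsilon> T b e p \<eta>). \<not> f a)"
    using red_T by (intro conjI ball_pairI) (blast, simp add: red_rhoD(4))
next
  assume *: "a \<in> {1..n} \<and> (\<forall>(f, g)\<in>rho (W \<epsilon> T b e p \<eta>). \<not> f a)"
  show "a \<in> T \<and> \<not> b a"
  proof (rule ccontr)
    assume "\<not> (a \<in> T \<and> \<not> b a)"
    from bspec[OF conjunct2[OF *] red_top_indicator[OF conjunct1[OF *] this]] red_top_equiv(1)[OF conjunct1[OF *]]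
    show False by simp
  qed
qed

lemma red_bottom_dot_iff:
  "p c \<in> T \<and> \<not> e (p c) \<longleftrightarrow> c \<in> {1..n} \<and> (\<forall>(f, g)\<in>rho (W \<epsilon> T b e p \<eta>). \<not> g c)"
proof
  assume "p c \<in> T \<and> \<not> e (p c)"
  then show "c \<in> {1..n} \<and> (\<forall>(f, g)\<in>rho (W \<epsilon> T b e p \<eta>). \<not> g c)"
    using red_T permutes_in_image[OF red_p, of c] by (intro conjI ball_pairI) (blast, simp add: red_rhoD(5))
next
  assume *: "c \<in> {1..n} \<and> (\<forall>(f, g)\<in>rho (W \<epsilon> T b e p \<eta>). \<not> g c)"
  show "p c \<in> T \<and> \<not> e (p c)"
  proof (rule ccontr)
    assume "\<not> (p c \<in> T \<and> \<not> e (p c))"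
    from bspec[OF conjunct2[OF *] red_bottom_indicator[OF conjunct1[OF *] this]] red_bottom_equiv(1)[OF conjunct1[OF *]]
    show False by simp
  qed
qed

text \<open>Unrelated vertices are separated by the indicator at whichever of them is not a dot; if
  both are dots, they are related by \<open>red_top_dots_related\<close>.\<close>

lemma red_top_iff:
  "(a, c) \<in> \<epsilon> \<longleftrightarrow> a \<in> {1..n} \<and> c \<in> {1..n} \<and> (\<forall>(f, g)\<in>rho (W \<epsilon> T b e p \<eta>). f a = f c)"
proof
  assume "(a, c) \<in> \<epsilon>"
  then show "a \<in> {1..n} \<and> c \<in> {1..n} \<and> (\<forall>(f, g)\<in>rho (W \<epsilon> T b e p \<eta>). f a = f c)"
    using red_\<epsilon> by (intro conjI ball_pairI) (blast, blast, rule red_rhoD(1))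
next
  assume "a \<in> {1..n} \<and> c \<in> {1..n} \<and> (\<forall>(f, g)\<in>rho (W \<epsilon> T b e p \<eta>). f a = f c)"
  then have ac: "a \<in> {1..n}" "c \<in> {1..n}" and all: "\<forall>(f, g)\<in>rho (W \<epsilon> T b e p \<eta>). f a = f c"
    by blast+
  consider "a \<in> T \<and> \<not> b a" "c \<in> T \<and> \<not> b c" | "\<not> (a \<in> T \<and> \<not> b a)" | "\<not> (c \<in> T \<and> \<not> b c)" by blast
  then show "(a, c) \<in> \<epsilon>"
  proof cases
    case 1
    then show ?thesis using red_top_dots_related by blast
  next
    case 2
    from bspec[OF all red_top_indicator[OF ac(1) this]] have "(c, a) \<in> \<epsilon>"
      using red_top_equiv(1)[OF ac(1)] by simp
    then show ?thesis by (rule red_top_equiv(2))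
  next
    case 3
    from bspec[OF all red_top_indicator[OF ac(2) this]] show ?thesis
      using red_top_equiv(1)[OF ac(2)] by simp
  qed
qed

lemma red_bottom_iff:
  "(a, c) \<in> \<eta> \<longleftrightarrow> a \<in> {1..n} \<and> c \<in> {1..n} \<and> (\<forall>(f, g)\<in>rho (W \<epsilon> T b e p \<eta>). g a = g c)"
proof
  assume "(a, c) \<in> \<eta>"
  then show "a \<in> {1..n} \<and> c \<in> {1..n} \<and> (\<forall>(f, g)\<in>rho (W \<epsilon> T b e p \<eta>). g a = g c)"
    using red_\<eta> by (intro conjI ball_pairI) (blast, blast, rule red_rhoD(2))
next
  assume "a \<in> {1..n} \<and> c \<in> {1..n} \<and> (\<forall>(f, g)\<in>rho (W \<epsilon> T b e p \<eta>). g a = g c)"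
  then have ac: "a \<in> {1..n}" "c \<in> {1..n}" and all: "\<forall>(f, g)\<in>rho (W \<epsilon> T b e p \<eta>). g a = g c"
    by blast+
  consider "p a \<in> T \<and> \<not> e (p a)" "p c \<in> T \<and> \<not> e (p c)" | "\<not> (p a \<in> T \<and> \<not> e (p a))"
    | "\<not> (p c \<in> T \<and> \<not> e (p c))" by blast
  then show "(a, c) \<in> \<eta>"
  proof cases
    case 1
    then show ?thesis using red_bottom_dots_related by blast
  next
    case 2
    from bspec[OF all red_bottom_indicator[OF ac(1) this]] have "(c, a) \<in> \<eta>"
      using red_bottom_equiv(1)[OF ac(1)] by simp
    then show ?thesis by (rule red_bottom_equiv(2))
  next
    case 3
    from bspec[OF all red_bottom_indicator[OF ac(2) this]] show ?thesis
      using red_bottom_equiv(1)[OF ac(2)] by simp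
  qed
qed

text \<open>Dots must be excluded: a top dot and a bottom dot agree in every colouring without being
  linked.\<close>

lemma red_link_iff:
  assumes "a \<in> {1..n}" "\<not> (a \<in> T \<and> \<not> b a)"
  shows "(\<exists>j. p j \<notin> T \<and> (p j, a) \<in> \<epsilon> \<and> (j, c) \<in> \<eta>) \<longleftrightarrow> (\<forall>(f, g)\<in>rho (W \<epsilon> T b e p \<eta>). f a = g c)"
proof
  assume "\<exists>j. p j \<notin> T \<and> (p j, a) \<in> \<epsilon> \<and> (j, c) \<in> \<eta>"
  then obtain j where "p j \<notin> T" "(p j, a) \<in> \<epsilon>" "(j, c) \<in> \<eta>" by blast
  then show "\<forall>(f, g)\<in>rho (W \<epsilon> T b e p \<eta>). f a = g c"
    using red_rhoD(1,2,3) by (intro ball_pairI) metis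
next
  assume all: "\<forall>(f, g)\<in>rho (W \<epsilon> T b e p \<eta>). f a = g c"
  show "\<exists>j. p j \<notin> T \<and> (p j, a) \<in> \<epsilon> \<and> (j, c) \<in> \<eta>"
    using bspec[OF all red_top_indicator[OF assms]] red_top_equiv(1)[OF assms(1)] by simp
qed

end

text \<open>By \<open>red_link_iff\<close> the second word has an uncut strand between the same two
  classes, and in both words such a strand ends at the greatest vertices of these classes.\<close>

lemma reduced_edges:
  assumes r1: "reduced \<epsilon> T1 b1 e1 p1 \<eta>" and r2: "reduced \<epsilon> T2 b2 e2 p2 \<eta>"
    and rho: "rho (W \<epsilon> T1 b1 e1 p1 \<eta>) = rho (W \<epsilon> T2 b2 e2 p2 \<eta>)" and j: "p1 j \<notin> T1"
  shows "p2 j \<notin> T2 \<and> p2 j = p1 j"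
proof (cases "j \<in> {1..n}")
  case False
  then have "p1 j = j" "p2 j = j"
    using permutes_not_in[OF red_p[OF r1]] permutes_not_in[OF red_p[OF r2]] by auto
  then show ?thesis using False red_T[OF r2] by auto
next
  case True
  then have a: "p1 j \<in> {1..n}" using permutes_in_image[OF red_p[OF r1]] by blast
  have "\<exists>i. p1 i \<notin> T1 \<and> (p1 i, p1 j) \<in> \<epsilon> \<and> (i, j) \<in> \<eta>"
    using j red_top_equiv(1)[OF r1 a] red_bottom_equiv(1)[OF r1 True] by blast
  then have all: "\<forall>(f, g)\<in>rho (W \<epsilon> T1 b1 e1 p1 \<eta>). f (p1 j) = g j"
    using red_link_iff[OF r1 a] j by blast
  have "\<not> (p1 j \<in> T2 \<and> \<not> b2 (p1 j))"
    using red_top_dot_iff[OF r1, of "p1 j"] red_top_dot_iff[OF r2, of "p1 j"] rho j by auto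
  then obtain i where i: "p2 i \<notin> T2" "(p2 i, p1 j) \<in> \<epsilon>" "(i, j) \<in> \<eta>"
    using red_link_iff[OF r2 a, of j] all rho by auto
  have "i = j"
    using red_bottom_greatest[OF r2 i(1,3)] red_bottom_greatest[OF r1 j red_bottom_equiv(2)[OF r1 i(3)]] by simp
  moreover have "p2 i = p1 j"
    using red_top_greatest[OF r2 i(1,2)] red_top_greatest[OF r1 j red_top_equiv(2)[OF r1 i(2)]] by simp
  ultimately show ?thesis using i(1) by simp
qed

lemma reduced_unique:
  assumes r1: "reduced \<epsilon>1 T1 b1 e1 p1 \<eta>1" and r2: "reduced \<epsilon>2 T2 b2 e2 p2 \<eta>2"
    and rho: "rho (W \<epsilon>1 T1 b1 e1 p1 \<eta>1) = rho (W \<epsilon>2 T2 b2 e2 p2 \<eta>2)"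
  shows "W \<epsilon>1 T1 b1 e1 p1 \<eta>1 = W \<epsilon>2 T2 b2 e2 p2 \<eta>2"
proof -
  have \<epsilon>: "\<epsilon>1 = \<epsilon>2"
    by (intro equalityI subrelI; unfold red_top_iff[OF r1] red_top_iff[OF r2] rho; assumption)
  have \<eta>: "\<eta>1 = \<eta>2"
    by (intro equalityI subrelI; unfold red_bottom_iff[OF r1] red_bottom_iff[OF r2] rho; assumption)
  note r1' = r1[unfolded \<epsilon> \<eta>] and rho' = rho[unfolded \<epsilon> \<eta>]
  note edge1 = reduced_edges[OF r1' r2 rho'] and edge2 = reduced_edges[OF r2 r1' rho'[symmetric]]
  have T: "T1 = T2"
  proof -
    have "i \<in> T1 \<longleftrightarrow> i \<in> T2" for i
      using edge1[of "pinv p1 i"] edge2[of "pinv p2 i"] permutes_inverses(1)[OF red_p[OF r1], of i]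
        permutes_inverses(1)[OF red_p[OF r2], of i] by metis
    then show ?thesis by blast
  qed
  \<comment> \<open>The permutations may still differ on cut strands, so the words are compared
    through \<open>F_cong\<close> rather than component by component.\<close>
  have "F T1 b1 e1 p1 = F T1 b2 e2 p2"
  proof (rule F_cong[OF red_p[OF r1] red_p[OF r2] red_T[OF r1]])
    show "p1 j \<notin> T1 \<Longrightarrow> p1 j = p2 j" for j using edge1 by simp
    show "b1 i = b2 i" if "i \<in> T1" for i
      using red_top_dot_iff[OF r1, of i] red_top_dot_iff[OF r2, of i] rho that T by auto
    show "e1 (p1 j) = e2 (p2 j)" if "p1 j \<in> T1" for j
      using red_bottom_dot_iff[OF r1, of j] red_bottom_dot_iff[OF r2, of j] rho that T edge2[of j] by auto
  qed
  then show ?thesis by (simp add: W_def \<epsilon> \<eta> T)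
qed

lemma word_W:
  assumes "w \<in> lists (letters n)"
  shows "\<exists>\<epsilon> T b e p \<eta>. valid \<epsilon> T p \<eta> \<and> prod_list (map gen w) = W \<epsilon> T b e p \<eta>"
  using assms
proof (induction w rule: rev_induct)
  case Nil
  have "prod_list (map gen []) = W {} {} b e id {}" for b e
    by (simp only: W_def Qs_def F_def iprod_empty D_empty perm_id mult_1 list.map prod_list.Nil)
  moreover have "valid {} {} id {}" by (simp add: valid_def permutes_id[unfolded id_def] id_def)
  ultimately show ?case by blast
next
  case (snoc c w)
  then obtain \<epsilon> T b e p \<eta> where v: "valid \<epsilon> T p \<eta>" and w: "prod_list (map gen w) = W \<epsilon> T b e p \<eta>" by auto
  have mult: "prod_list (map gen (w @ [c])) = W \<epsilon> T b e p \<eta> * gen c" by (simp add: w)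
  have \<eta>: "\<eta> \<subseteq> {1..n} \<times> {1..n}" and T: "finite T" and p: "p permutes {1..n}"
    using v finite_subset by (auto simp: valid_def)
  show ?case
  proof (cases c)
    case (LS i)
    then have i: "1 \<le> i" "i < n" using snoc.prems by (auto simp: letters_def)
    define t where "t = transpose i (Suc i)"
    have t: "t permutes {1..n}" unfolding t_def by (rule transpose_permutes) (use i in auto)
    have s: "gen c = perm t" unfolding LS t_def using perm_transpose[OF i] by simp
    have ss: "perm t * perm t = 1" using s_square[OF i] s LS by simp
    have "Qs \<eta> * perm t = perm t * (perm t * Qs \<eta>) * perm t"
      using ss by (simp add: mult.assoc[symmetric])
    also have "\<dots> = perm t * Qs (map_prod t t ` \<eta>)"
      unfolding perm_Qs[OF t finite_rel[OF \<eta>]] using ss by (simp add: mult.assoc)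
    finally have "W \<epsilon> T b e p \<eta> * gen c = W \<epsilon> T b e (p \<circ> t) (map_prod t t ` \<eta>)"
      unfolding W_def s F_mult_perm[OF p t, symmetric] by (simp only: mult.assoc)
    moreover have "valid \<epsilon> T (p \<circ> t) (map_prod t t ` \<eta>)"
      unfolding valid_def
    proof (intro conjI)
      show "map_prod t t ` \<eta> \<subseteq> {1..n} \<times> {1..n}"
        using \<eta> permutes_in_image[OF t] by (auto simp del: atLeastAtMost_iff)
      show "p \<circ> t permutes {1..n}" by (rule permutes_compose[OF t p])
    qed (use v in \<open>simp_all add: valid_def\<close>)
    ultimately show ?thesis unfolding mult by blast
  next
    case LE
    obtain \<epsilon>' T' b' e' p' \<eta>' where r: "reduced \<epsilon>' T' b' e' p' \<eta>'" "W \<epsilon>' T' b' e' p' \<eta>' = W \<epsilon> T b e p \<eta>"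
      using exists_reduced[OF v] by blast
    show ?thesis unfolding mult unfolding LE by (rule red_mult_e[OF r(1), unfolded r(2)])
  next
    case LQ
    have "W \<epsilon> T b e p \<eta> * gen c = W \<epsilon> T b e p (insert (1, 2) \<eta>)"
      using Q_Qs_commute[OF finite_rel[OF \<eta>], of 1 2]
      unfolding W_def LQ Qs_insert[OF finite_rel[OF \<eta>]] Q_1_2 by (simp only: mult.assoc)
    moreover have "valid \<epsilon> T p (insert (1, 2) \<eta>)" using v one_in by (auto simp: valid_def)
    ultimately show ?thesis unfolding mult by blast
  next
    case LO
    have c: "gen c = G False 1" unfolding G_1 point_def LO by simp
    have "Qs \<eta> * G False 1 = G False 1 * Qs \<eta>"
      unfolding Qs_def
      by (rule iprod_commute[OF _ finite_rel[OF \<eta>], symmetric]) (auto simp: Q_O_commute)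
    then have "W \<epsilon> T b e p \<eta> * gen c = Qs \<epsilon> * (F T b e p * G False 1) * Qs \<eta>"
      unfolding W_def c by (simp add: mult.assoc)
    then have "W \<epsilon> T b e p \<eta> * gen c = W \<epsilon> (insert (p 1) T) (if p 1 \<in> T then b else b(p 1 := False)) (e(p 1 := False)) p \<eta>"
      unfolding W_def F_mult_G[OF T p] .
    moreover have "valid \<epsilon> (insert (p 1) T) p \<eta>"
      using v permutes_in_image[OF p, of 1] one_in(1) by (auto simp: valid_def)
    ultimately show ?thesis unfolding mult by blast
  qed
qed

theorem rho_injective:
  assumes "u \<in> lists (letters n)" "v \<in> lists (letters n)"
    and "rho (prod_list (map gen u)) = rho (prod_list (map gen v))"
  shows "prod_list (map gen u) = prod_list (map gen v)"
proof -
  obtain \<epsilon>1 T1 b1 e1 p1 \<eta>1 where "reduced \<epsilon>1 T1 b1 e1 p1 \<eta>1" "W \<epsilon>1 T1 b1 e1 p1 \<eta>1 = prod_list (map gen u)"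
    using word_W[OF assms(1)] exists_reduced by metis
  moreover obtain \<epsilon>2 T2 b2 e2 p2 \<eta>2 where "reduced \<epsilon>2 T2 b2 e2 p2 \<eta>2" "W \<epsilon>2 T2 b2 e2 p2 \<eta>2 = prod_list (map gen v)"
    using word_W[OF assms(2)] exists_reduced by metis
  ultimately show ?thesis using reduced_unique assms(3) by metis
qed

section \<open>Every rook partition is the diagram of a word\<close>

text \<open>\<open>'m\<close> may contain elements that no word reaches, so the submonoid generated
  by the letters is tracked separately.\<close>

definition words :: "'m set" where
  "words = (\<lambda>w. prod_list (map gen w)) ` lists (letters n)"

lemma words_one: "1 \<in> words"
  unfolding words_def by (rule image_eqI[of _ _ "[]"]) auto

lemma words_mult: "x \<in> words \<Longrightarrow> y \<in> words \<Longrightarrow> x * y \<in> words"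
proof -
  assume "x \<in> words" "y \<in> words"
  then obtain u v where "u \<in> lists (letters n)" "v \<in> lists (letters n)"
    "x = prod_list (map gen u)" "y = prod_list (map gen v)" unfolding words_def by blast
  then show "x * y \<in> words" unfolding words_def by (intro image_eqI[of _ _ "u @ v"]) auto
qed

lemma words_gen: "c \<in> letters n \<Longrightarrow> gen c \<in> words"
  unfolding words_def by (rule image_eqI[of _ _ "[c]"]) auto

lemma words_prod_list: "(\<And>x. x \<in> set xs \<Longrightarrow> x \<in> words) \<Longrightarrow> prod_list xs \<in> words"
  by (induction xs) (simp_all add: words_one words_mult)

lemma words_perm: "p permutes {1..n} \<Longrightarrow> perm p \<in> words"
proof -
  assume "p permutes {1..n}"
  then obtain w where w: "set w \<subseteq> {1..<n}" "tprod w = p" using permutation_word by blast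
  have "s i \<in> words" if "i \<in> set w" for i
    by (intro words_gen s_letter) (use that w(1) in auto)
  then have "prod_list (map s w) \<in> words" by (intro words_prod_list) auto
  then show "perm p \<in> words" using perm_tprod[OF w(1)] w(2) by (simp add: sprod_def)
qed

lemma words_G: "G c i \<in> words"
proof (cases "i \<in> {1..n}")
  case True
  then show ?thesis unfolding G_def point_def
    using words_perm[OF transpose_permutes[OF one_in(1) True]] other_letters
    by (auto intro!: words_mult words_gen)
qed (simp add: G_outside words_one del: atLeastAtMost_iff)

lemma words_Q: "Q i j \<in> words"
proof (cases "i \<in> {1..n} \<and> j \<in> {1..n} \<and> i \<noteq> j")
  case True
  then show ?thesis unfolding Q_def Let_def
    using words_perm[OF perm_SOME(1)] words_perm[OF permutes_inv[OF perm_SOME(1)]] other_letters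
    by (auto intro!: words_mult words_gen)
qed (simp add: Q_outside words_one del: atLeastAtMost_iff)

lemma words_iprod: "finite A \<Longrightarrow> (\<And>a. a \<in> A \<Longrightarrow> g a \<in> words) \<Longrightarrow> iprod g A \<in> words"
  by (rule iprod_list[of A g]) (auto intro!: words_prod_list)

lemma words_W: "valid \<epsilon> T p \<eta> \<Longrightarrow> W \<epsilon> T b e p \<eta> \<in> words"
  unfolding W_def F_def Qs_def D_def H_def valid_def
  by (intro words_mult words_iprod words_perm)
    (auto intro: words_G words_Q words_mult finite_rel finite_subset)

text \<open>Each transversal block, meeting both rows, contributes one uncut strand between chosen
  vertices \<open>x C\<close> and \<open>y C\<close>. All other vertices are cut, with colour
  \<open>True\<close> if they lie in a block, and \<open>\<epsilon>\<close> and
  \<open>\<eta>\<close> restore the parts of the blocks in the two rows.\<close>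

lemma rho_surjective:
  assumes A: "A \<in> rook_partitions n"
  shows "\<exists>w\<in>lists (letters n). rho (prod_list (map gen w)) = colouring_rel n A"
proof -
  note disj = disjointE[OF rook_partitionsD(1)[OF A]]
  have range: "v \<in> verts n" if "C \<in> A" "v \<in> C" for C v using that rook_partitionsD(3)[OF A] by blast
  define TB where "TB = {C \<in> A. (\<exists>i. Up i \<in> C) \<and> (\<exists>j. Lo j \<in> C)}"
  define x where "x C = (SOME i. Up i \<in> C)" for C
  define y where "y C = (SOME j. Lo j \<in> C)" for C
  have x: "Up (x C) \<in> C" and y: "Lo (y C) \<in> C" and TB: "C \<in> A" if "C \<in> TB" for C
    using that someI_ex[of "\<lambda>i. Up i \<in> C"] someI_ex[of "\<lambda>i. Lo i \<in> C"]
    by (auto simp: TB_def x_def y_def)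
  have xr: "x C \<in> {1..n}" and yr: "y C \<in> {1..n}" if "C \<in> TB" for C
    using range[OF TB x, OF that that] range[OF TB y, OF that that] by simp_all
  have xinj: "C = C'" if "C \<in> TB" "C' \<in> TB" "x C = x C'" for C C'
    using disj[OF TB TB x, OF that(1,2,1)] x[OF that(2)] that(3) by simp
  have yinj: "C = C'" if "C \<in> TB" "C' \<in> TB" "y C = y C'" for C C'
    using disj[OF TB TB y, OF that(1,2,1)] y[OF that(2)] that(3) by simp
  have "inj_on y TB" using yinj by (auto intro: inj_onI)
  then have the_inv: "the_inv_into TB y (y C) = C" if "C \<in> TB" for C using that by (rule the_inv_into_f_f)
  \<comment> \<open>The uncut strands prescribe \<open>p\<close> at the vertices \<open>y C\<close>;
    any completion serves for the cut ones.\<close>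
  have "\<exists>p. p permutes {1..n} \<and> (\<forall>a\<in>y ` TB. p a = (x \<circ> the_inv_into TB y) a)"
  proof (rule extend_to_permutation)
    show "inj_on (x \<circ> the_inv_into TB y) (y ` TB)"
      by (auto intro!: inj_onI simp: the_inv dest: xinj)
  qed (use xr yr in \<open>auto simp: the_inv\<close>)
  then obtain p where p: "p permutes {1..n}" "\<And>C. C \<in> TB \<Longrightarrow> p (y C) = x C"
    by (auto simp: the_inv)
  define T where "T = {1..n} - x ` TB"
  define \<epsilon> where "\<epsilon> = {(i, k). \<exists>C\<in>A. Up i \<in> C \<and> Up k \<in> C}"
  define \<eta> where "\<eta> = {(i, k). \<exists>C\<in>A. Lo i \<in> C \<and> Lo k \<in> C}"
  define b where "b i \<longleftrightarrow> Up i \<in> \<Union>A" for i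
  \<comment> \<open>Lower colours are indexed by the top vertex \<open>p j\<close>, hence the
    inverse.\<close>
  define e where "e i \<longleftrightarrow> Lo (pinv p i) \<in> \<Union>A" for i
  have ep: "e (p j) \<longleftrightarrow> Lo j \<in> \<Union>A" for j using permutes_inverses(2)[OF p(1)] by (simp add: e_def)
  have sub: "\<epsilon> \<subseteq> {1..n} \<times> {1..n}" "\<eta> \<subseteq> {1..n} \<times> {1..n}" "T \<subseteq> {1..n}"
  proof -
    show "\<epsilon> \<subseteq> {1..n} \<times> {1..n}" unfolding \<epsilon>_def using range[of _ "Up _"] by fastforce
    show "\<eta> \<subseteq> {1..n} \<times> {1..n}" unfolding \<eta>_def using range[of _ "Lo _"] by fastforce
  qed (simp add: T_def)
  have edge: "p j \<notin> T \<longleftrightarrow> j \<notin> {1..n} \<or> j \<in> y ` TB" for j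
  proof -
    have "p j \<in> x ` TB \<longleftrightarrow> j \<in> y ` TB"
    proof
      assume "p j \<in> x ` TB"
      then obtain C where C: "C \<in> TB" "p j = p (y C)" using p(2) by auto
      then have "j = y C" using permutes_inj[OF p(1)] by (simp add: inj_eq)
      with C show "j \<in> y ` TB" by blast
    qed (use p(2) in auto)
    then show ?thesis using permutes_in_image[OF p(1), of j] by (auto simp: T_def simp del: atLeastAtMost_iff)
  qed
  have "(f, g) \<in> rho (W \<epsilon> T b e p \<eta>) \<longleftrightarrow> (f, g) \<in> colouring_rel n A" for f g
  proof
    assume "(f, g) \<in> rho (W \<epsilon> T b e p \<eta>)"
    note r = this[unfolded rho_W[OF sub p(1)]]
    have r1: "f i = f k" if "(i, k) \<in> \<epsilon>" for i k using bspec[OF conjunct1[OF r] that] by simp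
    have r2: "g i = g k" if "(i, k) \<in> \<eta>" for i k using bspec[OF conjunct1[OF conjunct2[OF r]] that] by simp
    have r3: "f (p j) = g j" if "p j \<notin> T" for j using r that by simp
    have r4: "\<not> f i" if "i \<in> T" "\<not> b i" for i using r that by simp
    have r5: "\<not> g j" if "p j \<in> T" "\<not> e (p j)" for j using r that by simp
    have cross: "f i = g k" if "C \<in> A" "Up i \<in> C" "Lo k \<in> C" for C i k
    proof -
      have C: "C \<in> TB" using that by (auto simp: TB_def)
      have "f i = f (x C)" by (rule r1) (use that x[OF C] in \<open>auto simp: \<epsilon>_def\<close>)
      also have "\<dots> = g (y C)" using r3[of "y C"] C p(2)[OF C] edge[of "y C"] by auto
      also have "\<dots> = g k" by (rule r2) (use that y[OF C] in \<open>auto simp: \<eta>_def\<close>)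
      finally show ?thesis .
    qed
    have blocks: "val f g g u = val f g g v" if C: "C \<in> A" "u \<in> C" "v \<in> C" for C u v
    proof -
      have "u \<in> verts n" "v \<in> verts n" using range C by blast+
      then show ?thesis
        using C cross[OF C(1)] r1 r2
        by (cases u; cases v) (auto simp: \<epsilon>_def \<eta>_def, (metis)+)
    qed
    have dots: "\<not> val f g g v" if v: "v \<in> verts n - \<Union>A" for v
    proof (cases v)
      case (Up i)
      then have "i \<in> T" using v x TB by (auto simp: T_def)
      then show ?thesis using r4[of i] v Up by (simp add: b_def)
    next
      case (Lo j)
      then have "p j \<in> T" using v y TB edge[of j] by auto
      then show ?thesis using r5[of j] v Lo by (simp add: ep)
    qed (use v in simp)
    have "f i = g i" if "i \<notin> {1..n}" for i
      using r3[of i] edge[of i] that permutes_not_in[OF p(1) that] by simp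
    then show "(f, g) \<in> colouring_rel n A"
      unfolding colouring_rel_def compatible_def using blocks dots by blast
  next
    assume fg: "(f, g) \<in> colouring_rel n A"
    then have out: "\<And>i. i \<notin> {1..n} \<Longrightarrow> f i = g i"
      and blocks: "\<And>C u v. C \<in> A \<Longrightarrow> u \<in> C \<Longrightarrow> v \<in> C \<Longrightarrow> val f g g u = val f g g v"
      and dots: "\<And>v. v \<in> verts n - \<Union>A \<Longrightarrow> \<not> val f g g v"
      unfolding colouring_rel_def compatible_def by blast+
    show "(f, g) \<in> rho (W \<epsilon> T b e p \<eta>)"
      unfolding rho_W[OF sub p(1)]
    proof (intro conjI allI impI ballI)
      fix r assume "r \<in> \<epsilon>"
      then obtain i k C where "r = (i, k)" "C \<in> A" "Up i \<in> C" "Up k \<in> C" unfolding \<epsilon>_def by blast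
      then show "case r of (i, j) \<Rightarrow> f i = f j" using blocks[of C "Up i" "Up k"] by simp
    next
      fix r assume "r \<in> \<eta>"
      then obtain i k C where "r = (i, k)" "C \<in> A" "Lo i \<in> C" "Lo k \<in> C" unfolding \<eta>_def by blast
      then show "case r of (i, j) \<Rightarrow> g i = g j" using blocks[of C "Lo i" "Lo k"] by simp
    next
      fix j assume "p j \<notin> T"
      then consider "j \<notin> {1..n}" | C where "C \<in> TB" "j = y C" using edge by blast
      then show "f (p j) = g j"
      proof cases
        case 1
        then show ?thesis using permutes_not_in[OF p(1)] out by simp
      next
        case 2
        then show ?thesis using p(2) blocks[OF TB x y, of C] by simp
      qed
    next
      fix i assume "i \<in> T" "\<not> b i"
      then show "\<not> f i" using dots[of "Up i"] sub(3) by (auto simp: b_def)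
    next
      fix j assume "p j \<in> T" "\<not> e (p j)"
      moreover from this have "j \<in> {1..n}" using edge by blast
      ultimately show "\<not> g j" using dots[of "Lo j"] by (auto simp: ep)
    qed
  qed
  then have "rho (W \<epsilon> T b e p \<eta>) = colouring_rel n A" by (intro equalityI subrelI) simp_all
  moreover have "W \<epsilon> T b e p \<eta> \<in> words" by (rule words_W) (use sub p(1) in \<open>simp add: valid_def\<close>)
  ultimately show ?thesis unfolding words_def by force
qed

end

section \<open>The presentation\<close>

text \<open>\<open>monoid_mult\<close> requires a type, whereas the congruence is a variable set.
  Functions on sets of words form a fixed monoid in which words act on the classes of any
  congruence; the second component carries the diagram, so that \<open>col\<close> can serve as
  \<open>rho\<close>.\<close>

datatype 'a action = Action (act: "'a \<Rightarrow> 'a") (col: "(nat \<Rightarrow> bool) rel")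

instantiation action :: (type) monoid_mult
begin

definition one_action :: "'a action" where "1 = Action id Id"

definition times_action :: "'a action \<Rightarrow> 'a action \<Rightarrow> 'a action" where
  "a * b = Action (act a \<circ> act b) (col a O col b)"

instance
proof
  fix a b c :: "'a action"
  show "a * b * c = a * (b * c)" by (simp only: times_action_def action.sel comp_assoc O_assoc)
  show "1 * a = a" "a * 1 = a"
    by (simp_all only: one_action_def times_action_def action.sel id_comp comp_id Id_O_R R_O_Id action.collapse)
qed

end

text \<open>The action is made trivial off the congruence classes, so that words that are congruent act
  equally on all sets of words.\<close>

definition left_mult :: "'a set \<Rightarrow> 'a list rel \<Rightarrow> 'a \<Rightarrow> 'a list set \<Rightarrow> 'a list set" where
  "left_mult X r c C = (if C \<in> lists X // r then r `` ((#) c ` C) else C)"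

definition class_action :: "nat \<Rightarrow> letter list rel \<Rightarrow> letter \<Rightarrow> letter list set action" where
  "class_action n r c = Action (left_mult (letters n) r c) (sem c)"

lemma col_class_action: "col (prod_list (map (class_action n r) w)) = sem_word w"
  by (induction w) (simp_all add: one_action_def times_action_def class_action_def sem_word_Cons)

lemma act_class_action_outside:
  "C \<notin> lists (letters n) // r \<Longrightarrow> act (prod_list (map (class_action n r) w)) C = C"
  by (induction w) (simp_all add: one_action_def times_action_def class_action_def left_mult_def)

context
  fixes n :: nat and r :: "letter list rel"
  assumes r: "monoid_congruence (free_monoid (letters n)) r"
begin

lemma congruence_equiv: "equiv (lists (letters n)) r"
  using r by (simp add: monoid_congruence_def free_monoid_def)

lemma congruence_append: "(a, b) \<in> r \<Longrightarrow> (c, d) \<in> r \<Longrightarrow> (a @ c, b @ d) \<in> r"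
  using r by (auto simp: monoid_congruence_def free_monoid_def)

lemma congruence_refl: "u \<in> lists (letters n) \<Longrightarrow> (u, u) \<in> r"
  using congruence_equiv by (meson equivE refl_onD)

lemma act_class_action:
  assumes "w \<in> lists (letters n)" "u \<in> lists (letters n)"
  shows "act (prod_list (map (class_action n r) w)) (r `` {u}) = r `` {w @ u}"
  using assms(1)
proof (induction w)
  case Nil
  show ?case by (simp add: one_action_def)
next
  case (Cons c w)
  let ?v = "w @ u"
  have v: "?v \<in> lists (letters n)" "[c] \<in> lists (letters n)" using Cons assms(2) by auto
  have "r `` {?v} \<in> lists (letters n) // r" by (rule quotientI[OF v(1)])
  then have "act (prod_list (map (class_action n r) (c # w))) (r `` {u}) = r `` ((#) c ` (r `` {?v}))"
    using Cons by (simp add: times_action_def class_action_def[of n r c] left_mult_def)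
  also have "\<dots> = r `` {c # ?v}"
  proof (intro equalityI subsetI)
    fix z assume "z \<in> r `` ((#) c ` (r `` {?v}))"
    then obtain v' where v': "(?v, v') \<in> r" "(c # v', z) \<in> r" by blast
    have "(c # ?v, c # v') \<in> r" using congruence_append[OF congruence_refl[OF v(2)] v'(1)] by simp
    then show "z \<in> r `` {c # ?v}" using v'(2) congruence_equiv by (blast elim: equivE dest: transD)
  next
    fix z assume "z \<in> r `` {c # ?v}"
    then show "z \<in> r `` ((#) c ` (r `` {?v}))" using congruence_refl[OF v(1)] by blast
  qed
  finally show ?case by simp
qed

text \<open>Related words act equally on classes because the congruence contains the relations;
  their diagrams agree by soundness, \<open>sem_relation\<close>.\<close>

lemma rook_presentation_class_action:
  assumes "n \<ge> 2" "relations n \<subseteq> r"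
  shows "rook_presentation n (class_action n r) col"
proof
  show "n \<ge> 2" by (rule assms(1))
  show "col (x * y) = col x O col y" for x y :: "letter list set action" by (simp add: times_action_def)
  show "col (1 :: letter list set action) = Id" by (simp add: one_action_def)
  show "col (class_action n r c) = sem c" for c by (simp add: class_action_def)
  fix u v assume uv: "(u, v) \<in> relations n"
  then have lists: "u \<in> lists (letters n)" "v \<in> lists (letters n)" and rel: "(u, v) \<in> r"
    using assms(2) by (auto simp: relations_def)
  let ?u = "prod_list (map (class_action n r) u)" and ?v = "prod_list (map (class_action n r) v)"
  have "col ?u = col ?v"
    unfolding col_class_action by (rule sem_relation) (use uv in \<open>simp add: relations_def\<close>)
  moreover have "act ?u C = act ?v C" for C
  proof (cases "C \<in> lists (letters n) // r")
    case True
    then obtain w where w: "w \<in> lists (letters n)" "C = r `` {w}" by (rule quotientE)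
    have "(u @ w, v @ w) \<in> r" by (rule congruence_append[OF rel congruence_refl[OF w(1)]])
    then show ?thesis
      unfolding w(2) act_class_action[OF lists(1) w(1)] act_class_action[OF lists(2) w(1)]
      by (rule equiv_class_eq[OF congruence_equiv])
  next
    case False
    then show ?thesis by (simp add: act_class_action_outside)
  qed
  ultimately show "?u = ?v" by (intro action.expand conjI ext) auto
qed

text \<open>Words with equal diagrams are equal as actions. Evaluated at the class of the empty
  word, these return the classes of \<open>u\<close> and \<open>v\<close>.\<close>

lemma congruence_contains_kernel:
  assumes "n \<ge> 2" "relations n \<subseteq> r"
    and uv: "u \<in> lists (letters n)" "v \<in> lists (letters n)" "sem_word u = sem_word v"
  shows "(u, v) \<in> r"
proof -
  interpret rook_presentation n "class_action n r" col
    by (rule rook_presentation_class_action[OF assms(1,2)])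
  have "prod_list (map (class_action n r) u) = prod_list (map (class_action n r) v)"
    by (rule rho_injective[OF uv(1,2)]) (simp only: col_class_action uv(3))
  then have "r `` {u @ []} = r `` {v @ []}"
    using act_class_action[OF uv(1) lists.Nil] act_class_action[OF uv(2) lists.Nil] by simp
  then show ?thesis using eq_equiv_class[OF _ congruence_equiv uv(2)] by simp
qed

end

theorem theorem4p11:
  fixes n :: nat
  assumes "n \<ge> 2"
  shows "has_monoid_presentation (rook_monoid n) (letters n) (relations n) (xi n)"
proof -
  let ?M = "free_monoid (letters n)"
  define K where "K = kernel_rel ?M (xi n)"
  have xi_append: "xi n (u @ v) = rook_product n (xi n u) (xi n v)"
    if "u \<in> lists (letters n)" "v \<in> lists (letters n)" for u v
    by (rule colouring_rel_inj[of _ n])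
      (use xi_word[OF assms] that in \<open>simp_all add: rook_product_closed colouring_rel_product sem_word_append\<close>)
  have xi_eq: "xi n u = xi n v \<longleftrightarrow> sem_word u = sem_word v"
    if "u \<in> lists (letters n)" "v \<in> lists (letters n)" for u v
    using xi_word[OF assms that(1)] xi_word[OF assms that(2)] colouring_rel_inj by metis
  have K: "(u, v) \<in> K \<longleftrightarrow> u \<in> lists (letters n) \<and> v \<in> lists (letters n) \<and> xi n u = xi n v" for u v
    by (simp add: K_def kernel_rel_def free_monoid_def)
  have cong: "monoid_congruence ?M K"
    unfolding monoid_congruence_def
  proof (intro conjI)
    show "equiv (carrier ?M) K"
      by (rule equivI) (auto simp: free_monoid_def refl_on_def sym_def trans_def K)
    show "\<forall>(a, b)\<in>K. \<forall>(c, d)\<in>K. (a \<otimes>\<^bsub>?M\<^esub> c, b \<otimes>\<^bsub>?M\<^esub> d) \<in> K"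
      using xi_append by (auto simp: K free_monoid_def)
  qed
  have relations: "relations n \<subseteq> K"
  proof (intro subrelI)
    fix u v assume "(u, v) \<in> relations n"
    then have uv: "(u, v) \<in> all_relations" "u \<in> lists (letters n)" "v \<in> lists (letters n)"
      by (simp_all add: relations_def)
    with xi_eq[OF uv(2,3)] sem_relation[OF uv(1)] show "(u, v) \<in> K" unfolding K by blast
  qed
  have hom: "is_monoid_hom ?M (rook_monoid n) (xi n)"
  proof -
    have "xi n [] = \<one>\<^bsub>rook_monoid n\<^esub>" by (simp add: xi_def word_hom_def)
    then show ?thesis
      using xi_append xi_word[OF assms]
      by (auto simp: is_monoid_hom_def hom_def free_monoid_def rook_monoid_def)
  qed
  have surj: "xi n ` carrier ?M = carrier (rook_monoid n)"
  proof (intro equalityI subsetI)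
    fix A assume "A \<in> carrier (rook_monoid n)"
    then have A: "A \<in> rook_partitions n" by (simp add: rook_monoid_def)
    \<comment> \<open>The kernel itself serves as the congruence; what is taken from the locale is a
      word realising the relation of \<open>A\<close>.\<close>
    interpret rook_presentation n "class_action n K" col
      by (rule rook_presentation_class_action[OF cong assms relations])
    obtain w where w: "w \<in> lists (letters n)" "sem_word w = colouring_rel n A"
      using rho_surjective[OF A] by (auto simp: col_class_action)
    have "xi n w = A"
      by (rule colouring_rel_inj[of _ n]) (use xi_word[OF assms w(1)] A w(2) in simp_all)
    then show "A \<in> xi n ` carrier ?M" using w(1) by (auto simp: free_monoid_def)
  qed (use xi_word[OF assms] in \<open>auto simp: free_monoid_def rook_monoid_def\<close>)
  \<comment> \<open>Every congruence containing the relations yields its own instance of the locale,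
    and so contains \<open>K\<close>.\<close>
  have "K \<subseteq> generated_congruence ?M (relations n)"
    unfolding generated_congruence_def
  proof (intro subrelI InterI)
    fix u v r assume "(u, v) \<in> K" and r: "r \<in> {r. monoid_congruence ?M r \<and> relations n \<subseteq> r}"
    then have uv: "u \<in> lists (letters n)" "v \<in> lists (letters n)" "xi n u = xi n v" unfolding K by blast+
    have "monoid_congruence ?M r" "relations n \<subseteq> r" using r by simp_all
    from congruence_contains_kernel[OF this(1) assms this(2) uv(1,2)] show "(u, v) \<in> r"
      using xi_eq[OF uv(1,2)] uv(3) by blast
  qed
  moreover have "generated_congruence ?M (relations n) \<subseteq> K"
    unfolding generated_congruence_def using cong relations by blast
  ultimately show ?thesis
    unfolding has_monoid_presentation_def
    using monoid_rook_monoid hom surj by (auto simp: K_def relations_def)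
qed

end
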